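(* Let $r\ge 2$, let $\boldsymbol{k}=(k_1,\dots,k_r)\in\mathbb{N}^r$ have weight $w=k_1+\cdots+k_r$, and let $\boldsymbol{\sigma}=(\sigma_1,\dots,\sigma_r)$, $\boldsymbol{\varepsilon}=(\varepsilon_1,\dots,\varepsilon_r)\in\{\pm1\}^r$ with $(k_1,\sigma_1)\ne(1,1)$. Then $$\Big(1-(-1)^{r+w}\prod_{j=1}^r \iota(\sigma_j,\varepsilon_j)\Big)\, M_{\boldsymbol{\sigma}}^{\boldsymbol{\varepsilon}}(\boldsymbol{k})\in \mathsf{AMMV}_w^{<r},$$ where $\iota(\sigma,\varepsilon)=-1$ if $\sigma=\varepsilon=-1$ and $\iota(\sigma,\varepsilon)=1$ otherwise.
   Context: $\mathbb{N}$ is the set of positive integers. For $\boldsymbol{k}\in\mathbb{N}^r$ and $\boldsymbol{\sigma},\boldsymbol{\varepsilon}\in\{\pm1\}^r$ with $(k_1,\sigma_1)\neq(1,1)$ (the admissible case, equivalent to convergence), the alternating multiple mixed value (AMMV) of weight $k_1+\cdots+k_r$ and depth $r$ is the real number $$M_{\boldsymbol{\sigma}}^{\boldsymbol{\varepsilon}}(\boldsymbol{k})=\sum_{m_1>\cdots>m_r>0}\ \prod_{j=1}^r\frac{(1+\varepsilon_j(-1)^{m_j})\,\sigma_j^{(2m_j+1-\varepsilon_j)/4}}{m_j^{k_j}}$$ (only terms with $m_j$ even when $\varepsilon_j=1$ and $m_j$ odd when $\varepsilon_j=-1$ are nonzero, so the exponent of $\sigma_j$ is the integer $m_j/2$ or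 $(m_j+1)/2$ respectively; the series is the limit of its partial sums over $m_1\le N$). For $d,w\in\mathbb{N}$ let $\mathsf{AMMV}_w^d$ be the $\mathbb{Q}$-span in $\mathbb{R}$ of all admissible AMMVs of weight $w$ and depth $d$. For $w\ge d\ge2$ define $$\mathsf{AMMV}_w^{<d}=\sum_{0<\ell<d}\mathsf{AMMV}_w^{\ell}+\sum_{\substack{w_1+w_2=w,\ w_1,w_2>0\\ d_1+d_2=d,\ d_1,d_2>0}}\mathsf{AMMV}_{w_1}^{d_1}\cdot\mathsf{AMMV}_{w_2}^{d_2},$$ where $U\cdot V$ denotes the $\mathbb{Q}$-span of all products $uv$ with $u\in U$, $v\in V$. *)

theory Defs
  imports "HOL-Analysis.Analysis" "HOL-Library.Set_Algebras"
begin

interpretation real_rat: vector_space "\<lambda>(q::rat) (x::real). of_rat q * x"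
  by standard (simp_all add: algebra_simps of_rat_add of_rat_mult)

abbreviation span_rat :: "real set \<Rightarrow> real set"
  where "span_rat \<equiv> module.span (\<lambda>(q::rat) (x::real). of_rat q * x)"

text \<open>
  An index \<open>(k\<^sub>1, \<dots>, k\<^sub>r)\<close> and the sign vectors \<open>(\<sigma>\<^sub>1, \<dots>, \<sigma>\<^sub>r)\<close>, \<open>(\<epsilon>\<^sub>1, \<dots>, \<epsilon>\<^sub>r)\<close> are lists of length \<open>r\<close>;
  the entry \<open>k\<^sub>j\<close> is \<open>k ! (j - 1)\<close>.
\<close>

definition admissible :: "nat list \<Rightarrow> int list \<Rightarrow> int list \<Rightarrow> bool" where
  "admissible k \<sigma> \<epsilon> \<longleftrightarrow>
     k \<noteq> [] \<and> length \<sigma> = length k \<and> length \<epsilon> = length k \<and>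
     (\<forall>x\<in>set k. x > 0) \<and> set \<sigma> \<subseteq> {1, -1} \<and> set \<epsilon> \<subseteq> {1, -1} \<and>
     (k ! 0, \<sigma> ! 0) \<noteq> (1, 1)"

text \<open>
  The exponent \<open>(2m + 1 - \<epsilon>)/4\<close> of \<open>\<sigma>\<close> is an integer whenever \<open>1 + \<epsilon>(-1)\<^sup>m \<noteq> 0\<close>. In the
  other case the factor vanishes and the rounding done by \<open>div\<close> is immaterial.
\<close>

definition ammv_factor :: "nat \<Rightarrow> int \<Rightarrow> int \<Rightarrow> nat \<Rightarrow> real" where
  "ammv_factor k \<sigma> \<epsilon> m =
     (1 + of_int \<epsilon> * (-1) ^ m) * of_int \<sigma> powi ((2 * int m + 1 - \<epsilon>) div 4) / real m ^ k"

definition ammv_partial :: "nat list \<Rightarrow> int list \<Rightarrow> int list \<Rightarrow> nat \<Rightarrow> real" where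
  "ammv_partial k \<sigma> \<epsilon> N =
     (\<Sum>m | length m = length k \<and> sorted_wrt (>) m \<and> set m \<subseteq> {1..N}.
        \<Prod>j<length k. ammv_factor (k ! j) (\<sigma> ! j) (\<epsilon> ! j) (m ! j))"

definition ammv :: "nat list \<Rightarrow> int list \<Rightarrow> int list \<Rightarrow> real" where
  "ammv k \<sigma> \<epsilon> = lim (ammv_partial k \<sigma> \<epsilon>)"

definition AMMV :: "nat \<Rightarrow> nat \<Rightarrow> real set" where
  "AMMV w d = span_rat {ammv k \<sigma> \<epsilon> | k \<sigma> \<epsilon>. admissible k \<sigma> \<epsilon> \<and> sum_list k = w \<and> length k = d}"

text \<open>
  Sums of subspaces and products \<open>U * V = {u * v | u \<in> U, v \<in> V}\<close> are the elementwise
  operations on sets; an empty sum of subspaces is \<open>{0}\<close>.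
\<close>

definition AMMV_lower :: "nat \<Rightarrow> nat \<Rightarrow> real set" where
  "AMMV_lower w d =
     (\<Sum>l\<in>{0<..<d}. AMMV w l) +
     (\<Sum>(w1, w2, d1, d2) \<in> {(w1, w2, d1, d2). w1 + w2 = w \<and> w1 > 0 \<and> w2 > 0 \<and>
                                         d1 + d2 = d \<and> d1 > 0 \<and> d2 > 0}.
        span_rat (AMMV w1 d1 * AMMV w2 d2))"

text \<open>The index set of the second sum is finite, so that this sum is a genuine one.\<close>

lemma finite_AMMV_lower_index:
  "finite {(w1, w2, d1, d2). w1 + w2 = (w::nat) \<and> w1 > 0 \<and> w2 > 0 \<and>
                             d1 + d2 = (d::nat) \<and> d1 > 0 \<and> d2 > 0}"
  by (rule finite_subset[of _ "{..w} \<times> {..w} \<times> {..d} \<times> {..d}"]) auto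

text \<open>Likewise for the sum over decreasing tuples in the partial sums.\<close>

lemma finite_ammv_partial_index:
  "finite {m. length m = r \<and> sorted_wrt (>) m \<and> set m \<subseteq> {1..N::nat}}"
  by (rule finite_subset[OF _ finite_lists_length_eq[of "{1..N}" r]]) auto

definition iota :: "int \<Rightarrow> int \<Rightarrow> int" where
  "iota \<sigma> \<epsilon> = (if \<sigma> = -1 \<and> \<epsilon> = -1 then -1 else 1)"

end

theory Submission
  imports Defs
begin

text \<open>
  Write a mixed value as a sum over \<open>m\<^sub>1 > \<dots> > m\<^sub>r > 0\<close> of products of \<open>\<chi>\<^sub>j(m\<^sub>j) / m\<^sub>j ^ k\<^sub>j\<close> with rational
  \<open>\<chi>\<^sub>j\<close> of period 4, and let \<open>p\<close> and \<open>m\<^sub>1 > \<dots> > m\<^sub>r\<close> run over distinct integers of a window \<open>[0, N]\<close>, with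
  summand the product of the \<open>\<chi>\<^sub>j(m\<^sub>j - p) / (m\<^sub>j - p) ^ k\<^sub>j\<close>. Splitting at the position of \<open>p\<close> gives
  convolutions of truncated sums; up to products, the two extreme ones are the value of the word and,
  up to the sign \<open>(-1)\<^sup>w \<Prod> \<iota>\<close>, the value of the reversed word, which by the antipode of the
  quasi-shuffle algebra is \<open>(-1)\<^sup>r\<^sup>-\<^sup>1\<close> times the former. Partial fractions in \<open>p\<close> express the same sum
  through sums centred at some \<open>m\<^sub>j\<close>, where \<open>p\<close> becomes a further summation variable attached to a
  single power \<open>1 / (p - m\<^sub>j) ^ l\<close>; these only contribute products and lower depth. The generating
  function in \<open>N\<close> turns convolutions into products. Divergent truncated sums are handled by
  expanding in powers of \<open>-ln (1 - x)\<close> as \<open>x\<close> tends to 1 and comparing constant terms.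
\<close>

section \<open>Words and the quasi-shuffle product\<close>

text \<open>An admissible word read backwards may begin with a divergent letter, so the reversed
  words need not have values at all; this obstacle shapes the proof. That constant comes with a
  derivation of \<open>log_reg\<close>; the uniqueness of the Abel expansion shows that it is
  determined by the sequence, and its multiplicativity under convolution allows the two evaluations
  of the window sum to be compared. After centring at m_j the characters still see m_i - p.
  Periodicity repairs this: they depend on p only through the residue of p - m_j modulo 4, so fixing
  that residue decouples p from the other variables. With V the value, c the regularized value of
  the reversed word and s = (-1)^w times the product of the \<open>iota\<close>, the window gives V
  + s c = 0 modulo lower terms. Inserting c = (-1)^(r-1) V from the antipode leaves the factor 1 -
  (-1)^r s.\<close>

text \<open>
  Allowing arbitrary rational characters modulo 4 instead of the functions indexed by \<open>(\<sigma>, \<epsilon>)\<close> makes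
  letters closed under multiplication and translation.
\<close>

type_synonym letter = "nat \<times> (int \<Rightarrow> real)"

definition letter_fun :: "letter \<Rightarrow> int \<Rightarrow> real" where
  "letter_fun a m = snd a m / of_int m ^ fst a"

definition letter_mult :: "letter \<Rightarrow> letter \<Rightarrow> letter" where
  "letter_mult a b = (fst a + fst b, \<lambda>m. snd a m * snd b m)"

lemma letter_fun_mult: "letter_fun (letter_mult a b) m = letter_fun a m * letter_fun b m"
  by (simp add: letter_fun_def letter_mult_def power_add)

lemma fst_letter_mult [simp]: "fst (letter_mult a b) = fst a + fst b"
  by (simp add: letter_mult_def)

lemma snd_letter_mult [simp]: "snd (letter_mult a b) m = snd a m * snd b m"
  by (simp add: letter_mult_def)

fun nsum :: "letter list \<Rightarrow> nat \<Rightarrow> real" where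
  "nsum [] N = 1"
| "nsum (a # ws) N = (\<Sum>m=1..N. letter_fun a (int m) * nsum ws (m - 1))"

declare nsum.simps(2) [simp del]

lemma nsum_Cons_0 [simp]: "nsum (a # ws) 0 = 0"
  by (simp add: nsum.simps)

lemma nsum_Cons_Suc: "nsum (a # ws) (Suc N) = nsum (a # ws) N + letter_fun a (int (Suc N)) * nsum ws N"
  by (simp add: nsum.simps)

definition weight :: "letter list \<Rightarrow> nat" where
  "weight ws = sum_list (map fst ws)"

lemma weight_simps [simp]:
  "weight [] = 0" "weight (a # ws) = fst a + weight ws" "weight (us @ vs) = weight us + weight vs"
  "weight (rev us) = weight us"
  by (simp_all add: weight_def flip: rev_map)

fun qshuffle :: "letter list \<Rightarrow> letter list \<Rightarrow> letter list list" where
  "qshuffle [] vs = [vs]"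
| "qshuffle us [] = [us]"
| "qshuffle (u # us) (v # vs) =
     map ((#) u) (qshuffle us (v # vs)) @ map ((#) v) (qshuffle (u # us) vs) @
     map ((#) (letter_mult u v)) (qshuffle us vs)"

lemma qshuffle_Nil2 [simp]: "qshuffle us [] = [us]"
  by (cases us) auto

lemma sum_list_nsum_Cons_Suc:
  "(\<Sum>ws\<leftarrow>L. nsum (a # ws) (Suc N)) =
   (\<Sum>ws\<leftarrow>L. nsum (a # ws) N) + letter_fun a (int (Suc N)) * (\<Sum>ws\<leftarrow>L. nsum ws N)"
  by (simp add: nsum_Cons_Suc sum_list_addf sum_list_const_mult)

text \<open>Exact at every truncation \<open>N\<close>, hence usable for divergent words too. Both
  sides vanish at 0 and have equal increments: in the product of two incremented sums the three new
  terms match the three branches of \<open>qshuffle\<close>.\<close>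

lemma nsum_mult: "nsum us N * nsum vs N = (\<Sum>ws\<leftarrow>qshuffle us vs. nsum ws N)"
proof (induction us vs arbitrary: N rule: qshuffle.induct)
  case (3 u us v vs)
  show ?case
  proof (induction N)
    case 0
    have *: "sum_list (map (\<lambda>x. 0::real) L) = 0" for L :: "letter list list"
      by (induction L) auto
    show ?case by (simp add: o_def *)
  next
    case (Suc N)
    have "(\<Sum>ws\<leftarrow>qshuffle (u # us) (v # vs). nsum ws (Suc N)) =
      (\<Sum>ws\<leftarrow>qshuffle us (v # vs). nsum (u # ws) (Suc N)) + (\<Sum>ws\<leftarrow>qshuffle (u # us) vs. nsum (v # ws) (Suc N))
       + (\<Sum>ws\<leftarrow>qshuffle us vs. nsum (letter_mult u v # ws) (Suc N))"
      by (simp add: o_def)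
    also have "\<dots> = (\<Sum>ws\<leftarrow>qshuffle (u # us) (v # vs). nsum ws N)
       + letter_fun u (int (Suc N)) * (\<Sum>ws\<leftarrow>qshuffle us (v # vs). nsum ws N)
       + letter_fun v (int (Suc N)) * (\<Sum>ws\<leftarrow>qshuffle (u # us) vs. nsum ws N)
       + letter_fun (letter_mult u v) (int (Suc N)) * (\<Sum>ws\<leftarrow>qshuffle us vs. nsum ws N)"
      by (simp only: sum_list_nsum_Cons_Suc) (simp add: o_def)
    also have "\<dots> = nsum (u # us) N * nsum (v # vs) N
       + letter_fun u (int (Suc N)) * (nsum us N * nsum (v # vs) N)
       + letter_fun v (int (Suc N)) * (nsum (u # us) N * nsum vs N)
       + letter_fun u (int (Suc N)) * letter_fun v (int (Suc N)) * (nsum us N * nsum vs N)"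
      using 3 Suc by (simp only: letter_fun_mult)
    also have "\<dots> = nsum (u # us) (Suc N) * nsum (v # vs) (Suc N)"
      by (simp add: nsum_Cons_Suc algebra_simps)
    finally show ?case by simp
  qed
qed auto

lemma nsum_linear:
  "nsum (us @ (k, \<lambda>m. \<alpha> * g m + \<beta> * h m) # vs) N =
   \<alpha> * nsum (us @ (k, g) # vs) N + \<beta> * nsum (us @ (k, h) # vs) N"
proof (induction us arbitrary: N)
  case Nil
  show ?case
    by (simp add: nsum.simps letter_fun_def sum_distrib_left sum.distrib[symmetric] add_divide_distrib
          algebra_simps)
next
  case (Cons a us)
  show ?case
    by (simp add: nsum.simps Cons sum_distrib_left sum.distrib[symmetric] algebra_simps)
qed

section \<open>Characters modulo 4 and admissible words\<close>

definition per4 :: "(int \<Rightarrow> real) \<Rightarrow> bool" where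
  "per4 g \<longleftrightarrow> (\<forall>m. g (m + 4) = g m) \<and> (\<forall>m. g m \<in> \<rat>)"

definition anti :: "(int \<Rightarrow> real) \<Rightarrow> bool" where
  "anti g \<longleftrightarrow> (\<forall>m. g (m + 2) = - g m)"

definition valid :: "letter \<Rightarrow> bool" where
  "valid a \<longleftrightarrow> fst a \<ge> 1 \<and> per4 (snd a)"

text \<open>Narrower than convergence: (-1)^m / m is summable but excluded. The antiperiodic
  characters in \<open>per4\<close> are exactly the rational combinations of the mixed-value
  characters with \<sigma> = -1, so for exponent 1 this is the linear form of the condition that
  (k_1, \<sigma>_1) differs from (1, 1).\<close>

definition adm :: "letter \<Rightarrow> bool" where
  "adm a \<longleftrightarrow> fst a \<ge> 2 \<or> anti (snd a)"

definition adm_word :: "letter list \<Rightarrow> bool" where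
  "adm_word ws \<longleftrightarrow> list_all valid ws \<and> (ws = [] \<or> adm (hd ws))"

lemma adm_word_take: "adm_word ws \<Longrightarrow> adm_word (take i ws)"
  by (cases i; cases ws) (auto simp: adm_word_def list_all_iff dest: in_set_takeD)

lemma per4_D: "per4 g \<Longrightarrow> g (m + 4) = g m" "per4 g \<Longrightarrow> g m \<in> \<rat>"
  by (auto simp: per4_def)

lemma per4_iter: assumes "per4 g" shows "g (m + 4 * k) = g m"
proof -
  have nat: "g (m + 4 * int k) = g m" for k m
  proof (induction k)
    case (Suc k)
    have "g (m + 4 * int (Suc k)) = g ((m + 4 * int k) + 4)" by (simp add: algebra_simps)
    then show ?case using Suc per4_D(1)[OF assms] by metis
  qed simp
  show ?thesis
  proof (cases "k \<ge> 0")
    case True then show ?thesis using nat[of m "nat k"] by simp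
  next
    case False then show ?thesis using nat[of "m + 4 * k" "nat (- k)"] by simp
  qed
qed

lemma per4_mod: "per4 g \<Longrightarrow> g (m mod 4) = g m"
  using per4_iter[of g "m mod 4" "m div 4"] by simp

lemma per4_eqI:
  assumes "per4 g" "per4 h" "g 0 = h 0" "g 1 = h 1" "g 2 = h 2" "g 3 = h 3"
  shows "g = h"
proof
  fix m :: int
  have "m mod 4 \<in> {0,1,2,3}" by auto
  then have "g (m mod 4) = h (m mod 4)" using assms by auto
  then show "g m = h m" using assms(1,2) by (simp add: per4_mod)
qed

lemma per4_shift: assumes "per4 g" shows "per4 (\<lambda>m. g (m + a))"
proof -
  have "g (m + 4 + a) = g (m + a)" for m using per4_D(1)[OF assms, of "m + a"] by (simp add: ac_simps)
  then show ?thesis using assms by (simp add: per4_def)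
qed

lemma antiI: assumes "per4 g" "g 2 = - g 0" "g 3 = - g 1" shows "anti g"
proof -
  have "(\<lambda>m. g (m + 2)) = (\<lambda>m. - g m)"
  proof (rule per4_eqI[OF per4_shift[OF assms(1)]])
    show "per4 (\<lambda>m. - g m)" using assms(1) by (simp add: per4_def)
    show "g (0 + 2) = - g 0" "g (1 + 2) = - g 1" "g (2 + 2) = - g 2" "g (3 + 2) = - g 3"
      using assms(2,3) per4_D(1)[OF assms(1), of 0] per4_D(1)[OF assms(1), of 1] by simp_all
  qed
  then show ?thesis unfolding anti_def by meson
qed

lemma per4_mult: "per4 g \<Longrightarrow> per4 h \<Longrightarrow> per4 (\<lambda>m. g m * h m)"
  by (simp add: per4_def)

lemma per4_lin: "\<alpha> \<in> \<rat> \<Longrightarrow> \<beta> \<in> \<rat> \<Longrightarrow> per4 g \<Longrightarrow> per4 h \<Longrightarrow> per4 (\<lambda>m. \<alpha> * g m + \<beta> * h m)"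
  by (simp add: per4_def)

lemma per4_bounded: assumes "per4 g" obtains K where "K > 0" "\<And>m. \<bar>g m\<bar> \<le> K"
proof
  let ?K = "1 + \<bar>g 0\<bar> + \<bar>g 1\<bar> + \<bar>g 2\<bar> + \<bar>g 3\<bar>"
  show "?K > 0" by linarith
  fix m :: int
  have "m mod 4 \<in> {0,1,2,3}" by auto
  then have "\<bar>g (m mod 4)\<bar> \<le> ?K" by auto
  then show "\<bar>g m\<bar> \<le> ?K" using assms by (simp add: per4_mod)
qed

lemma valid_mult: "valid a \<Longrightarrow> valid b \<Longrightarrow> valid (letter_mult a b)"
  by (auto simp: valid_def letter_mult_def per4_mult)

lemma adm_mult: "valid a \<Longrightarrow> valid b \<Longrightarrow> adm (letter_mult a b)"
  by (auto simp: valid_def adm_def)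

text \<open>Admissibility survives because the head of a term is the head of one factor or a product
  of two letters, and the latter has exponent at least 2.\<close>

lemma qshuffle_props:
  assumes "ws \<in> set (qshuffle us vs)"
  shows "weight ws = weight us + weight vs \<and> length ws \<le> length us + length vs \<and>
         (list_all valid us \<longrightarrow> list_all valid vs \<longrightarrow> list_all valid ws) \<and>
         (adm_word us \<longrightarrow> adm_word vs \<longrightarrow> adm_word ws)"
  using assms
proof (induction us vs arbitrary: ws rule: qshuffle.induct)
  case (3 u us v vs)
  from "3.prems" consider
      w where "w \<in> set (qshuffle us (v # vs))" "ws = u # w"
    | w where "w \<in> set (qshuffle (u # us) vs)" "ws = v # w"
    | w where "w \<in> set (qshuffle us vs)" "ws = letter_mult u v # w" by auto
  then show ?case
  proof cases
    case 1 then show ?thesis using "3.IH"(1)[of w] by (auto simp: adm_word_def)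
  next
    case 2 then show ?thesis using "3.IH"(2)[of w] by (auto simp: adm_word_def)
  next
    case 3 then show ?thesis using "3.IH"(3)[of w] by (auto simp: adm_word_def valid_mult adm_mult)
  qed
qed auto

section \<open>Convergence of admissible sums\<close>

text \<open>Growth at most like a power of the logarithm. The base \<open>1 + harm N\<close> stands
  in for ln N because it is at least 1 for every \<open>N\<close>, including 0.\<close>

definition log_bdd :: "(nat \<Rightarrow> real) \<Rightarrow> bool" where
  "log_bdd a \<longleftrightarrow> (\<exists>C r. \<forall>N. \<bar>a N\<bar> \<le> C * (1 + harm N) ^ r)"

definition decaying :: "(nat \<Rightarrow> real) \<Rightarrow> bool" where
  "decaying a \<longleftrightarrow> (\<exists>\<delta>>0. \<exists>C. \<forall>N. \<bar>a N\<bar> \<le> C * (real N + 1) powr (- \<delta>))"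

lemma one_plus_harm_ge_1: "1 + harm N \<ge> (1::real)"
  by (simp add: harm_nonneg)

lemma log_bddI: "(\<And>N. \<bar>a N\<bar> \<le> C * (1 + harm N) ^ r) \<Longrightarrow> log_bdd a"
  unfolding log_bdd_def by blast

lemma log_bdd_obtain:
  assumes "log_bdd a"
  obtains C r where "C > 0" "\<And>N. \<bar>a N\<bar> \<le> C * (1 + harm N) ^ r"
proof -
  from assms obtain C r where *: "\<And>N. \<bar>a N\<bar> \<le> C * (1 + harm N) ^ r" unfolding log_bdd_def by blast
  have "\<bar>a N\<bar> \<le> (\<bar>C\<bar> + 1) * (1 + harm N) ^ r" for N
    by (rule order.trans[OF *]) (use one_plus_harm_ge_1[of N] in \<open>intro mult_right_mono, auto\<close>)
  moreover have "\<bar>C\<bar> + 1 > 0" by linarith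
  ultimately show ?thesis using that by blast
qed

text \<open>The exponent is lowered to at most 1/2, because \<open>abel_decaying\<close> needs
  \<delta> < 1.\<close>

lemma decaying_obtain:
  assumes "decaying a"
  obtains C \<delta> where "C > 0" "0 < \<delta>" "\<delta> < 1" "\<And>N. \<bar>a N\<bar> \<le> C * (real N + 1) powr (- \<delta>)"
proof -
  from assms obtain C \<delta> where *: "\<And>N. \<bar>a N\<bar> \<le> C * (real N + 1) powr (- \<delta>)" "\<delta> > 0"
    unfolding decaying_def by blast
  have "\<bar>a N\<bar> \<le> (\<bar>C\<bar> + 1) * (real N + 1) powr (- (min \<delta> (1/2)))" for N
    by (rule order.trans[OF *(1)], rule mult_mono, simp, rule powr_mono) (use *(2) in auto)
  then show ?thesis using *(2) that[of "\<bar>C\<bar> + 1" "min \<delta> (1/2)"] by simp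
qed

lemma log_bdd_const [simp]: "log_bdd (\<lambda>_. c)"
  by (rule log_bddI[where r = 0 and C = "\<bar>c\<bar>"]) auto

lemma log_bdd_mult: assumes "log_bdd a" "log_bdd b" shows "log_bdd (\<lambda>N. a N * b N)"
proof -
  obtain C r where C: "C > 0" "\<And>N. \<bar>a N\<bar> \<le> C * (1 + harm N) ^ r" using log_bdd_obtain[OF assms(1)] by blast
  obtain D s where D: "D > 0" "\<And>N. \<bar>b N\<bar> \<le> D * (1 + harm N) ^ s" using log_bdd_obtain[OF assms(2)] by blast
  have "\<bar>a N * b N\<bar> \<le> (C * D) * (1 + harm N) ^ (r + s)" for N
  proof -
    have "\<bar>a N\<bar> * \<bar>b N\<bar> \<le> (C * (1 + harm N) ^ r) * (D * (1 + harm N) ^ s)"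
      using C D one_plus_harm_ge_1[of N] by (intro mult_mono) (auto intro: order.trans[rotated])
    then show ?thesis by (simp add: abs_mult power_add algebra_simps)
  qed
  then show ?thesis by (rule log_bddI)
qed

lemma log_bdd_add: assumes "log_bdd a" "log_bdd b" shows "log_bdd (\<lambda>N. a N + b N)"
proof -
  obtain C r where C: "C > 0" "\<And>N. \<bar>a N\<bar> \<le> C * (1 + harm N) ^ r" using log_bdd_obtain[OF assms(1)] by blast
  obtain D s where D: "D > 0" "\<And>N. \<bar>b N\<bar> \<le> D * (1 + harm N) ^ s" using log_bdd_obtain[OF assms(2)] by blast
  have "\<bar>a N + b N\<bar> \<le> (C + D) * (1 + harm N) ^ (r + s)" for N
  proof -
    have "(1 + harm N) ^ r \<le> (1 + harm N :: real) ^ (r + s)" "(1 + harm N) ^ s \<le> (1 + harm N :: real) ^ (r + s)"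
      using one_plus_harm_ge_1[of N] by (auto intro!: power_increasing)
    then have "C * (1 + harm N) ^ r \<le> C * (1 + harm N :: real) ^ (r + s)"
        "D * (1 + harm N) ^ s \<le> D * (1 + harm N :: real) ^ (r + s)"
      using C D by (auto intro!: mult_left_mono)
    then show ?thesis using C(2)[of N] D(2)[of N] by (simp add: algebra_simps)
  qed
  then show ?thesis by (rule log_bddI)
qed

lemma log_bdd_cong_le: "log_bdd b \<Longrightarrow> (\<And>N. \<bar>a N\<bar> \<le> \<bar>b N\<bar>) \<Longrightarrow> log_bdd a"
  unfolding log_bdd_def by (meson order.trans)

lemma harm_power_le_powr:
  assumes "\<delta> > 0"
  obtains C where "C > 0" "\<And>N. (1 + harm N :: real) ^ r \<le> C * (real N + 1) powr \<delta>"
proof -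
  \<comment> \<open>Chosen so that \<open>e * r \<le> \<delta>\<close>; the denominator
    \<open>r + 1\<close> also covers \<open>r = 0\<close>.\<close>
  define e where "e = \<delta> / (real r + 1)"
  have e: "e > 0" using assms by (simp add: e_def)
  have *: "1 + harm N \<le> (2 + 1 / e) * (real N + 1) powr e" for N
  proof -
    have "harm N \<le> 1 + ln (real N + 1)"
    proof (cases "N = 0")
      case True then show ?thesis by (simp add: harm_expand)
    next
      case False
      then have "harm N \<le> 1 + ln (real N)"
        using euler_mascheroni_sequence_decreasing[of 1 N] by (simp add: harm_expand)
      also have "ln (real N) \<le> ln (real N + 1)" using False by simp
      finally show ?thesis by simp
    qed
    also have "ln (real N + 1) \<le> (real N + 1) powr e / e"
      by (rule ln_powr_bound) (use e in auto)
    finally have "1 + harm N \<le> 2 + (real N + 1) powr e / e" by simp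
    moreover have "1 \<le> (real N + 1) powr e" using e by (intro ge_one_powr_ge_zero) auto
    ultimately show ?thesis by (simp add: algebra_simps)
  qed
  have "(1 + harm N :: real) ^ r \<le> (2 + 1 / e) ^ r * (real N + 1) powr \<delta>" for N
  proof -
    have "(1 + harm N :: real) ^ r \<le> ((2 + 1 / e) * (real N + 1) powr e) ^ r"
      using *[of N] one_plus_harm_ge_1[of N] by (intro power_mono) auto
    also have "\<dots> = (2 + 1 / e) ^ r * (real N + 1) powr (e * r)"
      by (simp add: power_mult_distrib powr_power mult.commute)
    also have "(real N + 1) powr (e * r) \<le> (real N + 1) powr \<delta>"
      using assms by (intro powr_mono) (auto simp: e_def field_simps)
    finally show ?thesis using e by (simp add: mult_left_mono)
  qed
  moreover have "(2 + 1 / e) ^ r > 0" using e by (intro zero_less_power) (auto intro: add_pos_pos)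
  ultimately show ?thesis using that by blast
qed

lemma log_bdd_le_powr:
  assumes "log_bdd a" "\<delta> > 0"
  obtains C where "C > 0" "\<And>N. \<bar>a N\<bar> \<le> C * (real N + 1) powr \<delta>"
proof -
  obtain C r where C: "C > 0" "\<And>N. \<bar>a N\<bar> \<le> C * (1 + harm N) ^ r" using log_bdd_obtain[OF assms(1)] by blast
  obtain D where D: "D > 0" "\<And>N. (1 + harm N :: real) ^ r \<le> D * (real N + 1) powr \<delta>"
    using harm_power_le_powr[OF assms(2), of r] by blast
  have "\<bar>a N\<bar> \<le> (C * D) * (real N + 1) powr \<delta>" for N
    using order.trans[OF C(2)[of N] mult_left_mono[OF D(2)[of N], of C]] C by simp
  with C D that show ?thesis by (metis mult_pos_pos)
qed

lemma decaying_mult_log_bdd: assumes "decaying a" "log_bdd b" shows "decaying (\<lambda>N. a N * b N)"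
proof -
  obtain C \<delta> where C: "C > 0" "0 < \<delta>" "\<And>N. \<bar>a N\<bar> \<le> C * (real N + 1) powr (- \<delta>)"
    using decaying_obtain[OF assms(1)] by metis
  obtain D where D: "D > 0" "\<And>N. \<bar>b N\<bar> \<le> D * (real N + 1) powr (\<delta> / 2)"
    using log_bdd_le_powr[OF assms(2), of "\<delta> / 2"] C by auto
  have "\<bar>a N * b N\<bar> \<le> (C * D) * (real N + 1) powr (- (\<delta> / 2))" for N
  proof -
    have "\<bar>a N * b N\<bar> \<le> (C * (real N + 1) powr (- \<delta>)) * (D * (real N + 1) powr (\<delta> / 2))"
      unfolding abs_mult using C D by (intro mult_mono) (auto intro: order.trans[rotated])
    also have "\<dots> = (C * D) * ((real N + 1) powr (- \<delta>) * (real N + 1) powr (\<delta> / 2))" by simp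
    also have "(real N + 1) powr (- \<delta>) * (real N + 1) powr (\<delta> / 2) = (real N + 1) powr (- (\<delta> / 2))"
      by (subst powr_add[symmetric]) (simp add: field_simps)
    finally show ?thesis .
  qed
  then show ?thesis unfolding decaying_def using C(2) by (intro exI[of _ "\<delta> / 2"] conjI exI allI) auto
qed

lemma decaying_add: assumes "decaying a" "decaying b" shows "decaying (\<lambda>N. a N + b N)"
proof -
  obtain C \<delta> where C: "C > 0" "0 < \<delta>" "\<And>N. \<bar>a N\<bar> \<le> C * (real N + 1) powr (- \<delta>)"
    using decaying_obtain[OF assms(1)] by metis
  obtain D \<gamma> where D: "D > 0" "0 < \<gamma>" "\<And>N. \<bar>b N\<bar> \<le> D * (real N + 1) powr (- \<gamma>)"
    using decaying_obtain[OF assms(2)] by metis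
  have "\<bar>a N + b N\<bar> \<le> (C + D) * (real N + 1) powr (- (min \<delta> \<gamma>))" for N
  proof -
    have "C * (real N + 1) powr (- \<delta>) \<le> C * (real N + 1) powr (- (min \<delta> \<gamma>))"
         "D * (real N + 1) powr (- \<gamma>) \<le> D * (real N + 1) powr (- (min \<delta> \<gamma>))"
      using C D by (auto intro!: mult_left_mono powr_mono)
    then show ?thesis using C(3)[of N] D(3)[of N] by (simp add: algebra_simps)
  qed
  then show ?thesis unfolding decaying_def using C(2) D(2)
    by (intro exI[of _ "min \<delta> \<gamma>"] conjI exI allI) auto
qed

lemma decaying_0 [simp]: "decaying (\<lambda>_. 0)"
  unfolding decaying_def by (intro exI[of _ 1] conjI exI[of _ 0]) auto

lemma decaying_scale: "decaying a \<Longrightarrow> decaying (\<lambda>N. c * a N)"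
  using decaying_mult_log_bdd[of a "\<lambda>_. c"] by (simp add: mult.commute)

lemma decaying_log_bdd: "decaying a \<Longrightarrow> log_bdd a"
  unfolding decaying_def
proof (elim exE conjE)
  fix \<delta> C assume *: "\<delta> > 0" "\<forall>N. \<bar>a N\<bar> \<le> C * (real N + 1) powr (- \<delta>)"
  have "\<bar>a N\<bar> \<le> \<bar>C\<bar> * (1 + harm N) ^ 0" for N
  proof -
    have "\<bar>a N\<bar> \<le> C * (real N + 1) powr (- \<delta>)" using * by blast
    also have "\<dots> \<le> \<bar>C\<bar> * 1"
      using *(1) powr_mono[of "-\<delta>" 0 "real N + 1"] by (intro mult_mono) auto
    finally show ?thesis by simp
  qed
  then show "log_bdd a" by (rule log_bddI)
qed

lemma decaying_tendsto: assumes "decaying a" shows "a \<longlonglongrightarrow> 0"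
proof -
  obtain C \<delta> where C: "C > 0" "0 < \<delta>" "\<And>N. \<bar>a N\<bar> \<le> C * (real N + 1) powr (- \<delta>)"
    using decaying_obtain[OF assms] by metis
  have "(\<lambda>N. (real N + 1) powr (- \<delta>)) \<longlonglongrightarrow> 0"
    by (rule tendsto_neg_powr) (use C in \<open>auto intro!: filterlim_tendsto_add_at_top filterlim_real_sequentially simp: add.commute[of _ 1]\<close>)
  then have "(\<lambda>N. C * (real N + 1) powr (- \<delta>)) \<longlonglongrightarrow> 0" by (rule tendsto_mult_right_zero)
  then show ?thesis by (rule Lim_null_comparison[rotated]) (use C in auto)
qed

lemma decaying_subseq_double: assumes "decaying a" shows "decaying (\<lambda>N. a (2 * N))"
proof -
  obtain C \<delta> where C: "C > 0" "0 < \<delta>" "\<And>N. \<bar>a N\<bar> \<le> C * (real N + 1) powr (- \<delta>)"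
    using decaying_obtain[OF assms] by metis
  have "\<bar>a (2 * N)\<bar> \<le> C * (real N + 1) powr (- \<delta>)" for N
  proof -
    have "(real (2 * N) + 1) powr - \<delta> \<le> (real N + 1) powr - \<delta>"
      using C(2) by (intro powr_mono2') auto
    then show ?thesis using C(3)[of "2 * N"] C(1) by (meson mult_left_mono order.trans less_imp_le)
  qed
  then show ?thesis unfolding decaying_def using C by blast
qed

lemma decaying_inverse_log_bdd: assumes "log_bdd a" shows "decaying (\<lambda>N. a N / (real N + 1))"
proof -
  have "decaying (\<lambda>N. 1 / (real N + 1))"
    unfolding decaying_def by (rule exI[of _ 1], simp, rule exI[of _ 1]) (simp add: powr_minus field_simps)
  from decaying_mult_log_bdd[OF this assms] show ?thesis by simp
qed

text \<open>A power of the logarithm is at most C sqrt(N + 1), so the increments are O(N^(-3/2)) and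
  are dominated by those of the telescoping sequence 1 / sqrt(N + 1). This yields convergence
  together with a rate.\<close>

lemma convergent_of_increments:
  assumes "log_bdd b" and "\<And>N. \<bar>a (Suc N) - a N\<bar> \<le> b N / (real N + 1)\<^sup>2"
  obtains l where "decaying (\<lambda>N. a N - l)"
proof -
  obtain C where C: "C > 0" "\<And>N. \<bar>b N\<bar> \<le> C * (real N + 1) powr (1/2)"
    using log_bdd_le_powr[OF assms(1), of "1/2"] by auto
  define u where "u N = 1 / sqrt (real N + 1)" for N :: nat
  \<comment> \<open>The 6 is 2 times 3: since t \<le> 2 s, the product s t (s + t) is at most 6 s^3,
    hence 1 / s^3 \<le> 6 (1 / s - 1 / t).\<close>
  define K where "K = 6 * C"
  have K: "K > 0" using C by (simp add: K_def)
  have inc: "\<bar>a (Suc N) - a N\<bar> \<le> K * (u N - u (Suc N))" for N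
  proof -
    define s t where "s = sqrt (real N + 1)" and "t = sqrt (real N + 2)"
    have st: "s > 0" "t > s" "s\<^sup>2 = real N + 1" "t\<^sup>2 = real N + 2" by (auto simp: s_def t_def)
    have s1: "s \<ge> 1" by (simp add: s_def)
    have "t\<^sup>2 \<le> (2 * s)\<^sup>2" using st by (simp add: power_mult_distrib)
    then have ts: "t \<le> 2 * s" by (rule power2_le_imp_le) (use st in auto)
    have "\<bar>a (Suc N) - a N\<bar> \<le> b N / (real N + 1)\<^sup>2" by (rule assms(2))
    also have "\<dots> \<le> C * s / (s\<^sup>2)\<^sup>2"
      using C(2)[of N] unfolding st(3) by (intro divide_right_mono) (auto simp: powr_half_sqrt s_def)
    also have "\<dots> = C / s ^ 3" using st(1) by (simp add: divide_simps eval_nat_numeral)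
    also have "\<dots> \<le> K * (1 / s - 1 / t)"
    proof -
      have "(t - s) * (t + s) = 1" using st by (simp add: algebra_simps power2_eq_square)
      moreover have "t + s > 0" using st(1,2) by simp
      ultimately have e: "t - s = 1 / (t + s)" by (metis nonzero_eq_divide_eq less_irrefl)
      have "1 / s - 1 / t = (t - s) / (s * t)" using st(1,2) by (simp add: diff_divide_distrib)
      also have "\<dots> = 1 / (s * t * (t + s))" by (simp add: e)
      also have "\<dots> \<ge> 1 / (s * (2 * s) * (3 * s))"
      proof (rule divide_left_mono)
        show "s * t * (t + s) \<le> s * (2 * s) * (3 * s)"
          using st(1,2) ts by (intro mult_mono) auto
      qed (use st(1,2) in auto)
      finally have "1 / (6 * s ^ 3) \<le> 1 / s - 1 / t" by (simp add: eval_nat_numeral algebra_simps)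
      then have "K * (1 / (6 * s ^ 3)) \<le> K * (1 / s - 1 / t)" using K by (intro mult_left_mono) auto
      then show ?thesis by (simp add: K_def)
    qed
    finally show ?thesis by (simp add: u_def s_def t_def add.commute)
  qed
  have diff: "\<bar>a (N + k) - a N\<bar> \<le> K * (u N - u (N + k))" for N k
  proof (induction k)
    case (Suc k) then show ?case using inc[of "N + k"] by (simp add: algebra_simps)
  qed simp
  have u0: "u N \<ge> 0" for N by (simp add: u_def)
  have diff': "\<bar>a (N + k) - a N\<bar> \<le> K * u N" for N k
    using diff[where N=N and k=k] mult_left_mono[OF u0[of "N+k"], of K] K by (simp add: algebra_simps)
  have "decaying u" unfolding decaying_def
    by (intro exI[of _ "1/2"] conjI exI[of _ 1]) (auto simp: u_def powr_minus powr_half_sqrt field_simps)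
  then have u_lim: "(\<lambda>N. K * u N) \<longlonglongrightarrow> 0" by (intro tendsto_mult_right_zero decaying_tendsto)
  have "Cauchy a"
  proof (rule metric_CauchyI)
    fix e :: real assume "e > 0"
    then have "eventually (\<lambda>N. K * u N < e / 2) sequentially"
      using order_tendstoD(2)[OF u_lim, of "e / 2"] by simp
    then obtain M where M: "K * u M < e / 2" by (auto simp: eventually_sequentially)
    have "dist (a m) (a n) < e" if "m \<ge> M" "n \<ge> M" for m n
      using diff'[of M "m - M"] diff'[of M "n - M"] M that by (auto simp: dist_real_def)
    then show "\<exists>M. \<forall>m\<ge>M. \<forall>n\<ge>M. dist (a m) (a n) < e" by blast
  qed
  then obtain l where l: "a \<longlonglongrightarrow> l" using Cauchy_convergent convergent_def by blast
  have "\<bar>a N - l\<bar> \<le> K * u N" for N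
  proof -
    have "(\<lambda>k. \<bar>a (k + N) - a N\<bar>) \<longlonglongrightarrow> \<bar>l - a N\<bar>"
      by (intro tendsto_intros LIMSEQ_ignore_initial_segment l)
    then have "\<bar>l - a N\<bar> \<le> K * u N"
      by (rule Lim_bounded) (use diff'[of N] in \<open>auto simp: add.commute\<close>)
    then show ?thesis by linarith
  qed
  then have "\<bar>a N - l\<bar> \<le> K * (real N + 1) powr (- (1/2))" for N
    by (simp add: u_def powr_minus powr_half_sqrt field_simps)
  then have "decaying (\<lambda>N. a N - l)" unfolding decaying_def by (intro exI[of _ "1/2"] conjI exI allI) auto
  then show ?thesis using that by blast
qed

lemma valid_bound:
  assumes "valid a" obtains K where "K > 0" "\<And>N. \<bar>letter_fun a (int (Suc N))\<bar> \<le> K / (real N + 1)"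
proof -
  obtain K where K: "K > 0" "\<And>m. \<bar>snd a m\<bar> \<le> K"
    using per4_bounded assms unfolding valid_def by metis
  have "\<bar>letter_fun a (int (Suc N))\<bar> \<le> K / (real N + 1)" for N
  proof -
    have "real N + 1 \<le> (real N + 1) ^ fst a"
      using assms unfolding valid_def by (intro self_le_power) auto
    then show ?thesis using K
      by (auto simp: letter_fun_def abs_divide power_abs add.commute intro!: frac_le)
  qed
  with K(1) that show ?thesis by blast
qed

text \<open>Each letter is O(1 / m), so each nested summation costs at most one factor
  \<open>harm N\<close>.\<close>

lemma nsum_log_bdd: "list_all valid ws \<Longrightarrow> log_bdd (nsum ws)"
proof -
  assume "list_all valid ws"
  then have "\<exists>C\<ge>0. \<forall>N. \<bar>nsum ws N\<bar> \<le> C * (1 + harm N) ^ length ws"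
  proof (induction ws)
    case (Cons a ws)
    then obtain C where C: "C \<ge> 0" "\<And>N. \<bar>nsum ws N\<bar> \<le> C * (1 + harm N) ^ length ws" by auto
    obtain K where K: "K > 0" "\<And>N. \<bar>letter_fun a (int (Suc N))\<bar> \<le> K / (real N + 1)"
      using valid_bound[of a] Cons.prems by (metis list.pred_inject(2))
    have "\<bar>nsum (a # ws) N\<bar> \<le> (C * K) * (1 + harm N) ^ length ws * harm N" for N
    proof (induction N)
      case (Suc N)
      have mono: "harm N \<le> (harm (Suc N) :: real)" by (rule harm_mono) simp
      have "\<bar>nsum (a # ws) (Suc N)\<bar> \<le> \<bar>nsum (a # ws) N\<bar> + \<bar>letter_fun a (int (Suc N))\<bar> * \<bar>nsum ws N\<bar>"
        by (simp add: nsum_Cons_Suc abs_mult[symmetric] del: of_nat_Suc)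
      also have "\<dots> \<le> C * K * (1 + harm N) ^ length ws * harm N
           + K / (real N + 1) * (C * (1 + harm N) ^ length ws)"
        by (intro add_mono Suc mult_mono K C) (use K in auto)
      also have "\<dots> = (C * K) * (1 + harm N) ^ length ws * harm (Suc N)"
        by (simp add: harm_Suc field_simps)
      also have "\<dots> \<le> (C * K) * (1 + harm (Suc N)) ^ length ws * harm (Suc N)"
        using C K mono harm_nonneg[of N, where 'a = real]
        by (intro mult_right_mono mult_left_mono power_mono) (auto simp: harm_nonneg)
      finally show ?case .
    qed (simp add: harm_def)
    also have "(C * K) * (1 + harm N) ^ length ws * harm N \<le> (C * K) * (1 + harm N) ^ length ws * (1 + harm N)" for N
      using C K by (intro mult_left_mono) (auto simp: harm_nonneg)
    finally have "\<bar>nsum (a # ws) N\<bar> \<le> (C * K) * (1 + harm N) ^ length (a # ws)" for N by (simp add: mult_ac)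
    with C K show ?case by (intro exI[of _ "C * K"]) auto
  qed (auto intro!: exI[of _ 1])
  then show ?thesis using log_bddI by metis
qed

lemma nsum_increment:
  assumes "list_all valid ws"
  obtains b where "log_bdd b" "\<And>N. \<bar>nsum ws (Suc N) - nsum ws N\<bar> \<le> b N / (real N + 1)"
proof (cases ws)
  case Nil then show ?thesis using that[of "\<lambda>_. 0"] by simp
next
  case (Cons a vs)
  obtain K where K: "K > 0" "\<And>N. \<bar>letter_fun a (int (Suc N))\<bar> \<le> K / (real N + 1)"
    using valid_bound[of a] assms Cons by (metis list.pred_inject(2))
  have sl: "log_bdd (\<lambda>N. K * \<bar>nsum vs N\<bar>)"
    using log_bdd_cong_le[OF log_bdd_mult[OF log_bdd_const[of K] nsum_log_bdd[of vs]]] assms Cons K by (simp add: abs_mult)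
  have "\<bar>nsum ws (Suc N) - nsum ws N\<bar> \<le> K * \<bar>nsum vs N\<bar> / (real N + 1)" for N
    using mult_right_mono[OF K(2)[of N], of "\<bar>nsum vs N\<bar>"]
    by (simp add: Cons nsum_Cons_Suc abs_mult del: of_nat_Suc)
  with sl that show ?thesis by blast
qed

lemma adm_word_converges:
  assumes "adm_word ws"
  obtains l where "decaying (\<lambda>N. nsum ws N - l)"
proof (cases ws)
  case Nil then show ?thesis using that[of 1] by simp
next
  case (Cons a vs)
  then have v: "valid a" "list_all valid vs" and ad: "adm a" using assms by (auto simp: adm_word_def)
  obtain K where K: "K > 0" "\<And>m. \<bar>snd a m\<bar> \<le> K"
    using per4_bounded v unfolding valid_def by metis
  show ?thesis
  proof (cases "fst a \<ge> 2")
    case True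
    have "\<bar>nsum ws (Suc N) - nsum ws N\<bar> \<le> (K * \<bar>nsum vs N\<bar>) / (real N + 1)\<^sup>2" for N
    proof -
      have "\<bar>letter_fun a (int (Suc N))\<bar> \<le> K / (real N + 1)\<^sup>2"
        using K power_increasing[OF True, of "real N + 1"]
        by (auto simp: letter_fun_def abs_divide power_abs add.commute intro!: frac_le)
      from mult_right_mono[OF this, of "\<bar>nsum vs N\<bar>"] show ?thesis
        by (simp add: Cons nsum_Cons_Suc abs_mult del: of_nat_Suc)
    qed
    moreover have "log_bdd (\<lambda>N. K * \<bar>nsum vs N\<bar>)"
      using log_bdd_cong_le[OF log_bdd_mult[OF log_bdd_const[of K] nsum_log_bdd[of vs]]] v K by (simp add: abs_mult)
    ultimately show ?thesis using convergent_of_increments that by blast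
  next
    case False
    then have k1: "fst a = 1" and an: "anti (snd a)" using ad v by (auto simp: adm_def valid_def)
    \<comment> \<open>A bounded discrete primitive of the character, for summation by parts: by
      antiperiodicity the difference is (g(N) - g(N + 2)) / 2 = g(N).\<close>
    define h where "h N = - (snd a (int N) + snd a (int N + 1)) / 2" for N
    have h_diff: "h (Suc N) - h N = snd a (int N)" for N
      using an unfolding anti_def h_def by (auto simp: add.commute field_simps)
    have h_bd: "\<bar>h N\<bar> \<le> K" for N using K(2)[of "int N"] K(2)[of "int N + 1"] unfolding h_def by (simp add: abs_le_iff)
    define v where "v N = nsum vs N / (real N + 1)" for N
    \<comment> \<open>Removing the boundary term leaves increments that contain the differences of
      \<open>v\<close>, which gain a second factor 1 / N.\<close>
    define A where "A N = nsum ws N - h (Suc N) * v N" for N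
    obtain b where b: "log_bdd b" "\<And>N. \<bar>nsum vs (Suc N) - nsum vs N\<bar> \<le> b N / (real N + 1)"
      using nsum_increment[OF v(2)] by blast
    have v_diff: "\<bar>v N - v (Suc N)\<bar> \<le> (\<bar>nsum vs N\<bar> + b N) / (real N + 1)\<^sup>2" for N
    proof -
      have "v N - v (Suc N) = nsum vs N / ((real N + 1) * (real N + 2)) - (nsum vs (Suc N) - nsum vs N) / (real N + 2)"
      proof -
        have "x / n - y / (n + 1) = x / (n * (n + 1)) - (y - x) / (n + 1)" if "n > 0" for x y n :: real
          using that by (simp add: divide_simps) (simp add: algebra_simps)
        from this[of "real N + 1" "nsum vs N" "nsum vs (Suc N)"] show ?thesis by (simp add: v_def add.commute)
      qed
      also have "\<bar>\<dots>\<bar> \<le> \<bar>nsum vs N\<bar> / ((real N + 1) * (real N + 2)) + \<bar>nsum vs (Suc N) - nsum vs N\<bar> / (real N + 2)"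
        by (rule order.trans[OF abs_triangle_ineq4]) (simp add: abs_mult abs_divide)
      also have "\<dots> \<le> \<bar>nsum vs N\<bar> / ((real N + 1) * (real N + 1)) + (b N / (real N + 1)) / (real N + 1)"
        using b(2)[of N] order.trans[OF abs_ge_zero b(2)[of N]]
        by (intro add_mono frac_le mult_mono mult_pos_pos) auto
      also have "\<dots> = (\<bar>nsum vs N\<bar> + b N) / (real N + 1)\<^sup>2"
        by (simp add: power2_eq_square add_divide_distrib)
      finally show ?thesis .
    qed
    have "\<bar>A (Suc N) - A N\<bar> \<le> (K * (\<bar>nsum vs N\<bar> + b N)) / (real N + 1)\<^sup>2" for N
    proof -
      have "nsum ws (Suc N) - nsum ws N = (h (Suc (Suc N)) - h (Suc N)) * v N"
        by (simp add: Cons nsum_Cons_Suc letter_fun_def k1 h_diff v_def add.commute)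
      then have "A (Suc N) - A N = h (Suc (Suc N)) * (v N - v (Suc N))"
        by (simp add: A_def algebra_simps)
      also have "\<bar>\<dots>\<bar> \<le> K * ((\<bar>nsum vs N\<bar> + b N) / (real N + 1)\<^sup>2)"
        unfolding abs_mult using h_bd v_diff K by (intro mult_mono) auto
      finally show ?thesis by simp
    qed
    moreover have "log_bdd (\<lambda>N. K * (\<bar>nsum vs N\<bar> + b N))"
      by (intro log_bdd_mult log_bdd_const log_bdd_add b log_bdd_cong_le[OF nsum_log_bdd[OF v(2)]]) auto
    ultimately obtain l where l: "decaying (\<lambda>N. A N - l)" using convergent_of_increments by blast
    have "decaying (\<lambda>N. h (Suc N) * v N)"
    proof -
      have "log_bdd (\<lambda>N. h (Suc N))" using log_bdd_cong_le[OF log_bdd_const[of K]] h_bd K by simp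
      from decaying_inverse_log_bdd[OF log_bdd_mult[OF this nsum_log_bdd[OF v(2)]]] show ?thesis by (simp add: v_def)
    qed
    from decaying_add[OF l this] have "decaying (\<lambda>N. nsum ws N - l)" by (simp add: A_def)
    then show ?thesis using that by blast
  qed
qed

section \<open>Limits of admissible words and their rational spans\<close>

definition wval :: "letter list \<Rightarrow> real" where "wval ws = lim (nsum ws)"

lemma decaying_imp_lim: assumes "decaying (\<lambda>N. a N - l)" shows "a \<longlonglongrightarrow> l" "lim a = l"
proof -
  show "a \<longlonglongrightarrow> l" using decaying_tendsto[OF assms] by (simp add: LIM_zero_cancel)
  then show "lim a = l" by (rule limI)
qed

lemma decaying_wval: "adm_word ws \<Longrightarrow> decaying (\<lambda>N. nsum ws N - wval ws)"
  using adm_word_converges decaying_imp_lim(2) unfolding wval_def by metis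

lemma nsum_tendsto_wval: "adm_word ws \<Longrightarrow> nsum ws \<longlonglongrightarrow> wval ws"
  using decaying_wval decaying_imp_lim(1) by blast

lemma wval_Nil [simp]: "wval [] = 1"
  unfolding wval_def by (rule decaying_imp_lim(2)) simp

lemma tendsto_sum_list:
  "(\<And>x. x \<in> set L \<Longrightarrow> (f x \<longlonglongrightarrow> (g x :: real))) \<Longrightarrow> (\<lambda>N. \<Sum>x\<leftarrow>L. f x N) \<longlonglongrightarrow> (\<Sum>x\<leftarrow>L. g x)"
  by (induction L) (auto intro!: tendsto_add)

lemma wval_mult: assumes "adm_word us" "adm_word vs" shows "wval us * wval vs = (\<Sum>ws\<leftarrow>qshuffle us vs. wval ws)"
proof -
  have "(\<lambda>N. nsum us N * nsum vs N) \<longlonglongrightarrow> wval us * wval vs"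
    using assms by (intro tendsto_mult nsum_tendsto_wval)
  moreover have "(\<lambda>N. \<Sum>ws\<leftarrow>qshuffle us vs. nsum ws N) \<longlonglongrightarrow> (\<Sum>ws\<leftarrow>qshuffle us vs. wval ws)"
    using assms qshuffle_props by (intro tendsto_sum_list nsum_tendsto_wval) blast
  ultimately show ?thesis by (simp add: nsum_mult LIMSEQ_unique)
qed

text \<open>The depth is only bounded, because merged letters in \<open>qshuffle\<close> lower it,
  while the weight stays exact. The empty word is included, so weight 0 gives the rationals.\<close>

definition val_span :: "nat \<Rightarrow> nat \<Rightarrow> real set" where
  "val_span w d = span_rat {wval ws | ws. adm_word ws \<and> weight ws = w \<and> length ws \<le> d}"

lemma span_rat_mult_closed:
  assumes "\<And>x y. x \<in> A \<Longrightarrow> y \<in> B \<Longrightarrow> x * y \<in> span_rat C"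
    and "x \<in> span_rat A" "y \<in> span_rat B"
  shows "x * y \<in> span_rat C"
  using assms(2)
proof (induction rule: real_rat.span_induct_alt)
  case base then show ?case by (simp add: real_rat.span_zero)
next
  case (step q a z)
  have "a * y \<in> span_rat C" using assms(3)
  proof (induction rule: real_rat.span_induct_alt)
    case base then show ?case by (simp add: real_rat.span_zero)
  next
    case (step r b u)
    have "of_rat r * (a * b) + a * u \<in> span_rat C"
      using assms(1) \<open>a \<in> A\<close> step by (intro real_rat.span_add real_rat.span_scale) auto
    then show ?case by (simp add: algebra_simps)
  qed
  then have "of_rat q * (a * y) + z * y \<in> span_rat C"
    using step by (intro real_rat.span_add real_rat.span_scale) auto
  then show ?case by (simp add: algebra_simps)
qed

lemma val_span_0 [simp]: "0 \<in> val_span w d" by (simp add: val_span_def real_rat.span_zero)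
lemma val_span_add: "x \<in> val_span w d \<Longrightarrow> y \<in> val_span w d \<Longrightarrow> x + y \<in> val_span w d" by (simp add: val_span_def real_rat.span_add)
lemma val_span_scale: "q \<in> \<rat> \<Longrightarrow> x \<in> val_span w d \<Longrightarrow> q * x \<in> val_span w d"
  by (auto simp: val_span_def Rats_def intro: real_rat.span_scale)
lemma val_span_minus: "x \<in> val_span w d \<Longrightarrow> - x \<in> val_span w d" using val_span_scale[of "-1"] by simp
lemma val_span_mono: "x \<in> val_span w d \<Longrightarrow> d \<le> d' \<Longrightarrow> x \<in> val_span w d'"
  unfolding val_span_def by (rule set_mp[OF real_rat.span_mono]) auto
lemma val_span_wval: "adm_word ws \<Longrightarrow> weight ws = w \<Longrightarrow> length ws \<le> d \<Longrightarrow> wval ws \<in> val_span w d"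
  unfolding val_span_def by (rule real_rat.span_base) auto
lemma val_span_1 [simp]: "1 \<in> val_span 0 d" using val_span_wval[of "[]" 0 d] by (simp add: adm_word_def)
lemma val_span_sum_list: "(\<And>x. x \<in> set L \<Longrightarrow> f x \<in> val_span w d) \<Longrightarrow> (\<Sum>x\<leftarrow>L. f x) \<in> val_span w d"
  by (induction L) (auto intro: val_span_add)

lemma val_span_mult:
  assumes "x \<in> val_span w d" "y \<in> val_span w' d'" shows "x * y \<in> val_span (w + w') (d + d')"
  unfolding val_span_def
proof (rule span_rat_mult_closed[OF _ assms[unfolded val_span_def]])
  fix x y
  assume "x \<in> {wval ws |ws. adm_word ws \<and> weight ws = w \<and> length ws \<le> d}"
    and "y \<in> {wval ws |ws. adm_word ws \<and> weight ws = w' \<and> length ws \<le> d'}"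
  then obtain us vs where *: "x = wval us" "adm_word us" "weight us = w" "length us \<le> d"
    "y = wval vs" "adm_word vs" "weight vs = w'" "length vs \<le> d'" by blast
  have "(\<Sum>ws\<leftarrow>qshuffle us vs. wval ws) \<in> val_span (w + w') (d + d')"
  proof (rule val_span_sum_list)
    fix ws assume ws: "ws \<in> set (qshuffle us vs)"
    show "wval ws \<in> val_span (w + w') (d + d')" using qshuffle_props[OF ws] * by (intro val_span_wval) auto
  qed
  then show "x * y \<in> span_rat {wval ws |ws. adm_word ws \<and> weight ws = w + w' \<and> length ws \<le> d + d'}"
    using * by (simp add: wval_mult val_span_def)
qed

lemma val_span_00_Rats: "x \<in> val_span 0 0 \<Longrightarrow> x \<in> \<rat>"
  unfolding val_span_def
proof (induction rule: real_rat.span_induct_alt)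
  case (step q a z)
  then have "a = 1" by auto
  then show ?case using step by simp
qed simp

section \<open>Regularization of divergent sums\<close>

definition s_letter :: letter where "s_letter = (1, \<lambda>_. 1)"

definition esum :: "nat \<Rightarrow> nat \<Rightarrow> real" where "esum p = nsum (replicate p s_letter)"

lemma valid_s [simp]: "valid s_letter" by (simp add: s_letter_def valid_def per4_def)

lemma esum_0 [simp]: "esum 0 N = 1" by (simp add: esum_def)

lemma log_bdd_esum [simp]: "log_bdd (esum p)"
  unfolding esum_def by (rule nsum_log_bdd) (simp add: list_all_iff)

text \<open>
  Divergences are measured against the sums \<open>esum p\<close> rather than against powers of the harmonic
  numbers, because their Abel means are exactly the monomials \<open>L\<^sup>p / p!\<close> with \<open>L = -ln (1 - x)\<close>.
\<close>

inductive log_reg :: "nat \<Rightarrow> nat \<Rightarrow> (nat \<Rightarrow> real) \<Rightarrow> real \<Rightarrow> bool" for w d where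
  log_reg_decaying: "decaying a \<Longrightarrow> log_reg w d a 0"
| log_reg_const: "x \<in> val_span w d \<Longrightarrow> log_reg w d (\<lambda>_. x) x"
| log_reg_esum: "1 \<le> p \<Longrightarrow> p \<le> w \<Longrightarrow> p \<le> d \<Longrightarrow> x \<in> val_span (w - p) (d - p) \<Longrightarrow> log_reg w d (\<lambda>N. x * esum p N) 0"
| log_reg_add: "log_reg w d a c \<Longrightarrow> log_reg w d b c' \<Longrightarrow> log_reg w d (\<lambda>N. a N + b N) (c + c')"

lemma log_reg_val_span: "log_reg w d a c \<Longrightarrow> c \<in> val_span w d"
  by (induction rule: log_reg.induct) (auto intro: val_span_add)

lemma log_reg_log_bdd: "log_reg w d a c \<Longrightarrow> log_bdd a"
  by (induction rule: log_reg.induct) (auto intro: decaying_log_bdd log_bdd_add log_bdd_mult)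

lemma log_reg_mono: "log_reg w d a c \<Longrightarrow> d \<le> d' \<Longrightarrow> log_reg w d' a c"
proof (induction rule: log_reg.induct)
  case (log_reg_esum p x) then show ?case by (intro log_reg.log_reg_esum) (auto intro: val_span_mono)
qed (auto intro: log_reg.intros val_span_mono)

lemma log_reg_scale: "log_reg w d a c \<Longrightarrow> q \<in> \<rat> \<Longrightarrow> log_reg w d (\<lambda>N. q * a N) (q * c)"
proof (induction rule: log_reg.induct)
  case (log_reg_decaying a) then show ?case using log_reg.log_reg_decaying[OF decaying_scale[of a q]] by simp
next
  case (log_reg_const x) then show ?case using log_reg.log_reg_const[OF val_span_scale[of q x]] by simp
next
  case (log_reg_esum p x) then show ?case using log_reg.log_reg_esum[of p w d "q * x"] val_span_scale[of q x] by (simp add: mult_ac)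
next
  case (log_reg_add a c b c') then show ?case using log_reg.log_reg_add by (fastforce simp: algebra_simps)
qed

lemma log_reg_diff: "log_reg w d a c \<Longrightarrow> log_reg w d b c' \<Longrightarrow> log_reg w d (\<lambda>N. a N - b N) (c - c')"
  using log_reg_add[of w d a c "\<lambda>N. -1 * b N" "-1 * c'"] log_reg_scale[of w d b c' "-1"] by simp

lemma log_reg_mult_const: "log_reg w d a c \<Longrightarrow> y \<in> val_span w' d' \<Longrightarrow> log_reg (w + w') (d + d') (\<lambda>N. a N * y) (c * y)"
proof (induction rule: log_reg.induct)
  case (log_reg_decaying a)
  then show ?case using log_reg.log_reg_decaying[OF decaying_scale[of a y]] by (simp add: mult.commute)
next
  case (log_reg_const x) then show ?case using log_reg.log_reg_const[OF val_span_mult] by simp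
next
  case (log_reg_esum p x)
  then have "x * y \<in> val_span ((w - p) + w') ((d - p) + d')" by (intro val_span_mult)
  with log_reg_esum show ?case using log_reg.log_reg_esum[of p "w + w'" "d + d'" "x * y"] by (simp add: mult_ac)
next
  case (log_reg_add a c b c') then show ?case using log_reg.log_reg_add by (fastforce simp: algebra_simps)
qed

text \<open>Splits a b into a y and a (b - y); the second part decays because \<open>a\<close> is
  only logarithmically large.\<close>

lemma log_reg_mult_conv:
  assumes "log_reg w d a c" "decaying (\<lambda>N. b N - y)" "y \<in> val_span w' d'"
  shows "log_reg (w + w') (d + d') (\<lambda>N. a N * b N) (c * y)"
proof -
  have "decaying (\<lambda>N. (b N - y) * a N)" by (rule decaying_mult_log_bdd[OF assms(2) log_reg_log_bdd[OF assms(1)]])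
  from log_reg_add[OF log_reg_mult_const[OF assms(1,3)] log_reg_decaying[OF this]] show ?thesis
    by (simp add: algebra_simps)
qed

lemma log_reg_sum_list:
  "(\<And>x. x \<in> set L \<Longrightarrow> \<exists>c. log_reg w d (f x) c) \<Longrightarrow> \<exists>c. log_reg w d (\<lambda>N. \<Sum>x\<leftarrow>L. f x N) c"
proof (induction L)
  case Nil then show ?case using log_reg_decaying[OF decaying_0] by auto
next
  case (Cons x L)
  obtain c where c: "log_reg w d (f x) c" using Cons.prems[of x] by auto
  obtain c' where "log_reg w d (\<lambda>N. \<Sum>x\<leftarrow>L. f x N) c'" using Cons.IH Cons.prems by (meson list.set_intros(2))
  from log_reg_add[OF c this] show ?case by auto
qed

lemma log_reg_wval: "adm_word ws \<Longrightarrow> log_reg (weight ws) (length ws) (nsum ws) (wval ws)"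
  using log_reg_add[OF log_reg_const[OF val_span_wval] log_reg_decaying[OF decaying_wval]] by fastforce

text \<open>Drawing from \<open>bs\<close> until it is exhausted gives the concatenation. Every
  other term uses \<open>v\<close>, alone or merged with a letter of \<open>bs\<close>, before that,
  so its prefix in \<open>B\<close> is strictly shorter and the next letter lies in
  \<open>D\<close>.\<close>

lemma qshuffle_bad_prefix:
  assumes "set bs \<subseteq> B" "v \<in> D" "\<And>b v. b \<in> B \<Longrightarrow> v \<in> D \<Longrightarrow> letter_mult b v \<in> D"
  shows "\<exists>L. qshuffle bs (v # vs) = (bs @ v # vs) # L \<and>
    (\<forall>ws\<in>set L. \<exists>bs' v' vs'. ws = bs' @ v' # vs' \<and> length bs' < length bs \<and> set bs' \<subseteq> B \<and> v' \<in> D)"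
  using assms(1)
proof (induction bs)
  case Nil then show ?case by auto
next
  case (Cons b bs)
  then obtain L where L: "qshuffle bs (v # vs) = (bs @ v # vs) # L"
    "\<forall>ws\<in>set L. \<exists>bs' v' vs'. ws = bs' @ v' # vs' \<and> length bs' < length bs \<and> set bs' \<subseteq> B \<and> v' \<in> D"
    by auto
  define L' where "L' = map ((#) b) L @ map ((#) v) (qshuffle (b # bs) vs) @ map ((#) (letter_mult b v)) (qshuffle bs vs)"
  have "qshuffle (b # bs) (v # vs) = ((b # bs) @ v # vs) # L'" by (simp add: L L'_def)
  moreover have "\<exists>bs' v' vs'. ws = bs' @ v' # vs' \<and> length bs' < length (b # bs) \<and> set bs' \<subseteq> B \<and> v' \<in> D"
    if "ws \<in> set L'" for ws
  proof -
    from that consider w where "w \<in> set L" "ws = b # w" | w where "ws = v # w"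
      | w where "ws = letter_mult b v # w" unfolding L'_def by auto
    then show ?thesis
    proof cases
      case 1
      then obtain bs' v' vs' where "w = bs' @ v' # vs'" "length bs' < length bs" "set bs' \<subseteq> B" "v' \<in> D"
        using L(2) by blast
      with 1 Cons.prems show ?thesis by (intro exI[of _ "b # bs'"]) auto
    next
      case 2 with assms(2) show ?thesis by (intro exI[of _ "[]"]) auto
    next
      case 3 with assms(2,3) Cons.prems show ?thesis by (intro exI[of _ "[]"]) auto
    qed
  qed
  ultimately show ?case by blast
qed

lemma qshuffle_set_closed:
  assumes "ws \<in> set (qshuffle us vs)" "\<And>a b. a \<in> Q \<Longrightarrow> b \<in> Q \<Longrightarrow> letter_mult a b \<in> Q"
    "set us \<subseteq> Q" "set vs \<subseteq> Q"
  shows "set ws \<subseteq> Q"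
  using assms(1,3,4)
proof (induction us vs arbitrary: ws rule: qshuffle.induct)
  case (3 u us v vs)
  from "3.prems" consider
      w where "w \<in> set (qshuffle us (v # vs))" "ws = u # w"
    | w where "w \<in> set (qshuffle (u # us) vs)" "ws = v # w"
    | w where "w \<in> set (qshuffle us vs)" "ws = letter_mult u v # w" by auto
  then show ?case
  proof cases
    case 1 then show ?thesis using "3.IH"(1)[of w] "3.prems" by auto
  next
    case 2 then show ?thesis using "3.IH"(2)[of w] "3.prems" by auto
  next
    case 3 then show ?thesis using "3.IH"(3)[of w] "3.prems" assms(2) by auto
  qed
qed auto

text \<open>The product \<open>nsum bs * nsum vs\<close> is the wanted word plus words with a
  shorter bad prefix, so induction on the prefix length solves for the wanted word. The sets are
  abstract because the argument runs twice: first inside level 2 with \<open>s_letter\<close> as the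
  only bad letter, then for all valid letters with \<open>s_letter\<close> and
  \<open>y_letter\<close> as bad letters, whose pure words the first run has settled.\<close>

lemma log_reg_strip_prefix:
  assumes BQ: "B \<subseteq> Q" and DQ: "D \<subseteq> Q"
    and BD: "\<And>b v. b \<in> B \<Longrightarrow> v \<in> D \<Longrightarrow> letter_mult b v \<in> D"
    and QQ: "\<And>a b. a \<in> Q \<Longrightarrow> b \<in> Q \<Longrightarrow> letter_mult a b \<in> Q"
    and pure: "\<And>bs. set bs \<subseteq> B \<Longrightarrow> \<exists>c. log_reg (weight bs) (length bs) (nsum bs) c"
    and lead: "\<And>v vs. v \<in> D \<Longrightarrow> set vs \<subseteq> Q \<Longrightarrow>
        \<exists>y\<in>val_span (weight (v # vs)) (length (v # vs)). decaying (\<lambda>N. nsum (v # vs) N - y)"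
    and "set bs \<subseteq> B" "set vs \<subseteq> Q" "vs = [] \<or> hd vs \<in> D"
  shows "\<exists>c. log_reg (weight (bs @ vs)) (length (bs @ vs)) (nsum (bs @ vs)) c"
  using assms(7-)
proof (induction "length bs" arbitrary: bs vs rule: less_induct)
  case less
  show ?case
  proof (cases vs)
    case Nil then show ?thesis using pure less.prems by simp
  next
    case (Cons v vs')
    with less.prems have v: "v \<in> D" "set vs' \<subseteq> Q" by auto
    obtain y where y: "y \<in> val_span (weight vs) (length vs)" "decaying (\<lambda>N. nsum vs N - y)"
      using lead[OF v] Cons by blast
    obtain c where c: "log_reg (weight bs) (length bs) (nsum bs) c" using pure less.prems by blast
    obtain L where L: "qshuffle bs (v # vs') = (bs @ v # vs') # L"
      "\<forall>ws\<in>set L. \<exists>bs' v' vs'. ws = bs' @ v' # vs' \<and> length bs' < length bs \<and> set bs' \<subseteq> B \<and> v' \<in> D"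
      using qshuffle_bad_prefix[OF less.prems(1) v(1) BD, of vs'] by blast
    have "\<exists>c. log_reg (weight (bs @ vs)) (length (bs @ vs)) (\<lambda>N. \<Sum>ws\<leftarrow>L. nsum ws N) c"
    proof (rule log_reg_sum_list)
      fix ws assume ws: "ws \<in> set L"
      then have q: "ws \<in> set (qshuffle bs vs)" using L Cons by simp
      obtain bs' v' vs'' where d: "ws = bs' @ v' # vs''" "length bs' < length bs" "set bs' \<subseteq> B" "v' \<in> D"
        using L(2) ws by blast
      have "set ws \<subseteq> Q" using less.prems BQ by (intro qshuffle_set_closed[OF q QQ]) auto
      then have "\<exists>c. log_reg (weight ws) (length ws) (nsum ws) c"
        using less.hyps[of bs' "v' # vs''"] d by simp
      then show "\<exists>c. log_reg (weight (bs @ vs)) (length (bs @ vs)) (nsum ws) c"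
        using qshuffle_props[OF q] log_reg_mono by fastforce
    qed
    then obtain c' where c': "log_reg (weight (bs @ vs)) (length (bs @ vs)) (\<lambda>N. \<Sum>ws\<leftarrow>L. nsum ws N) c'" by blast
    have "log_reg (weight (bs @ vs)) (length (bs @ vs)) (\<lambda>N. nsum bs N * nsum vs N) (c * y)"
      using log_reg_mult_conv[OF c y(2,1)] by simp
    from log_reg_diff[OF this c'] have "log_reg (weight (bs @ vs)) (length (bs @ vs)) (nsum (bs @ vs)) (c * y - c')"
      by (simp add: nsum_mult Cons L)
    then show ?thesis by blast
  qed
qed

text \<open>
  Words in the two non-admissible letters \<open>1 / m\<close> and \<open>(-1)\<^sup>m / m\<close> are of level 2. Substituting \<open>2 m\<close>
  for each summation variable makes the letter \<open>(-1)\<^sup>m / m\<close> admissible.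
\<close>

definition alt_char :: "int \<Rightarrow> real" where "alt_char m = (if even m then 1 else -1)"

definition y_letter :: letter where "y_letter = (1, alt_char)"

lemma per4_alt_char [simp]: "per4 alt_char" by (auto simp: per4_def alt_char_def)

lemma valid_y [simp]: "valid y_letter" by (simp add: y_letter_def valid_def)

definition level2 :: "letter set" where "level2 = {(k, g) | k g. k \<ge> 1 \<and> g \<in> {\<lambda>_. 1, alt_char}}"

text \<open>The factor \<open>2 ^ fst a\<close> cancels the one that the denominator acquires at 2
  m, so sums up to 2 N reproduce the original sums up to N.\<close>

definition double_letter :: "letter \<Rightarrow> letter" where
  "double_letter a = (fst a, \<lambda>m. if even m then 2 ^ fst a * snd a (m div 2) else 0)"

lemma nsum_double_letter: "nsum (map double_letter ws) (2 * N) = nsum ws N"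
proof (induction ws arbitrary: N)
  case (Cons a ws)
  show ?case
  proof (induction N)
    case (Suc N)
    have odd0: "letter_fun (double_letter a) (int (Suc (2 * N))) = 0"
      by (simp add: letter_fun_def double_letter_def)
    have even: "letter_fun (double_letter a) (int (Suc (Suc (2 * N)))) = letter_fun a (int (Suc N))"
      by (simp add: letter_fun_def double_letter_def power_mult_distrib[symmetric] field_simps)
    have odd_step: "nsum (map double_letter ws) (Suc (2 * N)) = nsum (map double_letter ws) (2 * N)"
      by (cases ws) (simp_all add: nsum_Cons_Suc letter_fun_def double_letter_def)
    have "nsum (map double_letter (a # ws)) (2 * Suc N) = nsum (map double_letter (a # ws)) (2 * N) + letter_fun a (int (Suc N)) * nsum ws N"
      using Cons[of N] odd0 even odd_step by (simp add: nsum_Cons_Suc del: of_nat_Suc)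
    with Suc show ?case by (simp add: nsum_Cons_Suc)
  qed simp
qed simp

text \<open>A word headed by \<open>y_letter\<close> converges without being an
  \<open>adm_word\<close>, so its limit is not visibly in \<open>val_span\<close>. The doubled word
  has the same limit and is admissible: period 2 becomes period 4, and the sign change of
  \<open>alt_char\<close> under m + 1 becomes antiperiodicity.\<close>

lemma level2_wval:
  assumes "set ws \<subseteq> level2" "ws = [] \<or> hd ws \<noteq> s_letter"
  shows "\<exists>y\<in>val_span (weight ws) (length ws). decaying (\<lambda>N. nsum ws N - y)"
proof -
  have valid: "valid (double_letter a)" if "a \<in> level2" for a
  proof -
    have "(m + 4) div 2 = m div 2 + (2::int)" for m by simp
    then show ?thesis using that unfolding level2_def valid_def per4_def
      by (auto simp: double_letter_def alt_char_def)
  qed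
  have adm: "adm (double_letter a)" if "a \<in> level2" "a \<noteq> s_letter" for a
  proof -
    obtain k g where a: "a = (k, g)" "k \<ge> 1" "g = (\<lambda>_. 1) \<or> g = alt_char" using \<open>a \<in> level2\<close>
      by (auto simp: level2_def)
    show ?thesis
    proof (cases "k = 1")
      case True
      then have "g = alt_char" using a \<open>a \<noteq> s_letter\<close> by (auto simp: s_letter_def)
      moreover have "(m + 2) div 2 = m div 2 + (1::int)" for m by simp
      ultimately have "anti (snd (double_letter a))" by (auto simp: a double_letter_def anti_def alt_char_def)
      then show ?thesis by (simp add: adm_def)
    qed (use a in \<open>auto simp: adm_def double_letter_def\<close>)
  qed
  have adw: "adm_word (map double_letter ws)"
  proof (cases ws)
    case (Cons a as)
    then have "a \<in> level2" "set as \<subseteq> level2" "a \<noteq> s_letter" using assms by auto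
    then have "\<forall>x\<in>set (map double_letter ws). valid x" "adm (double_letter a)" using valid adm Cons by auto
    then show ?thesis by (simp add: Cons adm_word_def list_all_iff)
  qed (simp add: adm_word_def)
  have "decaying (\<lambda>N. nsum ws N - wval (map double_letter ws))"
    using decaying_subseq_double[OF decaying_wval[OF adw]] by (simp add: nsum_double_letter)
  moreover have "wval (map double_letter ws) \<in> val_span (weight ws) (length ws)"
    by (rule val_span_wval[OF adw]) (auto simp: weight_def o_def double_letter_def)
  ultimately show ?thesis by blast
qed

lemma level2_mult: "a \<in> level2 \<Longrightarrow> b \<in> level2 \<Longrightarrow> letter_mult a b \<in> level2"
proof -
  have "(\<lambda>m. alt_char m * alt_char m) = (\<lambda>_. 1)" by (auto simp: alt_char_def)
  then show "a \<in> level2 \<Longrightarrow> b \<in> level2 \<Longrightarrow> letter_mult a b \<in> level2"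
    by (auto simp: level2_def letter_mult_def)
qed

lemma level2_log_reg:
  assumes "set ws \<subseteq> level2" shows "\<exists>c. log_reg (weight ws) (length ws) (nsum ws) c"
proof -
  define bs vs where "bs = takeWhile (\<lambda>a. a = s_letter) ws" and "vs = dropWhile (\<lambda>a. a = s_letter) ws"
  have ws: "ws = bs @ vs" by (simp add: bs_def vs_def)
  have "\<exists>c. log_reg (weight (bs @ vs)) (length (bs @ vs)) (nsum (bs @ vs)) c"
  proof (rule log_reg_strip_prefix[where B = "{s_letter}" and Q = level2 and D = "level2 - {s_letter}"])
    show "{s_letter} \<subseteq> level2" by (auto simp: level2_def s_letter_def)
    show "letter_mult b v \<in> level2 - {s_letter}" if "b \<in> {s_letter}" "v \<in> level2 - {s_letter}" for b v
      using that level2_mult[of b v] \<open>{s_letter} \<subseteq> level2\<close> 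
      by (auto simp: level2_def s_letter_def letter_mult_def)
    show "\<exists>c. log_reg (weight bs) (length bs) (nsum bs) c" if "set bs \<subseteq> {s_letter}" for bs
    proof -
      have "\<And>x. x \<in> set bs \<Longrightarrow> x = s_letter" using that by auto
      then have bs: "bs = replicate (length bs) s_letter" by (induction bs) auto
      have wb: "weight bs = length bs" by (subst bs) (simp add: weight_def s_letter_def sum_list_replicate)
      show ?thesis
      proof (cases "bs = []")
        case True then show ?thesis using log_reg_wval[of "[]"] by (auto simp: adm_word_def)
      next
        case False
        \<comment> \<open>Pure powers of \<open>s_letter\<close> are the reference divergences
          themselves, so their constant is 0.\<close>
        have "log_reg (length bs) (length bs) (\<lambda>N. 1 * esum (length bs) N) 0"
          using False by (intro log_reg_esum) (auto simp: Suc_le_eq)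
        then show ?thesis using bs by (auto simp: esum_def wb)
      qed
    qed
    show "\<exists>y\<in>val_span (weight (v # vs)) (length (v # vs)). decaying (\<lambda>N. nsum (v # vs) N - y)"
      if "v \<in> level2 - {s_letter}" "set vs \<subseteq> level2" for v vs
      using that by (intro level2_wval) auto
    show "set bs \<subseteq> {s_letter}" by (auto simp: bs_def dest: set_takeWhileD)
    show "set vs \<subseteq> level2" using assms by (auto simp: vs_def dest: set_dropWhileD)
    show "vs = [] \<or> hd vs \<in> level2 - {s_letter}"
    proof (cases vs)
      case (Cons v vs')
      then have "v \<noteq> s_letter" using hd_dropWhile[of "\<lambda>a. a = s_letter" ws] unfolding vs_def by fastforce
      moreover have "v \<in> level2" using \<open>set vs \<subseteq> level2\<close> Cons by simp
      ultimately show ?thesis using Cons by simp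
    qed simp
  qed (auto intro: level2_mult)
  then show ?thesis using ws by simp
qed

lemma log_reg_adm_tail:
  assumes "set bs \<subseteq> {s_letter, y_letter}" "adm_word vs"
  shows "\<exists>c. log_reg (weight (bs @ vs)) (length (bs @ vs)) (nsum (bs @ vs)) c"
proof (rule log_reg_strip_prefix[where B = "{s_letter, y_letter}" and Q = "{a. valid a}" and D = "{a. valid a \<and> adm a}"])
  show "\<exists>c. log_reg (weight bs) (length bs) (nsum bs) c" if "set bs \<subseteq> {s_letter, y_letter}" for bs
    using that by (intro level2_log_reg) (auto simp: level2_def s_letter_def y_letter_def)
  show "\<exists>y\<in>val_span (weight (v # vs)) (length (v # vs)). decaying (\<lambda>N. nsum (v # vs) N - y)"
    if "v \<in> {a. valid a \<and> adm a}" "set vs \<subseteq> {a. valid a}" for v vs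
  proof -
    have "adm_word (v # vs)" using that by (auto simp: adm_word_def list_all_iff)
    then show ?thesis using decaying_wval val_span_wval by blast
  qed
  show "vs = [] \<or> hd vs \<in> {a. valid a \<and> adm a}" 
    using assms(2) unfolding adm_word_def by (cases vs) simp_all
  show "set vs \<subseteq> {a. valid a}" using assms(2) by (auto simp: adm_word_def list_all_iff)
  show "set bs \<subseteq> {s_letter, y_letter}" by (rule assms(1))
qed (auto simp: valid_mult adm_mult)

text \<open>Fourier analysis modulo 4 over the rationals: the mean, the coefficient of (-1)^m, and
  the joint contribution of the two characters of order 4, which is antiperiodic. The nested form of
  the equation fits two applications of \<open>nsum_linear\<close>.\<close>

lemma per4_decompose:
  assumes "per4 g"
  obtains \<alpha> \<beta> h where "\<alpha> \<in> \<rat>" "\<beta> \<in> \<rat>" "per4 h" "anti h"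
    "g = (\<lambda>m. \<alpha> * 1 + 1 * (\<lambda>m. \<beta> * alt_char m + 1 * h m) m)"
proof
  define \<alpha> \<beta> where "\<alpha> = (g 0 + g 1 + g 2 + g 3) / 4" and "\<beta> = (g 0 - g 1 + g 2 - g 3) / 4"
  define h where "h m = g m - \<alpha> - \<beta> * alt_char m" for m
  have r: "g m \<in> \<rat>" for m using assms by (simp add: per4_def)
  show rat: "\<alpha> \<in> \<rat>" "\<beta> \<in> \<rat>" using r by (auto simp: \<alpha>_def \<beta>_def)
  show ph: "per4 h" using assms rat unfolding h_def per4_def by (auto simp: alt_char_def)
  show "anti h"
    by (rule antiI[OF ph]) (auto simp: h_def \<alpha>_def \<beta>_def alt_char_def field_simps)
  show "g = (\<lambda>m. \<alpha> * 1 + 1 * (\<lambda>m. \<beta> * alt_char m + 1 * h m) m)" by (auto simp: h_def)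
qed

text \<open>The prefix \<open>bs\<close> collects letters already reduced to \<open>s_letter\<close>
  or \<open>y_letter\<close>. A next letter outside \<open>adm\<close> has exponent 1: its
  components of period 2 join the prefix and the recursion goes on, while its antiperiodic component
  heads an admissible tail and ends it.\<close>

theorem log_reg_valid:
  assumes "list_all valid ws" shows "\<exists>c. log_reg (weight ws) (length ws) (nsum ws) c"
proof -
  have "\<exists>c. log_reg (weight (bs @ ws)) (length (bs @ ws)) (nsum (bs @ ws)) c"
    if "set bs \<subseteq> {s_letter, y_letter}" "list_all valid ws" for bs
    using that
  proof (induction ws arbitrary: bs)
    case Nil then show ?case using log_reg_adm_tail[of bs "[]"] by (simp add: adm_word_def)
  next
    case (Cons a ws)
    show ?case
    proof (cases "adm a")
      case True then show ?thesis using log_reg_adm_tail[of bs "a # ws"] Cons.prems by (simp add: adm_word_def)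
    next
      case False
      then have k1: "fst a = 1" using Cons.prems by (auto simp: adm_def valid_def)
      obtain \<alpha> \<beta> h where d: "\<alpha> \<in> \<rat>" "\<beta> \<in> \<rat>" "per4 h" "anti h"
        "snd a = (\<lambda>m. \<alpha> * 1 + 1 * (\<lambda>m. \<beta> * alt_char m + 1 * h m) m)"
        using per4_decompose[of "snd a"] Cons.prems by (auto simp: valid_def)
      have a: "a = (1, \<lambda>m. \<alpha> * 1 + 1 * (\<lambda>m. \<beta> * alt_char m + 1 * h m) m)" using k1 d(5) by (metis prod.collapse)
      let ?w = "weight (bs @ a # ws)" and ?d = "length (bs @ a # ws)"
      obtain c1 where c1: "log_reg ?w ?d (nsum (bs @ s_letter # ws)) c1"
        using Cons.IH[of "bs @ [s_letter]"] Cons.prems k1 by (auto simp: s_letter_def)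
      obtain c2 where c2: "log_reg ?w ?d (nsum (bs @ y_letter # ws)) c2"
        using Cons.IH[of "bs @ [y_letter]"] Cons.prems k1 by (auto simp: y_letter_def)
      obtain c3 where c3: "log_reg ?w ?d (nsum (bs @ (1, h) # ws)) c3"
      proof -
        have "list_all valid ws" using Cons.prems by simp
        then have "adm_word ((1, h) # ws)" using d by (simp add: adm_word_def adm_def) (simp add: valid_def)
        from log_reg_adm_tail[OF Cons.prems(1) this] obtain c where
          "log_reg (weight (bs @ (1, h) # ws)) (length (bs @ (1, h) # ws)) (nsum (bs @ (1, h) # ws)) c" by blast
        moreover have "weight (bs @ (1, h) # ws) = ?w" "length (bs @ (1, h) # ws) = ?d" by (simp_all add: k1)
        ultimately show ?thesis using that by metis
      qed
      have eq: "nsum (bs @ a # ws) N = \<alpha> * nsum (bs @ s_letter # ws) N +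
          (\<beta> * nsum (bs @ y_letter # ws) N + nsum (bs @ (1, h) # ws) N)" for N
      proof -
        have "nsum (bs @ a # ws) N = \<alpha> * nsum (bs @ (1, \<lambda>_. 1) # ws) N
            + 1 * nsum (bs @ (1, \<lambda>m. \<beta> * alt_char m + 1 * h m) # ws) N"
          unfolding a by (rule nsum_linear)
        also have "nsum (bs @ (1, \<lambda>m. \<beta> * alt_char m + 1 * h m) # ws) N = \<beta> * nsum (bs @ (1, alt_char) # ws) N + 1 * nsum (bs @ (1, h) # ws) N"
          by (rule nsum_linear)
        finally show ?thesis by (simp only: s_letter_def y_letter_def mult_1)
      qed
      have "log_reg ?w ?d (\<lambda>N. \<alpha> * nsum (bs @ s_letter # ws) N +
          (\<beta> * nsum (bs @ y_letter # ws) N + nsum (bs @ (1, h) # ws) N)) (\<alpha> * c1 + (\<beta> * c2 + c3))"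
        by (intro log_reg_add log_reg_scale c1 c2 c3 d)
      then show ?thesis unfolding eq[symmetric] by blast
    qed
  qed
  from this[of "[]"] assms show ?thesis by simp
qed

section \<open>The antipode relation\<close>

text \<open>Models \<open>AMMV_lower w r\<close> with bounded instead of exact depths and with
  arbitrary characters modulo 4; \<open>low_span_subset_AMMV_lower\<close> shows that this gives
  nothing larger.\<close>

definition low_span :: "nat \<Rightarrow> nat \<Rightarrow> real set" where
  "low_span w r = span_rat (val_span w (r - 1) \<union> {x * y | x y w1 w2 d1 d2. x \<in> val_span w1 d1 \<and> y \<in> val_span w2 d2 \<and>
     w1 + w2 = w \<and> d1 + d2 = r \<and> w1 > 0 \<and> w2 > 0 \<and> d1 > 0 \<and> d2 > 0})"

lemma low_span_0 [simp]: "0 \<in> low_span w r" by (simp add: low_span_def real_rat.span_zero)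
lemma low_span_add: "x \<in> low_span w r \<Longrightarrow> y \<in> low_span w r \<Longrightarrow> x + y \<in> low_span w r"
  by (simp add: low_span_def real_rat.span_add)
lemma low_span_scale: "q \<in> \<rat> \<Longrightarrow> x \<in> low_span w r \<Longrightarrow> q * x \<in> low_span w r"
  by (auto simp: low_span_def Rats_def intro: real_rat.span_scale)
lemma low_span_minus: "x \<in> low_span w r \<Longrightarrow> - x \<in> low_span w r" using low_span_scale[of "-1"] by simp
lemma low_span_diff: "x \<in> low_span w r \<Longrightarrow> y \<in> low_span w r \<Longrightarrow> x - y \<in> low_span w r"
  using low_span_add[of x w r "-y"] low_span_minus by simp
lemma low_span_sum: "(\<And>i. i \<in> A \<Longrightarrow> f i \<in> low_span w r) \<Longrightarrow> sum f A \<in> low_span w r"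
  unfolding low_span_def by (rule real_rat.span_sum)
lemma low_span_val_span: "x \<in> val_span w d \<Longrightarrow> d < r \<Longrightarrow> x \<in> low_span w r"
  unfolding low_span_def by (rule real_rat.span_base) (auto intro: val_span_mono)
lemma low_span_mult:
  "x \<in> val_span w1 d1 \<Longrightarrow> y \<in> val_span w2 d2 \<Longrightarrow> w1 + w2 = w \<Longrightarrow> d1 + d2 = r \<Longrightarrow>
   w1 > 0 \<Longrightarrow> w2 > 0 \<Longrightarrow> d1 > 0 \<Longrightarrow> d2 > 0 \<Longrightarrow> x * y \<in> low_span w r"
  unfolding low_span_def by (rule real_rat.span_base) blast

lemma valid_weight_pos: "list_all valid ws \<Longrightarrow> ws \<noteq> [] \<Longrightarrow> weight ws > 0"
  by (cases ws) (auto simp: valid_def)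

lemma log_reg_sum:
  "finite A \<Longrightarrow> (\<And>i. i \<in> A \<Longrightarrow> log_reg w d (f i) (c i)) \<Longrightarrow> log_reg w d (\<lambda>N. \<Sum>i\<in>A. f i N) (\<Sum>i\<in>A. c i)"
proof (induction A rule: finite_induct)
  case empty then show ?case using log_reg_decaying[OF decaying_0] by simp
next
  case (insert x F) then show ?case by (simp add: log_reg_add)
qed

text \<open>Non-strict chains with one sign per letter; on the reversed word this is the
  antipode.\<close>

fun star_nsum :: "letter list \<Rightarrow> nat \<Rightarrow> real" where
  "star_nsum [] N = 1"
| "star_nsum (a # ws) N = - (\<Sum>m=1..N. letter_fun a (int m) * star_nsum ws m)"

declare star_nsum.simps(2) [simp del]

lemma star_nsum_Cons_0 [simp]: "star_nsum (a # ws) 0 = 0" by (simp add: star_nsum.simps)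

lemma star_nsum_Cons_Suc: "star_nsum (a # ws) (Suc N) = star_nsum (a # ws) N - letter_fun a (int (Suc N)) * star_nsum ws (Suc N)"
  by (simp add: star_nsum.simps)

text \<open>Two independent bounds, so that each can be raised alone: the first acts on the first
  letter of the word, the second on the last.\<close>

definition antipode_sum :: "letter list \<Rightarrow> nat \<Rightarrow> nat \<Rightarrow> real" where
  "antipode_sum ws N N' = (\<Sum>i\<le>length ws. nsum (take i ws) N * star_nsum (rev (drop i ws)) N')"

lemma antipode_sum_Cons:
  "antipode_sum (a # ws) (Suc N) N' = antipode_sum (a # ws) N N' + letter_fun a (int (Suc N)) * antipode_sum ws N N'"
  unfolding antipode_sum_def length_Cons
  by (subst (1 2) sum.atMost_Suc_shift)
     (simp add: nsum_Cons_Suc sum.distrib sum_distrib_left algebra_simps del: of_nat_Suc)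

lemma antipode_sum_snoc:
  "antipode_sum (ws @ [a]) N (Suc N') = antipode_sum (ws @ [a]) N N' - letter_fun a (int (Suc N')) * antipode_sum ws N (Suc N')"
  unfolding antipode_sum_def
  by (simp add: star_nsum_Cons_Suc sum_subtractf sum_distrib_left algebra_simps del: of_nat_Suc)

text \<open>Raising the second bound first gives the product of all -a(N + 1), letter by letter from
  the right. Raising the first bound then adds a(N + 1) times the same product without the first
  letter, and the two cancel.\<close>

lemma antipode_sum_eq: "antipode_sum ws N N = (if ws = [] then 1 else 0)"
proof (induction N arbitrary: ws)
  case 0
  show ?case
  proof (cases ws)
    case Nil then show ?thesis by (simp add: antipode_sum_def)
  next
    case (Cons a vs)
    have z: "nsum (take i ws) 0 * star_nsum (rev (drop i ws)) 0 = 0" if "i \<le> length ws" for i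
    proof (cases i)
      case 0
      have "rev ws \<noteq> []" using Cons by simp
      then obtain b us where "rev ws = b # us" by (cases "rev ws") auto
      then show ?thesis using 0 by simp
    next
      case (Suc j) then show ?thesis by (simp add: Cons)
    qed
    then show ?thesis using Cons unfolding antipode_sum_def by (subst sum.neutral) auto
  qed
next
  case (Suc N)
  have half: "antipode_sum us N (Suc N) = (\<Prod>a\<leftarrow>us. - letter_fun a (int (Suc N)))" for us
  proof (induction us rule: rev_induct)
    case Nil then show ?case by (simp add: antipode_sum_def)
  next
    case (snoc a us)
    then show ?case by (simp only: antipode_sum_snoc Suc.IH) simp
  qed
  show ?case
  proof (cases ws)
    case Nil then show ?thesis by (simp add: antipode_sum_def)
  next
    case (Cons a vs)
    then show ?thesis by (simp only: antipode_sum_Cons half) simp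
  qed
qed

text \<open>Resolves non-strict chains into strict ones: equality of neighbouring variables merges
  their letters.\<close>

fun star_words :: "letter list \<Rightarrow> letter list list" where
  "star_words [] = [[]]"
| "star_words (a # ws) = concat (map (\<lambda>u. (a # u) #
      (case u of [] \<Rightarrow> [] | b # u' \<Rightarrow> [letter_mult a b # u'])) (star_words ws))"

lemma star_nsum_eq: "star_nsum ws N = (-1) ^ length ws * (\<Sum>u\<leftarrow>star_words ws. nsum u N)"
proof (induction ws arbitrary: N)
  case (Cons a ws)
  have 1: "letter_fun a (int m) * nsum u m = letter_fun a (int m) * nsum u (m - 1) +
      (\<Sum>v\<leftarrow>(case u of [] \<Rightarrow> [] | b # u' \<Rightarrow> [letter_mult a b # u']). letter_fun (hd v) (int m) * nsum (tl v) (m - 1))"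
    if "m \<ge> 1" for u m
    using that by (cases m) (auto simp: nsum_Cons_Suc letter_fun_mult algebra_simps split: list.splits simp del: of_nat_Suc)
  have 2: "(\<Sum>m=1..N. letter_fun a (int m) * nsum u m) = (\<Sum>v\<leftarrow>(a # u) #
      (case u of [] \<Rightarrow> [] | b # u' \<Rightarrow> [letter_mult a b # u']). nsum v N)" for u
  proof -
    have "(\<Sum>m=1..N. letter_fun a (int m) * nsum u m) = (\<Sum>m=1..N. letter_fun a (int m) * nsum u (m - 1) +
      (\<Sum>v\<leftarrow>(case u of [] \<Rightarrow> [] | b # u' \<Rightarrow> [letter_mult a b # u']). letter_fun (hd v) (int m) * nsum (tl v) (m - 1)))"
      by (rule sum.cong[OF refl], rule 1) auto
    then show ?thesis by (auto simp: nsum.simps sum.distrib split: list.splits)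
  qed
  have 3: "(\<Sum>m=1..N. letter_fun a (int m) * (\<Sum>u\<leftarrow>L. nsum u m)) =
     (\<Sum>v\<leftarrow>concat (map (\<lambda>u. (a # u) # (case u of [] \<Rightarrow> [] | b # u' \<Rightarrow> [letter_mult a b # u'])) L). nsum v N)" for L
  proof (induction L)
    case (Cons u L)
    have "(\<Sum>m=1..N. letter_fun a (int m) * (\<Sum>u\<leftarrow>u # L. nsum u m)) =
      (\<Sum>m=1..N. letter_fun a (int m) * nsum u m) + (\<Sum>m=1..N. letter_fun a (int m) * (\<Sum>u\<leftarrow>L. nsum u m))"
      by (simp add: distrib_left sum.distrib)
    then show ?case unfolding 2 Cons by simp
  qed simp
  have "star_nsum (a # ws) N = - ((-1) ^ length ws * (\<Sum>m=1..N. letter_fun a (int m) * (\<Sum>u\<leftarrow>star_words ws. nsum u m)))"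
    by (simp add: star_nsum.simps Cons sum_distrib_left mult_ac)
  then show ?case unfolding 3 by simp
qed simp

lemma star_words_props:
  assumes "list_all valid ws"
  shows "\<exists>L. star_words ws = ws # L \<and>
     (\<forall>u\<in>set L. list_all valid u \<and> weight u = weight ws \<and> length u < length ws)"
  using assms
proof (induction ws)
  case (Cons a ws)
  then obtain L where L: "star_words ws = ws # L"
    "\<forall>u\<in>set L. list_all valid u \<and> weight u = weight ws \<and> length u < length ws" by auto
  define L' where "L' = (case ws of [] \<Rightarrow> [] | b # u' \<Rightarrow> [letter_mult a b # u']) @
     concat (map (\<lambda>u. (a # u) # (case u of [] \<Rightarrow> [] | b # u' \<Rightarrow> [letter_mult a b # u'])) L)"
  have "star_words (a # ws) = (a # ws) # L'" by (simp add: L L'_def)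
  moreover have "list_all valid u \<and> weight u = weight (a # ws) \<and> length u < length (a # ws)" if "u \<in> set L'" for u
  proof -
    from that consider b u' where "ws = b # u'" "u = letter_mult a b # u'"
      | v where "v \<in> set L" "u = a # v" | v b u' where "v \<in> set L" "v = b # u'" "u = letter_mult a b # u'"
      unfolding L'_def by (auto split: list.splits)
    then show ?thesis
    proof cases
      case 1 then show ?thesis using Cons.prems by (auto simp: valid_mult)
    next
      case 2 then show ?thesis using Cons.prems L by auto
    next
      case 3
      then have "list_all valid v \<and> weight v = weight ws \<and> length v < length ws" using L by blast
      with 3 show ?thesis using Cons.prems by (auto simp: valid_mult)
    qed
  qed
  ultimately show ?case by blast
qed simp

lemma star_nsum_log_reg:
  assumes "list_all valid ws" shows "\<exists>c. log_reg (weight ws) (length ws) (star_nsum ws) c"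
proof -
  obtain L where L: "star_words ws = ws # L"
    "\<forall>u\<in>set L. list_all valid u \<and> weight u = weight ws \<and> length u < length ws"
    using star_words_props[OF assms] by blast
  have "\<exists>c. log_reg (weight ws) (length ws) (\<lambda>N. \<Sum>u\<leftarrow>star_words ws. nsum u N) c"
  proof (rule log_reg_sum_list)
    fix u assume "u \<in> set (star_words ws)"
    then have u: "list_all valid u" "weight u = weight ws" "length u \<le> length ws" using L assms by auto
    then show "\<exists>c. log_reg (weight ws) (length ws) (nsum u) c" using log_reg_valid[OF u(1)] log_reg_mono by metis
  qed
  then obtain c where "log_reg (weight ws) (length ws) (\<lambda>N. \<Sum>u\<leftarrow>star_words ws. nsum u N) c" by blast
  from log_reg_scale[OF this, of "(-1) ^ length ws"]
  have "log_reg (weight ws) (length ws) (star_nsum ws) ((-1) ^ length ws * c)" unfolding star_nsum_eq[abs_def] by simp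
  then show ?thesis by blast
qed

text \<open>The antipode identity solved for the reversed word. Its middle terms pair a convergent
  initial segment with a star sum, so their constants are products, and the proper merges in
  \<open>star_words\<close> have lower depth. This produces a regularization of the reversed word
  whose constant is known modulo lower terms.\<close>

lemma log_reg_rev:
  assumes "adm_word ws" "ws \<noteq> []"
  obtains c where "log_reg (weight ws) (length ws) (nsum (rev ws)) c"
    "c - (-1) ^ (length ws - 1) * wval ws \<in> low_span (weight ws) (length ws)"
proof -
  define r w where "r = length ws" and "w = weight ws"
  have r: "r > 0" using assms(2) by (simp add: r_def)
  have v: "list_all valid ws" using assms(1) by (simp add: adm_word_def)
  obtain L where L: "star_words (rev ws) = rev ws # L"
    "\<forall>u\<in>set L. list_all valid u \<and> weight u = w \<and> length u < r"
    using star_words_props[of "rev ws"] v by (auto simp: w_def r_def)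
  have "\<exists>c. log_reg w (r - 1) (\<lambda>N. \<Sum>u\<leftarrow>L. nsum u N) c"
  proof (rule log_reg_sum_list)
    fix u assume "u \<in> set L"
    then have u: "list_all valid u" "weight u = w" "length u \<le> r - 1" using L(2) by auto
    then show "\<exists>c. log_reg w (r - 1) (nsum u) c" using log_reg_valid[OF u(1)] log_reg_mono by metis
  qed
  then obtain cL where cL: "log_reg w (r - 1) (\<lambda>N. \<Sum>u\<leftarrow>L. nsum u N) cL" by blast
  note adm_take = adm_word_take[OF assms(1)]
  have "\<exists>c. log_reg w r (\<lambda>N. nsum (take i ws) N * star_nsum (rev (drop i ws)) N) c \<and> c \<in> low_span w r"
    if i: "i \<in> {1..<r}" for i
  proof -
    have vd: "list_all valid (rev (drop i ws))" using v by (auto simp: list_all_iff dest: in_set_dropD)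
    obtain c where c: "log_reg (weight (drop i ws)) (r - i) (star_nsum (rev (drop i ws))) c"
      using star_nsum_log_reg[OF vd] by (auto simp: r_def)
    have yW: "wval (take i ws) \<in> val_span (weight (take i ws)) i" by (rule val_span_wval[OF adm_take]) auto
    have wsum: "weight (drop i ws) + weight (take i ws) = w"
      by (metis add.commute append_take_drop_id w_def weight_simps(3))
    have pos: "weight (drop i ws) > 0" "weight (take i ws) > 0"
      using i valid_weight_pos[OF vd] valid_weight_pos[of "take i ws"] adm_take[of i]
      assms(2) by (auto simp: r_def adm_word_def)
    have "log_reg w r (\<lambda>N. star_nsum (rev (drop i ws)) N * nsum (take i ws) N) (c * wval (take i ws))"
      using log_reg_mult_conv[OF c decaying_wval[OF adm_take] yW] i wsum by simp
    moreover have "c * wval (take i ws) \<in> low_span w r"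
      by (rule low_span_mult[OF log_reg_val_span[OF c] yW wsum]) (use pos i in auto)
    ultimately show ?thesis by (auto simp: mult.commute)
  qed
  then obtain cm where cm: "\<And>i. i \<in> {1..<r} \<Longrightarrow> log_reg w r (\<lambda>N. nsum (take i ws) N * star_nsum (rev (drop i ws)) N) (cm i)"
    "\<And>i. i \<in> {1..<r} \<Longrightarrow> cm i \<in> low_span w r" by metis
  let ?mid = "\<lambda>N. \<Sum>i\<in>{1..<r}. nsum (take i ws) N * star_nsum (rev (drop i ws)) N" and ?rest = "\<lambda>N. \<Sum>u\<leftarrow>L. nsum u N"
  have eq: "nsum (rev ws) N = (-1) ^ (r - 1) * (nsum ws N + ?mid N)
     - ?rest N" for N
  proof -
    have "{..r} = insert 0 (insert r {1..<r})" using r by auto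
    then have "antipode_sum ws N N = star_nsum (rev ws) N + (nsum ws N + ?mid N)"
      using r unfolding antipode_sum_def r_def[symmetric] by (simp add: r_def)
    then have "nsum ws N + ?mid N = - star_nsum (rev ws) N"
      using assms(2) by (simp add: antipode_sum_eq)
    also have "\<dots> = (-1) ^ (r - 1) * (nsum (rev ws) N + ?rest N)"
      using r by (cases r) (simp_all add: star_nsum_eq L r_def)
    finally have "(-1) ^ (r - 1) * (nsum ws N + ?mid N)
      = ((-1) ^ (r - 1) * (-1) ^ (r - 1)) * (nsum (rev ws) N + ?rest N)" by simp
    also have "((-1) ^ (r - 1) * (-1) ^ (r - 1)) = (1::real)" by (simp flip: power_add)
    finally show ?thesis by simp
  qed
  have wsLR: "log_reg w r (nsum ws) (wval ws)" using log_reg_wval[OF assms(1)] by (simp add: w_def r_def)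
  define c where "c = (-1) ^ (r - 1) * (wval ws + (\<Sum>i\<in>{1..<r}. cm i)) - cL"
  have "log_reg w r (\<lambda>N. (-1) ^ (r - 1) * (nsum ws N + ?mid N)
     - ?rest N) c"
    unfolding c_def
    by (intro log_reg_diff log_reg_scale log_reg_add wsLR log_reg_sum cm log_reg_mono[OF cL]) auto
  then have "log_reg w r (nsum (rev ws)) c" unfolding eq[symmetric] .
  moreover have "c - (-1) ^ (r - 1) * wval ws = (-1) ^ (r - 1) * (\<Sum>i\<in>{1..<r}. cm i) - cL"
    by (simp add: c_def algebra_simps)
  moreover have "(-1) ^ (r - 1) * (\<Sum>i\<in>{1..<r}. cm i) - cL \<in> low_span w r"
    using cm(2) log_reg_val_span[OF cL] r by (intro low_span_diff low_span_scale low_span_sum low_span_val_span[of cL w "r - 1"]) auto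
  ultimately show ?thesis using that by (simp add: w_def r_def)
qed

section \<open>Partial fractions\<close>

text \<open>The step rests on 1 / (x_j (x_n - x_j)) = (1 / x_j + 1 / (x_n - x_j)) / x_n. The second
  part leaves the same identity for the translates x_i - x_n, hence the induction over arbitrary
  \<open>x\<close>. For x_i = m_i - p the differences x_i - x_j no longer contain p.\<close>

lemma lagrange_partial_fraction:
  fixes x :: "nat \<Rightarrow> real"
  assumes "finite I" "I \<noteq> {}" "inj_on x I" "\<forall>i\<in>I. x i \<noteq> 0"
  shows "(\<Prod>i\<in>I. 1 / x i) = (\<Sum>j\<in>I. 1 / x j * (\<Prod>i\<in>I - {j}. 1 / (x i - x j)))"
  using assms
proof (induction I arbitrary: x rule: finite_ne_induct)
  case (singleton n) then show ?case by simp
next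
  case (insert n I)
  let ?P = "\<lambda>j. \<Prod>i\<in>I - {j}. 1 / (x i - x j)"
  have nz: "x n \<noteq> 0" "\<And>j. j \<in> I \<Longrightarrow> x j \<noteq> 0" "\<And>j. j \<in> I \<Longrightarrow> x n - x j \<noteq> 0"
    using insert.prems insert.hyps by (auto simp: inj_on_def)
  have IH1: "(\<Prod>i\<in>I. 1 / x i) = (\<Sum>j\<in>I. 1 / x j * ?P j)"
    using insert.prems by (intro insert.IH) (auto simp: inj_on_def)
  have IH2: "(\<Prod>i\<in>I. 1 / (x i - x n)) = (\<Sum>j\<in>I. 1 / (x j - x n) * ?P j)"
  proof -
    have "inj_on (\<lambda>i. x i - x n) I" "\<forall>i\<in>I. x i - x n \<noteq> 0"
      using insert.prems nz by (auto simp: inj_on_def)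
    from insert.IH[OF this] show ?thesis by simp
  qed
  have "(\<Sum>j\<in>I. 1 / x j * (\<Prod>i\<in>insert n I - {j}. 1 / (x i - x j))) =
        (\<Sum>j\<in>I. 1 / x n * (1 / x j * ?P j) - 1 / x n * (1 / (x j - x n) * ?P j))"
  proof (rule sum.cong[OF refl])
    fix j assume j: "j \<in> I"
    then have "insert n I - {j} = insert n (I - {j})" using insert.hyps by auto
    then have "(\<Prod>i\<in>insert n I - {j}. 1 / (x i - x j)) = 1 / (x n - x j) * ?P j"
      using insert.hyps by simp
    moreover have "1 / x j * (1 / (x n - x j) * P) = 1 / x n * (1 / x j * P) - 1 / x n * (1 / (x j - x n) * P)" for P
      using nz(1) nz(2,3)[OF j] by (simp add: divide_simps) (auto simp: algebra_simps)
    ultimately show "1 / x j * (\<Prod>i\<in>insert n I - {j}. 1 / (x i - x j)) =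
      1 / x n * (1 / x j * ?P j) - 1 / x n * (1 / (x j - x n) * ?P j)" by simp
  qed
  also have "\<dots> = 1 / x n * (\<Prod>i\<in>I. 1 / x i) - 1 / x n * (\<Prod>i\<in>I. 1 / (x i - x n))"
    unfolding IH1 IH2 by (simp add: sum_subtractf sum_distrib_left)
  finally show ?case using insert.hyps by (simp add: insert_Diff_if)
qed

text \<open>
  Raising an exponent amounts to differentiation, which preserves this shape; so the partial
  fraction expansion follows from the case of simple poles.
\<close>

inductive star :: "nat \<Rightarrow> (nat \<Rightarrow> nat) \<Rightarrow> nat \<Rightarrow> ((nat \<Rightarrow> real) \<Rightarrow> real) \<Rightarrow> bool" for r ks w where
  star_0: "star r ks w (\<lambda>_. 0)"
| star_add: "star r ks w F \<Longrightarrow> star r ks w G \<Longrightarrow> star r ks w (\<lambda>x. F x + G x)"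
| star_term: "j < r \<Longrightarrow> 1 \<le> l \<Longrightarrow> (\<And>i. i < r \<Longrightarrow> i \<noteq> j \<Longrightarrow> ks i \<le> es i) \<Longrightarrow>
     l + (\<Sum>i\<in>{..<r} - {j}. es i) = w \<Longrightarrow> q \<in> \<rat> \<Longrightarrow>
     star r ks w (\<lambda>x. q * (1 / x j ^ l * (\<Prod>i\<in>{..<r} - {j}. 1 / (x i - x j) ^ es i)))"

lemma star_sum: "finite A \<Longrightarrow> (\<And>i. i \<in> A \<Longrightarrow> star r ks w (F i)) \<Longrightarrow> star r ks w (\<lambda>x. \<Sum>i\<in>A. F i x)"
  by (induction A rule: finite_induct) (simp_all add: star_0 star_add)

lemma star_scale: "star r ks w F \<Longrightarrow> p \<in> \<rat> \<Longrightarrow> star r ks w (\<lambda>x. p * F x)"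
proof (induction rule: star.induct)
  case star_0 then show ?case using star.star_0 by simp
next
  case (star_add F G) then show ?case using star.star_add by (simp add: distrib_left)
next
  case (star_term j l es q)
  then have "star r ks w (\<lambda>x. (p * q) * (1 / x j ^ l * (\<Prod>i\<in>{..<r} - {j}. 1 / (x i - x j) ^ es i)))"
    by (intro star.star_term) auto
  then show ?case by (simp add: mult.assoc)
qed

lemma deriv_inverse_power:
  fixes y :: real
  assumes "y \<noteq> a"
  shows "((\<lambda>y. 1 / (y - a) ^ e) has_field_derivative (- real e * (1 / (y - a) ^ Suc e))) (at y)"
proof -
  have "((\<lambda>y. inverse (y - a) ^ e) has_field_derivative (real e * (- (inverse (y - a))\<^sup>2) * inverse (y - a) ^ (e - 1))) (at y)"
    using assms by (auto intro!: derivative_eq_intros simp: power2_eq_square)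
  moreover have "real e * (- d\<^sup>2) * d ^ (e - 1) = - real e * d ^ Suc e" for d :: real
    by (cases e) (auto simp: power2_eq_square algebra_simps)
  ultimately show ?thesis by (simp only: power_one_over[symmetric] inverse_eq_divide)
qed

lemma deriv_inverse_power':
  fixes y :: real
  assumes "y \<noteq> a"
  shows "((\<lambda>y. 1 / (a - y) ^ e) has_field_derivative (real e * (1 / (a - y) ^ Suc e))) (at y)"
proof -
  have "((\<lambda>y. inverse (a - y) ^ e) has_field_derivative (real e * ((inverse (a - y))\<^sup>2) * inverse (a - y) ^ (e - 1))) (at y)"
    using assms by (auto intro!: derivative_eq_intros simp: power2_eq_square)
  moreover have "real e * (d\<^sup>2) * d ^ (e - 1) = real e * d ^ Suc e" for d :: real
    by (cases e) (auto simp: power2_eq_square algebra_simps)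
  ultimately show ?thesis by (simp only: power_one_over[symmetric] inverse_eq_divide)
qed

lemma deriv_prod_inverse_powers:
  fixes x :: "nat \<Rightarrow> real"
  assumes "finite A" "\<forall>i\<in>A. x i \<noteq> y"
  shows "((\<lambda>y. \<Prod>i\<in>A. 1 / (x i - y) ^ es i) has_field_derivative
     (\<Sum>k\<in>A. real (es k) * (\<Prod>i\<in>A. 1 / (x i - y) ^ (es(k := Suc (es k))) i))) (at y)"
  using assms
proof (induction A rule: finite_induct)
  case (insert n A)
  have d: "((\<lambda>y. 1 / (x n - y) ^ es n * (\<Prod>i\<in>A. 1 / (x i - y) ^ es i)) has_field_derivative
     (real (es n) * (1 / (x n - y) ^ Suc (es n)) * (\<Prod>i\<in>A. 1 / (x i - y) ^ es i) +
      (\<Sum>k\<in>A. real (es k) * (\<Prod>i\<in>A. 1 / (x i - y) ^ (es(k := Suc (es k))) i)) * (1 / (x n - y) ^ es n))) (at y)"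
    using insert by (intro DERIV_mult deriv_inverse_power') auto
  have c1: "(\<Prod>i\<in>A. 1 / (x i - y) ^ (es(n := Suc (es n))) i) = (\<Prod>i\<in>A. 1 / (x i - y) ^ es i)"
    using insert.hyps by (intro prod.cong) auto
  have c2: "(\<Sum>k\<in>A. real (es k) * (\<Prod>i\<in>insert n A. 1 / (x i - y) ^ (es(k := Suc (es k))) i)) =
     (\<Sum>k\<in>A. real (es k) * (\<Prod>i\<in>A. 1 / (x i - y) ^ (es(k := Suc (es k))) i)) * (1 / (x n - y) ^ es n)"
    unfolding sum_distrib_right using insert.hyps by (intro sum.cong refl) auto
  show ?case using d insert.hyps c1 c2 by simp
qed simp

definition generic :: "nat \<Rightarrow> (nat \<Rightarrow> real) \<Rightarrow> bool" where
  "generic r x \<longleftrightarrow> inj_on x {..<r} \<and> (\<forall>i<r. x i \<noteq> 0)"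

text \<open>Away from the centre, x_n occurs in a single factor. At the centre it occurs in all of
  them, and the product rule raises \<open>l\<close> or one of the \<open>es k\<close>. Either way
  no exponent drops, and the one at n rises when n is not the centre.\<close>

lemma star_deriv:
  assumes "star r ks w F" "n < r"
  shows "\<exists>F'. star r (ks(n := Suc (ks n))) (Suc w) F' \<and>
     (\<forall>x. generic r x \<longrightarrow> ((\<lambda>y. F (x(n := y))) has_field_derivative F' x) (at (x n)))"
  using assms(1)
proof (induction rule: star.induct)
  case star_0
  then show ?case by (intro exI[of _ "\<lambda>_. 0"]) (auto intro: star.star_0)
next
  case (star_add F G)
  then obtain F' G' where
    *: "star r (ks(n := Suc (ks n))) (Suc w) F'" "\<forall>x. generic r x \<longrightarrow> ((\<lambda>y. F (x(n := y))) has_field_derivative F' x) (at (x n))"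
    "star r (ks(n := Suc (ks n))) (Suc w) G'" "\<forall>x. generic r x \<longrightarrow> ((\<lambda>y. G (x(n := y))) has_field_derivative G' x) (at (x n))"
    by blast
  show ?case
  proof (intro exI[of _ "\<lambda>x. F' x + G' x"] conjI allI impI)
    show "star r (ks(n := Suc (ks n))) (Suc w) (\<lambda>x. F' x + G' x)" by (rule star.star_add[OF *(1,3)])
    show "((\<lambda>y. F (x(n := y)) + G (x(n := y))) has_field_derivative F' x + G' x) (at (x n))" if "generic r x" for x
      using DERIV_add *(2,4) that by blast
  qed
next
  case (star_term j l es q)
  let ?A = "{..<r} - {j}"
  have fin: "finite ?A" by simp
  show ?case
  proof (cases "n = j")
    case False
    have nA: "n \<in> ?A" using False assms(2) by simp
    let ?es = "es(n := Suc (es n))"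
    let ?F' = "\<lambda>x. (- real (es n) * q) * (1 / x j ^ l * (\<Prod>i\<in>?A. 1 / (x i - x j) ^ ?es i))"
    have "star r (ks(n := Suc (ks n))) (Suc w) ?F'"
    proof (rule star.star_term)
      have "(\<Sum>i\<in>?A. ?es i) = ?es n + (\<Sum>i\<in>?A - {n}. ?es i)" by (rule sum.remove[OF fin nA])
      also have "(\<Sum>i\<in>?A - {n}. ?es i) = (\<Sum>i\<in>?A - {n}. es i)" by (intro sum.cong) auto
      also have "?es n + \<dots> = Suc (\<Sum>i\<in>?A. es i)" by (simp add: sum.remove[OF fin nA])
      finally show "l + (\<Sum>i\<in>?A. ?es i) = Suc w" using star_term by simp
    qed (use star_term in auto)
    moreover have "((\<lambda>y. q * (1 / (x(n := y)) j ^ l * (\<Prod>i\<in>?A. 1 / ((x(n := y)) i - (x(n := y)) j) ^ es i)))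
       has_field_derivative ?F' x) (at (x n))" if "generic r x" for x
    proof -
      have ne: "x n \<noteq> x j" using that False assms(2) star_term(1) by (auto simp: generic_def inj_on_def)
      let ?R = "\<Prod>i\<in>?A - {n}. 1 / (x i - x j) ^ es i"
      have 1: "(\<lambda>y. q * (1 / (x(n := y)) j ^ l * (\<Prod>i\<in>?A. 1 / ((x(n := y)) i - (x(n := y)) j) ^ es i)))
        = (\<lambda>y. (q / x j ^ l * ?R) * (1 / (y - x j) ^ es n))"
      proof
        fix y
        have "(\<Prod>i\<in>?A. 1 / ((x(n := y)) i - (x(n := y)) j) ^ es i) = 1 / (y - x j) ^ es n *
           (\<Prod>i\<in>?A - {n}. 1 / ((x(n := y)) i - (x(n := y)) j) ^ es i)"
          using False by (subst prod.remove[OF fin nA]) auto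
        also have "(\<Prod>i\<in>?A - {n}. 1 / ((x(n := y)) i - (x(n := y)) j) ^ es i) = ?R"
          using False by (intro prod.cong) auto
        finally show "q * (1 / (x(n := y)) j ^ l * (\<Prod>i\<in>?A. 1 / ((x(n := y)) i - (x(n := y)) j) ^ es i))
          = (q / x j ^ l * ?R) * (1 / (y - x j) ^ es n)" using False by simp
      qed
      have "(\<Prod>i\<in>?A. 1 / (x i - x j) ^ ?es i) = 1 / (x n - x j) ^ Suc (es n) * (\<Prod>i\<in>?A - {n}. 1 / (x i - x j) ^ ?es i)"
        by (subst prod.remove[OF fin nA]) auto
      also have "(\<Prod>i\<in>?A - {n}. 1 / (x i - x j) ^ ?es i) = ?R" by (intro prod.cong) auto
      finally have 2: "?F' x = (q / x j ^ l * ?R) * (- real (es n) * (1 / (x n - x j) ^ Suc (es n)))" by simp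
      show ?thesis unfolding 1 2 by (intro DERIV_cmult deriv_inverse_power ne)
    qed
    ultimately show ?thesis by blast
  next
    case True
    let ?F1 = "\<lambda>x. (- real l * q) * (1 / x j ^ Suc l * (\<Prod>i\<in>?A. 1 / (x i - x j) ^ es i))"
    let ?F2 = "\<lambda>k x. (real (es k) * q) * (1 / x j ^ l * (\<Prod>i\<in>?A. 1 / (x i - x j) ^ (es(k := Suc (es k))) i))"
    have s1: "star r (ks(n := Suc (ks n))) (Suc w) ?F1"
      by (rule star.star_term) (use star_term True in auto)
    have s2: "star r (ks(n := Suc (ks n))) (Suc w) (?F2 k)" if k: "k \<in> ?A" for k
    proof (rule star.star_term)
      let ?es = "es(k := Suc (es k))"
      have "(\<Sum>i\<in>?A. ?es i) = ?es k + (\<Sum>i\<in>?A - {k}. ?es i)" by (rule sum.remove[OF fin k])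
      also have "(\<Sum>i\<in>?A - {k}. ?es i) = (\<Sum>i\<in>?A - {k}. es i)" by (intro sum.cong) auto
      also have "?es k + \<dots> = Suc (\<Sum>i\<in>?A. es i)" by (simp add: sum.remove[OF fin k])
      finally show "l + (\<Sum>i\<in>?A. ?es i) = Suc w" using star_term by simp
      show "(ks(n := Suc (ks n))) i \<le> ?es i" if "i < r" "i \<noteq> j" for i
        using star_term(3)[OF that] that True by auto
    qed (use star_term True in auto)
    let ?F' = "\<lambda>x. ?F1 x + (\<Sum>k\<in>?A. ?F2 k x)"
    have "star r (ks(n := Suc (ks n))) (Suc w) ?F'"
      using star.star_add[OF s1 star_sum[OF fin s2]] by simp
    moreover have "((\<lambda>y. q * (1 / (x(n := y)) j ^ l * (\<Prod>i\<in>?A. 1 / ((x(n := y)) i - (x(n := y)) j) ^ es i)))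
       has_field_derivative ?F' x) (at (x n))" if g: "generic r x" for x
    proof -
      have ne: "\<forall>i\<in>?A. x i \<noteq> x j" "x j \<noteq> 0" using g star_term(1) by (auto simp: generic_def inj_on_def)
      have 1: "(\<lambda>y. q * (1 / (x(n := y)) j ^ l * (\<Prod>i\<in>?A. 1 / ((x(n := y)) i - (x(n := y)) j) ^ es i)))
        = (\<lambda>y. q * (1 / (y - 0) ^ l * (\<Prod>i\<in>?A. 1 / (x i - y) ^ es i)))"
        using True by (intro ext) (auto intro!: prod.cong)
      let ?D = "\<lambda>y. q * ((- real l * (1 / (y - 0) ^ Suc l)) * (\<Prod>i\<in>?A. 1 / (x i - y) ^ es i) +
        (\<Sum>k\<in>?A. real (es k) * (\<Prod>i\<in>?A. 1 / (x i - y) ^ (es(k := Suc (es k))) i)) * (1 / (y - 0) ^ l))"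
      have d: "((\<lambda>y. q * (1 / (y - 0) ^ l * (\<Prod>i\<in>?A. 1 / (x i - y) ^ es i))) has_field_derivative ?D (x j)) (at (x j))"
        by (intro DERIV_cmult DERIV_mult deriv_inverse_power deriv_prod_inverse_powers ne fin)
      have "?D (x j) = ?F' x"
        by (simp add: sum_distrib_left sum_distrib_right algebra_simps)
      then show ?thesis using d unfolding 1 True by simp
    qed
    ultimately show ?thesis by blast
  qed
qed

text \<open>Induction on the total exponent: the derivative in x_n of the product with exponents
  \<open>ks'\<close> is -\<open>ks' n\<close> times the product with exponents
  \<open>ks\<close>.\<close>

lemma partial_fraction:
  assumes "r \<ge> 1" "\<And>i. i < r \<Longrightarrow> ks i \<ge> 1"
  shows "\<exists>F. star r ks (\<Sum>i<r. ks i) F \<and> (\<forall>x. generic r x \<longrightarrow> (\<Prod>i<r. 1 / x i ^ ks i) = F x)"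
  using assms(2)
proof (induction "\<Sum>i<r. ks i" arbitrary: ks rule: less_induct)
  case less
  show ?case
  proof (cases "\<forall>i<r. ks i = 1")
    case True
    let ?F = "\<lambda>x. \<Sum>j<r. 1 * (1 / x j ^ 1 * (\<Prod>i\<in>{..<r} - {j}. 1 / (x i - x j) ^ ks i))"
    have "star r ks (\<Sum>i<r. ks i) ?F"
      by (intro star_sum star_term) (use True in \<open>auto simp: sum.remove\<close>)
    moreover have "(\<Prod>i<r. 1 / x i ^ ks i) = ?F x" if "generic r x" for x :: "nat \<Rightarrow> real"
    proof -
      have "(\<Prod>i<r. 1 / x i ^ ks i) = (\<Prod>i<r. 1 / x i)" using True by (intro prod.cong) auto
      also have "\<dots> = (\<Sum>j<r. 1 / x j * (\<Prod>i\<in>{..<r} - {j}. 1 / (x i - x j)))"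
      proof (rule lagrange_partial_fraction)
        show "{..<r} \<noteq> {}" using assms(1) by (auto simp: lessThan_empty_iff)
      qed (use that in \<open>auto simp: generic_def\<close>)
      also have "\<dots> = ?F x" using True by (intro sum.cong) auto
      finally show ?thesis .
    qed
    ultimately show ?thesis by blast
  next
    case False
    then obtain n where n: "n < r" "ks n \<noteq> 1" by blast
    define ks' where "ks' = ks(n := ks n - 1)"
    have kn: "ks n \<ge> 2" using n less.prems[of n] by simp
    have ks: "ks = ks'(n := Suc (ks' n))" using kn by (auto simp: ks'_def)
    have kn': "ks' n \<ge> 1" using kn by (simp add: ks'_def)
    have sum: "(\<Sum>i<r. ks i) = Suc (\<Sum>i<r. ks' i)"
    proof -
      have "(\<Sum>i<r. ks i) = ks n + (\<Sum>i\<in>{..<r} - {n}. ks i)" using n by (subst sum.remove[of _ n]) auto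
      also have "(\<Sum>i\<in>{..<r} - {n}. ks i) = (\<Sum>i\<in>{..<r} - {n}. ks' i)" by (intro sum.cong) (auto simp: ks'_def)
      also have "ks n + \<dots> = Suc (ks' n + \<dots>)" using kn by (simp add: ks'_def)
      also have "ks' n + (\<Sum>i\<in>{..<r} - {n}. ks' i) = (\<Sum>i<r. ks' i)" using n by (subst sum.remove[of _ n]) auto
      finally show ?thesis .
    qed
    have "\<And>i. i < r \<Longrightarrow> ks' i \<ge> 1" using less.prems kn by (auto simp: ks'_def)
    then obtain F where F: "star r ks' (\<Sum>i<r. ks' i) F"
      "\<And>x. generic r x \<Longrightarrow> (\<Prod>i<r. 1 / x i ^ ks' i) = F x"
      using less.hyps[of ks'] sum by auto
    obtain F' where F': "star r ks (\<Sum>i<r. ks i) F'"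
      "\<And>x. generic r x \<Longrightarrow> ((\<lambda>y. F (x(n := y))) has_field_derivative F' x) (at (x n))"
      using star_deriv[OF F(1) n(1)] unfolding ks[symmetric] sum[symmetric] by blast
    have "(\<Prod>i<r. 1 / x i ^ ks i) = (- 1 / real (ks' n)) * F' x" if g: "generic r x" for x
    proof -
      let ?R = "\<Prod>i\<in>{..<r} - {n}. 1 / x i ^ ks' i"
      \<comment> \<open>Values of x_n that keep the point generic. The identity has to hold on a
        neighbourhood before it can be differentiated.\<close>
      define U where "U = - (insert 0 (x ` ({..<r} - {n})))"
      have U: "open U" unfolding U_def by (intro open_Compl finite_imp_closed) auto
      have xU: "x n \<in> U" using g n unfolding U_def generic_def inj_on_def by auto
      have gen: "generic r (x(n := y))" if "y \<in> U" for y
        using g that unfolding generic_def U_def inj_on_def by auto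
      have eq: "F (x(n := y)) = ?R * (1 / (y - 0) ^ ks' n)" if "y \<in> U" for y
      proof -
        have "F (x(n := y)) = (\<Prod>i<r. 1 / (x(n := y)) i ^ ks' i)" using F(2)[OF gen[OF that]] by (rule sym)
        also have "\<dots> = 1 / y ^ ks' n * (\<Prod>i\<in>{..<r} - {n}. 1 / (x(n := y)) i ^ ks' i)"
          using n by (subst prod.remove[of _ n]) auto
        also have "(\<Prod>i\<in>{..<r} - {n}. 1 / (x(n := y)) i ^ ks' i) = ?R" by (intro prod.cong) auto
        finally show ?thesis by (simp only: diff_0_right mult.commute)
      qed
      have "((\<lambda>y. ?R * (1 / (y - 0) ^ ks' n)) has_field_derivative ?R * (- real (ks' n) * (1 / (x n - 0) ^ Suc (ks' n)))) (at (x n))"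
        using xU by (intro DERIV_cmult deriv_inverse_power) (auto simp: U_def)
      then have "((\<lambda>y. F (x(n := y))) has_field_derivative ?R * (- real (ks' n) * (1 / (x n - 0) ^ Suc (ks' n)))) (at (x n))"
        by (rule has_field_derivative_transform_within_open[OF _ U xU]) (simp add: eq)
      then have F'x: "F' x = ?R * (- real (ks' n) * (1 / x n ^ Suc (ks' n)))"
        using DERIV_unique F'(2)[OF g] by fastforce
      have "(\<Prod>i<r. 1 / x i ^ ks i) = 1 / x n ^ ks n * (\<Prod>i\<in>{..<r} - {n}. 1 / x i ^ ks i)"
        using n by (subst prod.remove[of _ n]) auto
      also have "(\<Prod>i\<in>{..<r} - {n}. 1 / x i ^ ks i) = ?R" by (intro prod.cong) (auto simp: ks'_def)
      also have "ks n = Suc (ks' n)" using kn by (simp add: ks'_def)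
      finally show ?thesis using kn' unfolding F'x by simp
    qed
    moreover have "star r ks (\<Sum>i<r. ks i) (\<lambda>x. (- 1 / real (ks' n)) * F' x)"
      by (rule star_scale[OF F'(1)]) auto
    ultimately show ?thesis by blast
  qed
qed

section \<open>Abel means\<close>

definition log_pole :: "real \<Rightarrow> real" where "log_pole x = - ln (1 - x)"

text \<open>Power saving as x tends to 1. Starting at 1/2 keeps 1 / x bounded, which
  \<open>abel_decaying\<close> uses.\<close>

definition abel_small :: "(real \<Rightarrow> real) \<Rightarrow> bool" where
  "abel_small f \<longleftrightarrow> (\<exists>\<delta>>0. \<exists>C. \<forall>x. 1/2 \<le> x \<and> x < 1 \<longrightarrow> \<bar>f x\<bar> \<le> C * (1 - x) powr \<delta>)"

definition abel_mod :: "(real \<Rightarrow> real) \<Rightarrow> bool" where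
  "abel_mod f \<longleftrightarrow> (\<forall>\<delta>>0. \<exists>C. \<forall>x. 1/2 \<le> x \<and> x < 1 \<longrightarrow> \<bar>f x\<bar> \<le> C * (1 - x) powr (- \<delta>))"

lemma abel_small_mult: assumes "abel_small f" "abel_mod g" shows "abel_small (\<lambda>x. f x * g x)"
proof -
  obtain \<delta> C where f: "\<delta> > 0" "\<And>x. 1/2 \<le> x \<Longrightarrow> x < 1 \<Longrightarrow> \<bar>f x\<bar> \<le> C * (1 - x) powr \<delta>"
    using assms(1) unfolding abel_small_def by blast
  obtain D where g: "\<And>x. 1/2 \<le> x \<Longrightarrow> x < 1 \<Longrightarrow> \<bar>g x\<bar> \<le> D * (1 - x) powr (- (\<delta>/2))"
    using assms(2) f(1) unfolding abel_mod_def by (meson half_gt_zero)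
  have "\<bar>f x * g x\<bar> \<le> (C * D) * (1 - x) powr (\<delta> / 2)" if x: "1/2 \<le> x" "x < 1" for x
  proof -
    have "\<bar>f x * g x\<bar> \<le> (C * (1 - x) powr \<delta>) * (D * (1 - x) powr (- (\<delta>/2)))"
      unfolding abs_mult by (rule mult_mono[OF f(2)[OF x] g[OF x]]) (use f(2)[OF x] in auto)
    also have "\<dots> = (C * D) * ((1 - x) powr \<delta> * (1 - x) powr (- (\<delta>/2)))" by simp
    also have "(1 - x) powr \<delta> * (1 - x) powr (- (\<delta>/2)) = (1 - x) powr (\<delta> / 2)"
      by (subst powr_add[symmetric]) simp
    finally show ?thesis .
  qed
  then show ?thesis unfolding abel_small_def using f(1) by (intro exI[of _ "\<delta>/2"] conjI exI[of _ "C * D"]) auto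
qed

lemma abel_small_add: assumes "abel_small f" "abel_small g" shows "abel_small (\<lambda>x. f x + g x)"
proof -
  obtain \<delta> C where f: "\<delta> > 0" "\<And>x. 1/2 \<le> x \<Longrightarrow> x < 1 \<Longrightarrow> \<bar>f x\<bar> \<le> C * (1 - x) powr \<delta>"
    using assms(1) unfolding abel_small_def by blast
  obtain \<gamma> D where g: "\<gamma> > 0" "\<And>x. 1/2 \<le> x \<Longrightarrow> x < 1 \<Longrightarrow> \<bar>g x\<bar> \<le> D * (1 - x) powr \<gamma>"
    using assms(2) unfolding abel_small_def by blast
  have "\<bar>f x + g x\<bar> \<le> (\<bar>C\<bar> + \<bar>D\<bar>) * (1 - x) powr (min \<delta> \<gamma>)" if x: "1/2 \<le> x" "x < 1" for x
  proof -
    have p: "(1 - x) powr \<delta> \<le> (1 - x) powr (min \<delta> \<gamma>)" "(1 - x) powr \<gamma> \<le> (1 - x) powr (min \<delta> \<gamma>)"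
      using x by (auto intro!: powr_mono')
    have "C * (1 - x) powr \<delta> \<le> \<bar>C\<bar> * (1 - x) powr (min \<delta> \<gamma>)"
         "D * (1 - x) powr \<gamma> \<le> \<bar>D\<bar> * (1 - x) powr (min \<delta> \<gamma>)"
      using p by (auto intro!: mult_mono)
    then show ?thesis using f(2)[OF x] g(2)[OF x] abs_triangle_ineq[of "f x" "g x"]
      unfolding distrib_right by linarith
  qed
  then show ?thesis unfolding abel_small_def using f(1) g(1)
    by (intro exI[of _ "min \<delta> \<gamma>"] conjI exI[of _ "\<bar>C\<bar> + \<bar>D\<bar>"]) auto
qed

lemma abel_small_le: "abel_small g \<Longrightarrow> (\<And>x. 1/2 \<le> x \<Longrightarrow> x < 1 \<Longrightarrow> \<bar>f x\<bar> \<le> \<bar>g x\<bar>) \<Longrightarrow> abel_small f"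
  unfolding abel_small_def by (meson order.trans)

lemma abel_small_0 [simp]: "abel_small (\<lambda>_. 0)"
  unfolding abel_small_def by (intro exI[of _ 1] conjI exI[of _ 0]) auto

lemma abel_small_powr: "\<delta> > 0 \<Longrightarrow> abel_small (\<lambda>x. (1 - x) powr \<delta>)"
  unfolding abel_small_def by (intro exI[of _ \<delta>] conjI exI[of _ 1]) auto

lemma abel_small_abel_mod: assumes "abel_small f" shows "abel_mod f"
  unfolding abel_mod_def
proof (intro allI impI)
  fix \<gamma> :: real assume g: "\<gamma> > 0"
  obtain \<delta> C where f: "\<delta> > 0" "\<And>x. 1/2 \<le> x \<Longrightarrow> x < 1 \<Longrightarrow> \<bar>f x\<bar> \<le> C * (1 - x) powr \<delta>"
    using assms(1) unfolding abel_small_def by blast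
  have "\<bar>f x\<bar> \<le> \<bar>C\<bar> * (1 - x) powr (- \<gamma>)" if x: "1/2 \<le> x" "x < 1" for x
  proof -
    have "(1 - x) powr \<delta> \<le> (1 - x) powr (- \<gamma>)" using x g f(1) by (intro powr_mono') auto
    then have "C * (1 - x) powr \<delta> \<le> \<bar>C\<bar> * (1 - x) powr (- \<gamma>)" by (intro mult_mono) auto
    then show ?thesis using f(2)[OF x] by simp
  qed
  then show "\<exists>C. \<forall>x. 1 / 2 \<le> x \<and> x < 1 \<longrightarrow> \<bar>f x\<bar> \<le> C * (1 - x) powr - \<gamma>" by blast
qed

lemma abel_mod_const [simp]: "abel_mod (\<lambda>_. c)"
  unfolding abel_mod_def
proof (intro allI impI exI[of _ "\<bar>c\<bar>"])
  fix \<delta> x :: real assume "\<delta> > 0" "1 / 2 \<le> x \<and> x < 1"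
  then have "1 \<le> (1 - x) powr (- \<delta>)" using powr_mono'[of "-\<delta>" 0 "1 - x"] by simp
  then have "\<bar>c\<bar> * 1 \<le> \<bar>c\<bar> * (1 - x) powr (- \<delta>)" by (intro mult_left_mono) auto
  then show "\<bar>c\<bar> \<le> \<bar>c\<bar> * (1 - x) powr - \<delta>" by simp
qed

lemma abel_mod_add: assumes "abel_mod f" "abel_mod g" shows "abel_mod (\<lambda>x. f x + g x)"
  unfolding abel_mod_def
proof (intro allI impI)
  fix \<delta> :: real assume "\<delta> > 0"
  then obtain C D where "\<And>x. 1/2 \<le> x \<Longrightarrow> x < 1 \<Longrightarrow> \<bar>f x\<bar> \<le> C * (1 - x) powr (- \<delta>)"
    "\<And>x. 1/2 \<le> x \<Longrightarrow> x < 1 \<Longrightarrow> \<bar>g x\<bar> \<le> D * (1 - x) powr (- \<delta>)"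
    using assms unfolding abel_mod_def by meson
  then have "\<bar>f x + g x\<bar> \<le> (C + D) * (1 - x) powr (- \<delta>)" if "1/2 \<le> x" "x < 1" for x
    using that abs_triangle_ineq[of "f x" "g x"] by (fastforce simp: distrib_right)
  then show "\<exists>C. \<forall>x. 1 / 2 \<le> x \<and> x < 1 \<longrightarrow> \<bar>f x + g x\<bar> \<le> C * (1 - x) powr - \<delta>" by blast
qed

lemma abel_mod_mult: assumes "abel_mod f" "abel_mod g" shows "abel_mod (\<lambda>x. f x * g x)"
  unfolding abel_mod_def
proof (intro allI impI)
  fix \<delta> :: real assume "\<delta> > 0"
  then have "\<delta> / 2 > 0" by simp
  then obtain C D where *: "\<And>x. 1/2 \<le> x \<Longrightarrow> x < 1 \<Longrightarrow> \<bar>f x\<bar> \<le> C * (1 - x) powr (- (\<delta> / 2))"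
    "\<And>x. 1/2 \<le> x \<Longrightarrow> x < 1 \<Longrightarrow> \<bar>g x\<bar> \<le> D * (1 - x) powr (- (\<delta> / 2))"
    using assms unfolding abel_mod_def by meson
  have "\<bar>f x * g x\<bar> \<le> (C * D) * (1 - x) powr (- \<delta>)" if x: "1/2 \<le> x" "x < 1" for x
  proof -
    have "\<bar>f x * g x\<bar> \<le> (C * (1 - x) powr (- (\<delta> / 2))) * (D * (1 - x) powr (- (\<delta>/2)))"
      unfolding abs_mult by (rule mult_mono[OF *(1)[OF x] *(2)[OF x]]) (use *(1)[OF x] in auto)
    also have "\<dots> = (C * D) * ((1 - x) powr (- (\<delta> / 2)) * (1 - x) powr (- (\<delta>/2)))" by simp
    also have "(1 - x) powr (- (\<delta> / 2)) * (1 - x) powr (- (\<delta>/2)) = (1 - x) powr (- \<delta>)"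
      by (subst powr_add[symmetric]) simp
    finally show ?thesis .
  qed
  then show "\<exists>C. \<forall>x. 1 / 2 \<le> x \<and> x < 1 \<longrightarrow> \<bar>f x * g x\<bar> \<le> C * (1 - x) powr - \<delta>" by blast
qed

lemma abel_mod_log_pole: "abel_mod log_pole"
  unfolding abel_mod_def
proof (intro allI impI)
  fix \<delta> :: real assume d: "\<delta> > 0"
  have "\<bar>log_pole x\<bar> \<le> (1 / \<delta>) * (1 - x) powr (- \<delta>)" if x: "1/2 \<le> x" "x < 1" for x
  proof -
    have "ln (inverse (1 - x)) \<le> inverse (1 - x) powr \<delta> / \<delta>"
      by (rule ln_powr_bound) (use x d in \<open>auto simp: field_simps\<close>)
    moreover have "log_pole x = ln (inverse (1 - x))" using x by (simp add: log_pole_def ln_inverse)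
    moreover have "log_pole x \<ge> 0" using x by (simp add: log_pole_def)
    ultimately show ?thesis using x by (simp add: powr_minus inverse_powr)
  qed
  then show "\<exists>C. \<forall>x. 1 / 2 \<le> x \<and> x < 1 \<longrightarrow> \<bar>log_pole x\<bar> \<le> C * (1 - x) powr - \<delta>" by blast
qed

lemma abel_mod_poly: "abel_mod (\<lambda>x. poly P (log_pole x))"
  by (induction P) (auto intro!: abel_mod_add abel_mod_mult abel_mod_log_pole)

definition abel_reg :: "(real \<Rightarrow> real) \<Rightarrow> real \<Rightarrow> bool" where
  "abel_reg f c \<longleftrightarrow> (\<exists>P. poly P 0 = c \<and> abel_small (\<lambda>x. f x - poly P (log_pole x)))"

lemma abel_reg_poly: "abel_reg (\<lambda>x. poly P (log_pole x)) (poly P 0)"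
  unfolding abel_reg_def by (intro exI[of _ P]) simp

lemma abel_reg_abel_small: "abel_small f \<Longrightarrow> abel_reg f 0"
  unfolding abel_reg_def by (intro exI[of _ 0]) simp

lemma abel_reg_add: assumes "abel_reg f c" "abel_reg g d" shows "abel_reg (\<lambda>x. f x + g x) (c + d)"
proof -
  obtain P Q where *: "poly P 0 = c" "abel_small (\<lambda>x. f x - poly P (log_pole x))"
    "poly Q 0 = d" "abel_small (\<lambda>x. g x - poly Q (log_pole x))" using assms unfolding abel_reg_def by blast
  from abel_small_add[OF *(2,4)] have "abel_small (\<lambda>x. (f x + g x) - poly (P + Q) (log_pole x))"
    by (simp add: algebra_simps)
  with * show ?thesis unfolding abel_reg_def by (intro exI[of _ "P + Q"]) auto
qed

lemma abel_reg_mult: assumes "abel_reg f c" "abel_reg g d" shows "abel_reg (\<lambda>x. f x * g x) (c * d)"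
proof -
  obtain P Q where *: "poly P 0 = c" "abel_small (\<lambda>x. f x - poly P (log_pole x))"
    "poly Q 0 = d" "abel_small (\<lambda>x. g x - poly Q (log_pole x))" using assms unfolding abel_reg_def by blast
  have "abel_small (\<lambda>x. (f x - poly P (log_pole x)) * ((g x - poly Q (log_pole x)) + poly Q (log_pole x)) + (g x - poly Q (log_pole x)) * poly P (log_pole x))"
    by (intro abel_small_add abel_small_mult abel_mod_add abel_mod_poly *(2,4) abel_small_abel_mod)
  then have "abel_small (\<lambda>x. f x * g x - poly (P * Q) (log_pole x))" by (simp add: algebra_simps)
  with * show ?thesis unfolding abel_reg_def by (intro exI[of _ "P * Q"]) auto
qed

lemma abel_reg_cong:
  assumes "abel_reg f c" "\<And>x. 1/2 \<le> x \<Longrightarrow> x < 1 \<Longrightarrow> f x = g x" shows "abel_reg g c"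
proof -
  obtain P where *: "poly P 0 = c" "abel_small (\<lambda>x. f x - poly P (log_pole x))"
    using assms(1) unfolding abel_reg_def by blast
  have "abel_small (\<lambda>x. g x - poly P (log_pole x))" by (rule abel_small_le[OF *(2)]) (use assms(2) in auto)
  with * show ?thesis unfolding abel_reg_def by blast
qed

text \<open>Under x = 1 - exp(-t) the logarithm becomes t and the error becomes exp(-\<delta> t); a
  polynomial in t that decays exponentially is 0. The restriction t \<ge> 1 keeps x \<ge>
  1/2.\<close>

lemma abel_reg_unique: assumes "abel_reg f c" "abel_reg f d" shows "c = d"
proof -
  obtain P Q where *: "poly P 0 = c" "abel_small (\<lambda>x. f x - poly P (log_pole x))"
    "poly Q 0 = d" "abel_small (\<lambda>x. f x - poly Q (log_pole x))" using assms unfolding abel_reg_def by blast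
  define R where "R = Q - P"
  have "abel_small (\<lambda>x. (f x - poly P (log_pole x)) + (-1) * (f x - poly Q (log_pole x)))"
    using abel_small_add[OF *(2) abel_small_mult[OF *(4) abel_mod_const[of "-1"]]] by simp
  then have "abel_small (\<lambda>x. poly R (log_pole x))" by (simp add: R_def)
  then obtain \<delta> C where R: "\<delta> > 0" "\<And>x. 1/2 \<le> x \<Longrightarrow> x < 1 \<Longrightarrow> \<bar>poly R (log_pole x)\<bar> \<le> C * (1 - x) powr \<delta>"
    unfolding abel_small_def by blast
  have bound: "\<bar>poly R t\<bar> \<le> C * exp (- \<delta> * t)" if "t \<ge> 1" for t
  proof -
    have "exp (- t) \<le> 1 / 2" 
    proof -
      have "2 \<le> exp t" using exp_ge_add_one_self[of t] that by linarith
      then show ?thesis by (simp add: exp_minus field_simps)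
    qed
    then have "\<bar>poly R (log_pole (1 - exp (- t)))\<bar> \<le> C * (1 - (1 - exp (- t))) powr \<delta>" by (intro R(2)) auto
    then show ?thesis by (simp add: log_pole_def powr_def)
  qed
  have "((\<lambda>t. poly R t / t ^ degree R) \<longlongrightarrow> lead_coeff R) at_top"
    using poly_divide_tendsto_aux[of R] by (rule filterlim_mono) (auto intro: at_top_le_at_infinity)
  moreover have "((\<lambda>t. poly R t / t ^ degree R) \<longlongrightarrow> 0) at_top"
  proof (rule Lim_null_comparison)
    show "eventually (\<lambda>t. norm (poly R t / t ^ degree R) \<le> C * exp (- \<delta> * t)) at_top"
      using eventually_ge_at_top[of 1]
    proof eventually_elim
      case (elim t)
      then have "\<bar>t ^ degree R\<bar> \<ge> 1" by simp
      then have "norm (poly R t / t ^ degree R) \<le> \<bar>poly R t\<bar> / 1"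
        unfolding real_norm_def abs_divide using elim by (intro divide_left_mono) auto
      then show ?case using bound[OF elim] by simp
    qed
    have "LIM t at_top. - \<delta> * t :> at_bot"
      using R(1) by (intro filterlim_tendsto_neg_mult_at_bot[OF tendsto_const]) (auto simp: filterlim_ident)
    then have "((\<lambda>t. exp (- \<delta> * t)) \<longlongrightarrow> 0) at_top" by (rule filterlim_compose[OF exp_at_bot])
    then show "((\<lambda>t. C * exp (- \<delta> * t)) \<longlongrightarrow> 0) at_top" by (rule tendsto_mult_right_zero)
  qed
  ultimately have "lead_coeff R = 0" using tendsto_unique[OF trivial_limit_at_top_linorder] by blast
  then have "R = 0" by simp
  then show ?thesis using *(1,3) by (simp add: R_def)
qed

section \<open>Abel means of sequences\<close>

definition abel :: "(nat \<Rightarrow> real) \<Rightarrow> real \<Rightarrow> real" where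
  "abel a x = (1 - x) * (\<Sum>N. a N * x ^ N)"

definition abs_gen :: "(nat \<Rightarrow> real) \<Rightarrow> bool" where
  "abs_gen a \<longleftrightarrow> (\<forall>x. 0 \<le> x \<and> x < 1 \<longrightarrow> summable (\<lambda>N. \<bar>a N * x ^ N\<bar>))"

lemma log_bdd_abs_gen: assumes "log_bdd a" shows "abs_gen a"
  unfolding abs_gen_def
proof (intro allI impI)
  fix x :: real assume x: "0 \<le> x \<and> x < 1"
  obtain C where C: "C > 0" "\<And>N. \<bar>a N\<bar> \<le> C * (real N + 1) powr 1"
    using log_bdd_le_powr[OF assms, of 1] by auto
  have "summable (\<lambda>N. C * (of_nat (Suc N) * x ^ N))"
    using x by (intro summable_mult sums_summable[OF geometric_deriv_sums]) auto
  then show "summable (\<lambda>N. \<bar>a N * x ^ N\<bar>)"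
  proof (rule summable_comparison_test'[where N = 0])
    fix N
    have "\<bar>a N\<bar> * x ^ N \<le> (C * (real N + 1)) * x ^ N" using C(2)[of N] x by (intro mult_right_mono) auto
    then show "norm \<bar>a N * x ^ N\<bar> \<le> C * (of_nat (Suc N) * x ^ N)"
      using x by (simp add: abs_mult mult_ac add.commute)
  qed
qed

lemma abs_gen_summable: "abs_gen a \<Longrightarrow> 0 \<le> x \<Longrightarrow> x < 1 \<Longrightarrow> summable (\<lambda>N. a N * x ^ N)"
  unfolding abs_gen_def by (blast intro: summable_rabs_cancel)

lemma abs_gen_add: assumes "abs_gen a" "abs_gen b" shows "abs_gen (\<lambda>N. a N + b N)"
  unfolding abs_gen_def
proof (intro allI impI)
  fix x :: real assume x: "0 \<le> x \<and> x < 1"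
  then have "summable (\<lambda>N. \<bar>a N * x ^ N\<bar> + \<bar>b N * x ^ N\<bar>)"
    using assms unfolding abs_gen_def by (intro summable_add) auto
  then show "summable (\<lambda>N. \<bar>(a N + b N) * x ^ N\<bar>)"
    by (rule summable_comparison_test'[where N = 0]) (simp add: distrib_right)
qed

lemma abs_gen_scale: "abs_gen a \<Longrightarrow> abs_gen (\<lambda>N. q * a N)"
  unfolding abs_gen_def by (auto simp: abs_mult mult.assoc intro!: summable_mult)

lemma abel_add: "abs_gen a \<Longrightarrow> abs_gen b \<Longrightarrow> 0 \<le> x \<Longrightarrow> x < 1 \<Longrightarrow> abel (\<lambda>N. a N + b N) x = abel a x + abel b x"
  using suminf_add[OF abs_gen_summable[of a x] abs_gen_summable[of b x]]
  by (simp add: abel_def distrib_right flip: distrib_left)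

lemma abel_scale: "abs_gen a \<Longrightarrow> 0 \<le> x \<Longrightarrow> x < 1 \<Longrightarrow> abel (\<lambda>N. q * a N) x = q * abel a x"
  using suminf_mult[OF abs_gen_summable[of a x], of q] by (simp add: abel_def mult_ac)

lemma abel_const: "0 \<le> x \<Longrightarrow> x < 1 \<Longrightarrow> abel (\<lambda>_. c) x = c"
  using suminf_mult[of "\<lambda>n. x ^ n" c] by (simp add: abel_def suminf_geometric summable_geometric)

lemma esum_Suc: "esum (Suc p) (Suc N) = esum (Suc p) N + esum p N / (real N + 1)" "esum (Suc p) 0 = 0"
  by (simp_all add: esum_def nsum_Cons_Suc letter_fun_def s_letter_def add.commute)

text \<open>Summation by parts: the factor 1 - x replaces the coefficients by their
  increments.\<close>

lemma abel_esum_Suc_sums: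
  assumes "0 \<le> x" "x < 1"
  shows "(\<lambda>N. esum p N / (real N + 1) * x ^ Suc N) sums abel (esum (Suc p)) x"
proof -
  have s: "summable (\<lambda>N. esum (Suc p) N * x ^ N)"
    by (rule abs_gen_summable[OF log_bdd_abs_gen[OF log_bdd_esum] assms])
  have "(\<lambda>N. esum (Suc p) (Suc N) * x ^ Suc N) sums ((\<Sum>N. esum (Suc p) N * x ^ N) - esum (Suc p) 0 * x ^ 0)"
    using summable_sums[OF s] by (subst sums_Suc_iff) simp
  moreover have "(\<lambda>N. x * (esum (Suc p) N * x ^ N)) sums (x * (\<Sum>N. esum (Suc p) N * x ^ N))"
    by (rule sums_mult[OF summable_sums[OF s]])
  ultimately have "(\<lambda>N. esum (Suc p) (Suc N) * x ^ Suc N - x * (esum (Suc p) N * x ^ N)) sums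
    ((\<Sum>N. esum (Suc p) N * x ^ N) - esum (Suc p) 0 * x ^ 0 - x * (\<Sum>N. esum (Suc p) N * x ^ N))"
    by (rule sums_diff)
  then show ?thesis by (simp add: esum_Suc abel_def algebra_simps)
qed

text \<open>Induction by differentiation. For \<open>Suc p\<close> the left side has derivative
  equal to the generating function of \<open>esum p\<close>, which is L^p / (p! (1 - x)) by
  hypothesis, and this is also the derivative of L^(p+1) / (p+1)!; both sides vanish at 0.\<close>

lemma abel_esum: "0 \<le> x \<Longrightarrow> x < 1 \<Longrightarrow> abel (esum p) x = log_pole x ^ p / fact p"
proof (induction p arbitrary: x)
  case 0 then show ?case using abel_const[of x 1] by (simp add: esum_def)
next
  case (Suc p)
  define c where "c n = (if n = 0 then 0 else esum p (n - 1) / real n)" for n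
  define h where "h x = (\<Sum>n. c n * x ^ n)" for x
  have c_sums: "(\<lambda>n. c n * y ^ n) sums abel (esum (Suc p)) y" if "0 \<le> y" "y < 1" for y
  proof -
    have "(\<lambda>n. c (Suc n) * y ^ Suc n) sums abel (esum (Suc p)) y"
      using abel_esum_Suc_sums[OF that, of p] by (simp add: c_def add.commute)
    then show ?thesis by (subst (asm) sums_Suc_iff) (simp add: c_def)
  qed
  have h_eq: "h y = abel (esum (Suc p)) y" if "0 \<le> y" "y < 1" for y
    using sums_unique[OF c_sums[OF that]] by (simp add: h_def)
  have dc: "diffs c n = esum p n" for n by (simp add: diffs_def c_def)
  have dh: "(h has_field_derivative (\<Sum>n. esum p n * y ^ n)) (at y)" if "\<bar>y\<bar> < 1" for y
  proof -
    define K where "K = (\<bar>y\<bar> + 1) / 2"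
    have "summable (\<lambda>n. c n * K ^ n)" by (rule sums_summable[OF c_sums]) (use that in \<open>auto simp: K_def\<close>)
    then have "DERIV (\<lambda>x. \<Sum>n. c n * x ^ n) y :> (\<Sum>n. diffs c n * y ^ n)"
      by (rule termdiffs_strong) (use that in \<open>auto simp: K_def\<close>)
    then show ?thesis by (simp add: h_def[abs_def] dc)
  qed
  define g where "g y = h y - log_pole y ^ Suc p / fact (Suc p)" for y
  have dL: "(log_pole has_field_derivative 1 / (1 - y)) (at y)" if "y < 1" for y
    unfolding log_pole_def[abs_def] using that by (auto intro!: derivative_eq_intros)
  have dg: "(g has_field_derivative (\<Sum>n. esum p n * y ^ n) - log_pole y ^ p / fact p * (1 / (1 - y))) (at y)" if "\<bar>y\<bar> < 1" for y
  proof -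
    have "((\<lambda>y. log_pole y ^ Suc p / fact (Suc p)) has_field_derivative
       (of_nat (Suc p) * (1 / (1 - y) * log_pole y ^ p)) / fact (Suc p)) (at y)"
      using DERIV_power_Suc[OF dL[of y], of p] that by (intro DERIV_cdivide) simp
    moreover have "(of_nat (Suc p) * (1 / (1 - y) * log_pole y ^ p)) / fact (Suc p) = log_pole y ^ p / fact p * (1 / (1 - y))"
      by (simp add: divide_simps del: of_nat_Suc)
    ultimately have "((\<lambda>y. log_pole y ^ Suc p / fact (Suc p)) has_field_derivative log_pole y ^ p / fact p * (1 / (1 - y))) (at y)"
      by (simp only:)
    from DERIV_diff[OF dh[OF that] this] show ?thesis unfolding g_def[abs_def] .
  qed
  have g0: "(g has_field_derivative 0) (at y)" if "0 \<le> y" "y < 1" for y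
  proof -
    have "(\<Sum>n. esum p n * y ^ n) = log_pole y ^ p / fact p * (1 / (1 - y))"
      using Suc.IH[OF that] that by (simp add: abel_def field_simps)
    with dg[of y] that show ?thesis by simp
  qed
  have "g x = g 0"
  proof (cases "x = 0")
    case False
    have "continuous_on {0..x} g"
      by (rule DERIV_atLeastAtMost_imp_continuous_on) (use g0 Suc.prems in force)
    then show ?thesis using Suc.prems g0 False
      by (intro DERIV_isconst2[of 0 x]) auto
  qed simp
  moreover have "g 0 = 0" using h_eq[of 0] by (simp add: g_def abel_def log_pole_def esum_Suc)
  ultimately show ?case using h_eq[OF Suc.prems] by (simp add: g_def)
qed

text \<open>For y = 1 / (N + 1) and the scale t = sqrt(1 - x), the bound y^\<delta> \<le> t^\<delta>
  + y t^(\<delta> - 1) reduces the series to the geometric and the logarithmic one.\<close>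

lemma abel_decaying: assumes "decaying a" shows "abel_small (abel a)"
proof -
  obtain C \<delta> where C: "C > 0" "0 < \<delta>" "\<delta> < 1" "\<And>N. \<bar>a N\<bar> \<le> C * (real N + 1) powr (- \<delta>)"
    using decaying_obtain[OF assms] by metis
  have "abel_small (\<lambda>x. (1 - x) powr (\<delta> / 2) * C + (1 - x) powr ((1 + \<delta>) / 2) * (2 * C * log_pole x))"
    using C by (intro abel_small_add abel_small_mult abel_small_powr abel_mod_const abel_mod_mult abel_mod_log_pole) auto
  then show ?thesis
  proof (rule abel_small_le)
    fix x :: real assume x: "1/2 \<le> x" "x < 1"
    define t where "t = (1 - x) powr (1/2)"
    have t: "t > 0" using x by (simp add: t_def)
    have pt: "y powr \<delta> \<le> t powr \<delta> + y * t powr (\<delta> - 1)" if "y > 0" for y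
    proof (cases "y \<le> t")
      case True
      then have "y powr \<delta> \<le> t powr \<delta>" using that C by (intro powr_mono2) auto
      then show ?thesis using that by (simp add: add_increasing2)
    next
      case False
      have "y powr \<delta> = y * y powr (\<delta> - 1)" using that by (simp add: powr_mult_base)
      also have "\<dots> \<le> y * t powr (\<delta> - 1)" using False t that C by (intro mult_left_mono powr_mono2') auto
      finally show ?thesis by (simp add: add_increasing)
    qed
    have L: "(\<lambda>N. x ^ N / (real N + 1)) sums (log_pole x / x)"
    proof -
      have "(\<lambda>N. esum 0 N / (real N + 1) * x ^ Suc N) sums abel (esum (Suc 0)) x" by (rule abel_esum_Suc_sums) (use x in auto)
      then have "(\<lambda>N. esum 0 N / (real N + 1) * x ^ Suc N / x) sums (abel (esum (Suc 0)) x / x)" by (rule sums_divide)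
      then show ?thesis using x abel_esum[of x "Suc 0"] by simp
    qed
    have sg: "(\<lambda>N. x ^ N) sums (1 / (1 - x))" by (rule geometric_sums) (use x in auto)
    have bs: "(\<lambda>N. C * t powr \<delta> * x ^ N + C * t powr (\<delta> - 1) * (x ^ N / (real N + 1))) sums
       (C * t powr \<delta> * (1 / (1 - x)) + C * t powr (\<delta> - 1) * (log_pole x / x))"
      by (intro sums_add sums_mult sg L)
    have bd: "\<bar>a N * x ^ N\<bar> \<le> C * t powr \<delta> * x ^ N + C * t powr (\<delta> - 1) * (x ^ N / (real N + 1))" for N
    proof -
      have "\<bar>a N\<bar> \<le> C * (1 / (real N + 1)) powr \<delta>" using C(4)[of N] by (simp add: powr_minus powr_divide field_simps)
      also have "\<dots> \<le> C * (t powr \<delta> + 1 / (real N + 1) * t powr (\<delta> - 1))"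
        using C by (intro mult_left_mono pt) auto
      finally have "\<bar>a N\<bar> * x ^ N \<le> C * (t powr \<delta> + 1 / (real N + 1) * t powr (\<delta> - 1)) * x ^ N"
        using x by (intro mult_right_mono) auto
      then show ?thesis using x by (simp add: abs_mult algebra_simps)
    qed
    have "\<bar>\<Sum>N. a N * x ^ N\<bar> \<le> (\<Sum>N. \<bar>a N * x ^ N\<bar>)"
      using log_bdd_abs_gen[OF decaying_log_bdd[OF assms]] x by (intro summable_rabs) (auto simp: abs_gen_def)
    also have "\<dots> \<le> C * t powr \<delta> * (1 / (1 - x)) + C * t powr (\<delta> - 1) * (log_pole x / x)"
      unfolding sums_unique[OF bs]
      using log_bdd_abs_gen[OF decaying_log_bdd[OF assms]] x bd sums_summable[OF bs]
      by (intro suminf_le) (auto simp: abs_gen_def)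
    finally have "(1 - x) * \<bar>\<Sum>N. a N * x ^ N\<bar> \<le> (1 - x) * (C * t powr \<delta> * (1 / (1 - x)) + C * t powr (\<delta> - 1) * (log_pole x / x))"
      using x by (intro mult_left_mono) auto
    also have "\<dots> = C * t powr \<delta> + C * ((1 - x) * t powr (\<delta> - 1)) * (log_pole x / x)"
      using x by (simp add: distrib_left)
    also have "t powr \<delta> = (1 - x) powr (\<delta> / 2)" by (simp add: t_def powr_powr)
    also have "(1 - x) * t powr (\<delta> - 1) = (1 - x) powr ((1 + \<delta>) / 2)"
      using x by (simp add: t_def powr_powr powr_mult_base add_divide_distrib diff_divide_distrib)
    also have "C * (1 - x) powr ((1 + \<delta>) / 2) * (log_pole x / x) \<le> C * (1 - x) powr ((1 + \<delta>) / 2) * (2 * log_pole x)"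
    proof (rule mult_left_mono)
      have "log_pole x \<ge> 0" using x by (simp add: log_pole_def)
      then have "log_pole x * 1 \<le> log_pole x * (2 * x)" using x by (intro mult_left_mono) auto
      then show "log_pole x / x \<le> 2 * log_pole x" using x by (simp add: field_simps)
    qed (use C in auto)
    finally have "\<bar>abel a x\<bar> \<le> (1 - x) powr (\<delta> / 2) * C + (1 - x) powr ((1 + \<delta>) / 2) * (2 * C * log_pole x)"
      using x by (simp add: abel_def abs_mult mult_ac)
    then show "\<bar>abel a x\<bar> \<le> \<bar>(1 - x) powr (\<delta> / 2) * C + (1 - x) powr ((1 + \<delta>) / 2) * (2 * C * log_pole x)\<bar>" by linarith
  qed
qed

text \<open>The constant carried by \<open>log_reg\<close> is the Abel constant term, because for p
  \<ge> 1 the Abel mean of \<open>esum p\<close> is a monomial in the logarithm without constant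
  term.\<close>

lemma log_reg_abel_reg: "log_reg w d a c \<Longrightarrow> abel_reg (abel a) c"
proof (induction rule: log_reg.induct)
  case (log_reg_decaying a) then show ?case by (intro abel_reg_abel_small abel_decaying)
next
  case (log_reg_const y)
  show ?case by (rule abel_reg_cong[OF abel_reg_poly[of "[:y:]", simplified]]) (simp add: abel_const)
next
  case (log_reg_esum p y)
  have "abel_reg (\<lambda>x. poly (monom (y / fact p) p) (log_pole x)) 0"
    using abel_reg_poly[of "monom (y / fact p) p"] log_reg_esum(1) by (simp add: poly_monom power_0_left)
  then show ?case
    by (rule abel_reg_cong) (simp add: abel_scale[OF log_bdd_abs_gen[OF log_bdd_esum]] abel_esum poly_monom)
next
  case (log_reg_add a c b c')
  show ?case
    by (rule abel_reg_cong[OF abel_reg_add[OF log_reg_add.IH]])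
       (use log_reg_add.hyps in \<open>simp add: abel_add log_bdd_abs_gen log_reg_log_bdd\<close>)
qed

section \<open>Convolutions and products of Abel means\<close>

definition convol :: "(nat \<Rightarrow> real) \<Rightarrow> (nat \<Rightarrow> real) \<Rightarrow> nat \<Rightarrow> real" where
  "convol a b N = (\<Sum>c\<le>N. a (N - c) * b c)"

text \<open>A product of two Abel means carries (1 - x)^2 while \<open>abel\<close> supplies only
  one factor; the other is added here.\<close>

definition conv_reg :: "(nat \<Rightarrow> real) \<Rightarrow> real \<Rightarrow> bool" where
  "conv_reg Z c \<longleftrightarrow> abs_gen Z \<and> abel_reg (\<lambda>x. (1 - x) * abel Z x) c"

lemma conv_reg_unique: "conv_reg Z c \<Longrightarrow> conv_reg Z d \<Longrightarrow> c = d"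
  unfolding conv_reg_def using abel_reg_unique by blast

lemma conv_reg_add: assumes "conv_reg Y c" "conv_reg Z d" shows "conv_reg (\<lambda>N. Y N + Z N) (c + d)"
  using assms abs_gen_add unfolding conv_reg_def
  by (auto intro!: abel_reg_cong[OF abel_reg_add] simp: abel_add algebra_simps)

lemma conv_reg_scale: assumes "conv_reg Y c" shows "conv_reg (\<lambda>N. q * Y N) (q * c)"
proof -
  have "abel_reg (\<lambda>x. q) q" using abel_reg_poly[of "[:q:]"] by simp
  from abel_reg_mult[OF this] have "abel_reg (\<lambda>x. q * ((1 - x) * abel Y x)) (q * c)" using assms by (simp add: conv_reg_def)
  then have "abel_reg (\<lambda>x. (1 - x) * abel (\<lambda>N. q * Y N) x) (q * c)"
    by (rule abel_reg_cong) (use assms in \<open>simp add: conv_reg_def abel_scale\<close>)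
  then show ?thesis using assms abs_gen_scale by (simp add: conv_reg_def)
qed

lemma conv_reg_0: "conv_reg (\<lambda>_. 0) 0"
proof -
  have "abs_gen (\<lambda>_. 0)" by (simp add: abs_gen_def)
  then show ?thesis unfolding conv_reg_def by (simp add: abel_def abel_reg_abel_small)
qed

lemma conv_reg_sum: "finite A \<Longrightarrow> (\<And>i. i \<in> A \<Longrightarrow> conv_reg (f i) (c i)) \<Longrightarrow> conv_reg (\<lambda>N. \<Sum>i\<in>A. f i N) (\<Sum>i\<in>A. c i)"
  by (induction A rule: finite_induct) (simp_all add: conv_reg_0 conv_reg_add)

lemma conv_reg_convol:
  assumes "log_reg w d a c" "log_reg w' d' b c'" shows "conv_reg (convol a b) (c * c')"
proof -
  have g: "abs_gen a" "abs_gen b" using assms by (auto intro: log_bdd_abs_gen log_reg_log_bdd)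
  have eq: "(\<Sum>i\<le>k. (b i * x ^ i) * (a (k - i) * x ^ (k - i))) = convol a b k * x ^ k" for x k
    unfolding convol_def sum_distrib_right
    by (rule sum.cong[OF refl]) (simp add: mult_ac flip: power_add)
  have eq': "(\<Sum>i\<le>k. \<bar>b i * x ^ i\<bar> * \<bar>a (k - i) * x ^ (k - i)\<bar>) \<ge> \<bar>convol a b k * x ^ k\<bar>" for x k
    unfolding eq[symmetric] by (rule order.trans[OF sum_abs]) (simp add: abs_mult)
  have "abs_gen (convol a b)"
    unfolding abs_gen_def
  proof (intro allI impI)
    fix x :: real assume x: "0 \<le> x \<and> x < 1"
    have "summable (\<lambda>k. \<Sum>i\<le>k. \<bar>b i * x ^ i\<bar> * \<bar>a (k - i) * x ^ (k - i)\<bar>)"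
      using g x unfolding abs_gen_def by (intro summable_Cauchy_product) auto
    then show "summable (\<lambda>N. \<bar>convol a b N * x ^ N\<bar>)"
      by (rule summable_comparison_test'[where N = 0]) (use eq' in simp)
  qed
  moreover have "abel_reg (\<lambda>x. (1 - x) * abel (convol a b) x) (c * c')"
  proof (rule abel_reg_cong[OF abel_reg_mult[OF log_reg_abel_reg[OF assms(1)] log_reg_abel_reg[OF assms(2)]]])
    fix x :: real assume x: "1/2 \<le> x" "x < 1"
    have "(\<Sum>k. b k * x ^ k) * (\<Sum>k. a k * x ^ k) = (\<Sum>k. \<Sum>i\<le>k. (b i * x ^ i) * (a (k - i) * x ^ (k - i)))"
      using g x unfolding abs_gen_def by (intro Cauchy_product) auto
    then show "abel a x * abel b x = (1 - x) * abel (convol a b) x"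
      unfolding eq by (simp add: abel_def mult_ac)
  qed
  ultimately show ?thesis by (simp add: conv_reg_def)
qed

section \<open>Sums over a window\<close>

definition decr_lists :: "nat \<Rightarrow> 'a::linorder set \<Rightarrow> 'a list set" where
  "decr_lists n A = {m. length m = n \<and> sorted_wrt (>) m \<and> set m \<subseteq> A}"

lemma finite_decr_lists [simp]: "finite A \<Longrightarrow> finite (decr_lists n A)"
  unfolding decr_lists_def
  by (rule finite_subset[OF _ finite_lists_length_eq[of A n]]) auto

lemma decr_lists_0 [simp]: "decr_lists 0 A = {[]}"
  by (auto simp: decr_lists_def)

lemma sum_decr_lists_Suc:
  assumes "finite A"
  shows "(\<Sum>m\<in>decr_lists (Suc n) A. F m) = (\<Sum>x\<in>A. \<Sum>m\<in>decr_lists n {y\<in>A. y < x}. F (x # m))"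
proof -
  have "decr_lists (Suc n) A = (\<lambda>(x, m). x # m) ` (SIGMA x:A. decr_lists n {y\<in>A. y < x})"
    by (auto simp: decr_lists_def length_Suc_conv image_iff)
  moreover have "inj_on (\<lambda>(x, m). x # m) (SIGMA x:A. decr_lists n {y\<in>A. y < x})"
    by (auto simp: inj_on_def)
  ultimately have "(\<Sum>m\<in>decr_lists (Suc n) A. F m) = (\<Sum>(x, m)\<in>(SIGMA x:A. decr_lists n {y\<in>A. y < x}). F (x # m))"
    by (simp add: sum.reindex case_prod_unfold)
  also have "\<dots> = (\<Sum>x\<in>A. \<Sum>m\<in>decr_lists n {y\<in>A. y < x}. F (x # m))"
    using assms by (subst sum.Sigma) auto
  finally show ?thesis .
qed

lemma sum_decr_lists_split:
  assumes "finite A"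
  shows "(\<Sum>m\<in>decr_lists (n + Suc n') A. F m) =
    (\<Sum>c\<in>A. \<Sum>u\<in>decr_lists n {y\<in>A. y > c}. \<Sum>v\<in>decr_lists n' {y\<in>A. y < c}. F (u @ c # v))"
  using assms
proof (induction n arbitrary: A F)
  case 0 then show ?case by (simp add: sum_decr_lists_Suc)
next
  case (Suc n)
  have "(\<Sum>m\<in>decr_lists (Suc n + Suc n') A. F m) =
      (\<Sum>x\<in>A. \<Sum>m\<in>decr_lists (n + Suc n') {y\<in>A. y < x}. F (x # m))"
    using Suc.prems by (simp add: sum_decr_lists_Suc)
  also have "\<dots> = (\<Sum>x\<in>A. \<Sum>c\<in>{y\<in>A. y < x}. \<Sum>u\<in>decr_lists n {y\<in>{y\<in>A. y < x}. y > c}.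
      \<Sum>v\<in>decr_lists n' {y\<in>{y\<in>A. y < x}. y < c}. F (x # u @ c # v))"
    using Suc.prems by (intro sum.cong[OF refl], subst Suc.IH) auto
  also have "\<dots> = (\<Sum>x\<in>A. \<Sum>c\<in>{y\<in>A. y < x}. \<Sum>u\<in>decr_lists n {y\<in>{y\<in>A. y > c}. y < x}.
      \<Sum>v\<in>decr_lists n' {y\<in>A. y < c}. F (x # u @ c # v))"
  proof (intro sum.cong refl)
    fix x c assume "c \<in> {y\<in>A. y < x}"
    then show "decr_lists n {y\<in>{y\<in>A. y < x}. y > c} = decr_lists n {y\<in>{y\<in>A. y > c}. y < x}"
      "decr_lists n' {y\<in>{y\<in>A. y < x}. y < c} = decr_lists n' {y\<in>A. y < c}"
      by (auto intro!: arg_cong2[of _ _ _ _ decr_lists])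
  qed
  also have "\<dots> = (\<Sum>c\<in>A. \<Sum>x\<in>{y\<in>A. y > c}. \<Sum>u\<in>decr_lists n {y\<in>{y\<in>A. y > c}. y < x}.
      \<Sum>v\<in>decr_lists n' {y\<in>A. y < c}. F (x # u @ c # v))"
    using Suc.prems by (subst sum.swap_restrict) auto
  also have "\<dots> = (\<Sum>c\<in>A. \<Sum>u\<in>decr_lists (Suc n) {y\<in>A. y > c}. \<Sum>v\<in>decr_lists n' {y\<in>A. y < c}. F (u @ c # v))"
    using Suc.prems by (simp add: sum_decr_lists_Suc)
  finally show ?case .
qed

lemma sum_decr_lists_gap:
  assumes "finite A" "p \<in> A"
  shows "(\<Sum>m\<in>decr_lists r (A - {p}). F m) =
    (\<Sum>i\<le>r. \<Sum>u\<in>decr_lists i {y\<in>A. y > p}. \<Sum>v\<in>decr_lists (r - i) {y\<in>A. y < p}. F (u @ v))"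
  using assms
proof (induction r arbitrary: A F)
  case (Suc r)
  let ?hi = "{y\<in>A. y > p}" and ?lo = "{y\<in>A. y < p}"
  let ?R = "\<lambda>x. \<Sum>m\<in>decr_lists r {y\<in>?hi \<union> ?lo. y < x}. F (x # m)"
  have "(\<Sum>m\<in>decr_lists (Suc r) (A - {p}). F m) = (\<Sum>x\<in>A - {p}. \<Sum>m\<in>decr_lists r {y\<in>A - {p}. y < x}. F (x # m))"
    using Suc.prems by (simp add: sum_decr_lists_Suc)
  also have "\<dots> = (\<Sum>x\<in>?hi \<union> ?lo. ?R x)"
    by (intro sum.cong arg_cong2[of _ _ _ _ decr_lists]) auto
  also have "(\<Sum>x\<in>?hi \<union> ?lo. ?R x) =
     (\<Sum>x\<in>?hi. ?R x) +
     (\<Sum>x\<in>?lo. ?R x)"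
    using Suc.prems by (intro sum.union_disjoint) auto
  also have "(\<Sum>x\<in>?lo. ?R x) =
     (\<Sum>x\<in>?lo. \<Sum>m\<in>decr_lists r {y\<in>?lo. y < x}. F (x # m))"
    by (intro sum.cong refl arg_cong2[of _ _ _ _ decr_lists]) auto
  also have "\<dots> = (\<Sum>v\<in>decr_lists (Suc r) ?lo. F v)"
    using Suc.prems by (simp add: sum_decr_lists_Suc)
  also have "(\<Sum>x\<in>?hi. ?R x) =
     (\<Sum>x\<in>?hi. \<Sum>i\<le>r. \<Sum>u\<in>decr_lists i {y\<in>?hi. y < x}. \<Sum>v\<in>decr_lists (r - i) ?lo. F (x # u @ v))"
  proof (intro sum.cong refl)
    fix x assume x: "x \<in> ?hi"
    have "?R x = (\<Sum>m\<in>decr_lists r ({y\<in>A. y < x} - {p}). F (x # m))"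
      by (intro sum.cong refl arg_cong2[of _ _ _ _ decr_lists]) auto
    also have "\<dots> = (\<Sum>i\<le>r. \<Sum>u\<in>decr_lists i {y\<in>{y\<in>A. y < x}. y > p}. \<Sum>v\<in>decr_lists (r - i) {y\<in>{y\<in>A. y < x}. y < p}. F (x # u @ v))"
      using Suc.prems x by (intro Suc.IH) auto
    also have "\<dots> = (\<Sum>i\<le>r. \<Sum>u\<in>decr_lists i {y\<in>?hi. y < x}. \<Sum>v\<in>decr_lists (r - i) ?lo. F (x # u @ v))"
      using x by (intro sum.cong refl arg_cong2[of _ _ _ _ decr_lists]) auto
    finally show "?R x = \<dots>" .
  qed
  also have "\<dots> = (\<Sum>i\<le>r. \<Sum>u\<in>decr_lists (Suc i) ?hi. \<Sum>v\<in>decr_lists (r - i) ?lo. F (u @ v))"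
    using Suc.prems by (subst sum.swap) (simp add: sum_decr_lists_Suc)
  finally show ?case by (subst sum.atMost_Suc_shift) (simp add: add.commute)
qed simp

section \<open>Chains on either side of a centre\<close>

definition chain_sum :: "letter list \<Rightarrow> int \<Rightarrow> int set \<Rightarrow> real" where
  "chain_sum ws c A = (\<Sum>m\<in>decr_lists (length ws) A. \<Prod>i<length ws. letter_fun (ws ! i) (m ! i - c))"

lemma chain_sum_Nil [simp]: "chain_sum [] c A = 1" by (simp add: chain_sum_def)

lemma chain_sum_Cons:
  "finite A \<Longrightarrow> chain_sum (a # ws) c A = (\<Sum>x\<in>A. letter_fun a (x - c) * chain_sum ws c {y\<in>A. y < x})"
  by (simp add: chain_sum_def sum_decr_lists_Suc prod.lessThan_Suc_shift sum_distrib_left del: prod.lessThan_Suc)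

lemma chain_sum_snoc:
  assumes "finite A"
  shows "chain_sum (ws @ [a]) c A = (\<Sum>x\<in>A. letter_fun a (x - c) * chain_sum ws c {y\<in>A. y > x})"
proof -
  have "chain_sum (ws @ [a]) c A = (\<Sum>x\<in>A. \<Sum>u\<in>decr_lists (length ws) {y\<in>A. y > x}.
      \<Prod>i<Suc (length ws). letter_fun ((ws @ [a]) ! i) ((u @ [x]) ! i - c))"
    using sum_decr_lists_split[OF assms, of "\<lambda>m. \<Prod>i<Suc (length ws). letter_fun ((ws @ [a]) ! i) (m ! i - c)" "length ws" 0]
    by (simp add: chain_sum_def)
  also have "\<dots> = (\<Sum>x\<in>A. \<Sum>u\<in>decr_lists (length ws) {y\<in>A. y > x}.
      letter_fun a (x - c) * (\<Prod>i<length ws. letter_fun (ws ! i) (u ! i - c)))"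
  proof (intro sum.cong refl)
    fix x u assume "u \<in> decr_lists (length ws) {y\<in>A. y > x}"
    then have l: "length u = length ws" by (simp add: decr_lists_def)
    then show "(\<Prod>i<Suc (length ws). letter_fun ((ws @ [a]) ! i) ((u @ [x]) ! i - c)) =
      letter_fun a (x - c) * (\<Prod>i<length ws. letter_fun (ws ! i) (u ! i - c))"
      by (auto simp: nth_append mult.commute l[symmetric] intro!: prod.cong)
  qed
  finally show ?thesis by (simp add: chain_sum_def sum_distrib_left)
qed

definition reflect :: "letter \<Rightarrow> letter" where
  "reflect a = (fst a, \<lambda>m. (-1) ^ fst a * snd a (- m))"

lemma letter_fun_reflect: "letter_fun (reflect a) m = letter_fun a (- m)"
  by (cases "even (fst a)") (simp_all add: letter_fun_def reflect_def)

lemma fst_reflect [simp]: "fst (reflect a) = fst a" by (simp add: reflect_def)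

lemma valid_reflect: assumes "valid a" shows "valid (reflect a)"
proof -
  have "snd a (- m - 4) = snd a (- m)" for m
    using assms per4_D(1)[of "snd a" "- m - 4"] by (simp add: valid_def)
  then show ?thesis using assms by (auto simp: valid_def reflect_def per4_def)
qed

lemma chain_sum_upper: "chain_sum ws c {c + 1..c + int n} = nsum ws n"
proof (induction ws arbitrary: n)
  case (Cons a ws)
  have "chain_sum (a # ws) c {c + 1..c + int n} =
      (\<Sum>m=1..n. letter_fun a (int m) * chain_sum ws c {y\<in>{c + 1..c + int n}. y < c + int m})"
    unfolding chain_sum_Cons[OF finite_atLeastAtMost_int]
    by (rule sum.reindex_bij_witness[of _ "\<lambda>m. c + int m" "\<lambda>x. nat (x - c)"]) auto
  also have "\<dots> = (\<Sum>m=1..n. letter_fun a (int m) * nsum ws (m - 1))"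
  proof (intro sum.cong refl)
    fix m assume "m \<in> {1..n}"
    then have "{y\<in>{c + 1..c + int n}. y < c + int m} = {c + 1..c + int (m - 1)}" by auto
    then show "letter_fun a (int m) * chain_sum ws c {y\<in>{c + 1..c + int n}. y < c + int m} =
       letter_fun a (int m) * nsum ws (m - 1)" by (simp add: Cons)
  qed
  finally show ?case by (simp add: nsum.simps)
qed simp

text \<open>Below the centre the last entry is the farthest one, so in terms of distances the word
  is read backwards, and each letter is evaluated at a negative argument.\<close>

lemma chain_sum_lower: "chain_sum ws c {c - int n..c - 1} = nsum (rev (map reflect ws)) n"
proof (induction ws arbitrary: n rule: rev_induct)
  case (snoc a ws)
  have "chain_sum (ws @ [a]) c {c - int n..c - 1} =
      (\<Sum>m=1..n. letter_fun a (- int m) * chain_sum ws c {y\<in>{c - int n..c - 1}. y > c - int m})"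
    unfolding chain_sum_snoc[OF finite_atLeastAtMost_int]
    by (rule sum.reindex_bij_witness[of _ "\<lambda>m. c - int m" "\<lambda>x. nat (c - x)"]) auto
  also have "\<dots> = (\<Sum>m=1..n. letter_fun (reflect a) (int m) * nsum (rev (map reflect ws)) (m - 1))"
  proof (intro sum.cong refl)
    fix m assume "m \<in> {1..n}"
    then have "{y\<in>{c - int n..c - 1}. y > c - int m} = {c - int (m - 1)..c - 1}" by auto
    then show "letter_fun a (- int m) * chain_sum ws c {y\<in>{c - int n..c - 1}. y > c - int m} =
       letter_fun (reflect a) (int m) * nsum (rev (map reflect ws)) (m - 1)" by (simp add: snoc letter_fun_reflect)
  qed
  finally show ?case by (simp add: nsum.simps)
qed simp

lemma chain_sum_window:
  assumes "c \<le> N"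
  shows "chain_sum ws (int c) {y\<in>{0..int N}. y > int c} = nsum ws (N - c)"
    and "chain_sum ws (int c) {y\<in>{0..int N}. y < int c} = nsum (rev (map reflect ws)) c"
proof -
  have "{y\<in>{0..int N}. y > int c} = {int c + 1..int c + int (N - c)}"
    "{y\<in>{0..int N}. y < int c} = {int c - int c..int c - 1}" using assms by auto
  then show "chain_sum ws (int c) {y\<in>{0..int N}. y > int c} = nsum ws (N - c)"
    "chain_sum ws (int c) {y\<in>{0..int N}. y < int c} = nsum (rev (map reflect ws)) c"
    by (simp_all only: chain_sum_upper chain_sum_lower)
qed

lemma sum_window: "(\<Sum>c\<in>{0..int N}. f c) = (\<Sum>c\<le>N. f (int c))"
  by (rule sum.reindex_bij_witness[of _ int nat]) auto

text \<open>
  Windows make both centrings finite sums and count a configuration of span \<open>D\<close> exactly \<open>N - D + 1\<close>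
  times, which is the convolution structure on either side.
\<close>

definition window_sum :: "letter list \<Rightarrow> ((nat \<Rightarrow> real) \<Rightarrow> real) \<Rightarrow> nat \<Rightarrow> real" where
  "window_sum ws F N = (\<Sum>p\<in>{0..int N}. \<Sum>m\<in>decr_lists (length ws) ({0..int N} - {p}).
     (\<Prod>i<length ws. snd (ws ! i) (m ! i - p)) * F (\<lambda>i. real_of_int (m ! i - p)))"

lemma prod_lessThan_add: "(\<Prod>j<i + n. f j) = (\<Prod>j<i. f j) * (\<Prod>j<n. f (i + j) :: real)" for i n :: nat
  by (induction n) (simp_all add: mult.assoc)

lemma prod_split_append:
  assumes "length u = i" "i \<le> r"
  shows "(\<Prod>j<r. f j ((u @ v) ! j)) = (\<Prod>j<i. f j (u ! j)) * (\<Prod>j<r - i. f (i + j) (v ! j) :: real)"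
proof -
  have "(\<Prod>j<r. f j ((u @ v) ! j)) = (\<Prod>j<i. f j ((u @ v) ! j)) * (\<Prod>j<r - i. f (i + j) ((u @ v) ! (i + j)))"
    using prod_lessThan_add[of "\<lambda>j. f j ((u @ v) ! j)" i "r - i"] assms(2) by simp
  moreover have "(\<Prod>j<i. f j ((u @ v) ! j)) = (\<Prod>j<i. f j (u ! j))"
    using assms(1) by (intro prod.cong) (auto simp: nth_append)
  moreover have "(\<Prod>j<r - i. f (i + j) ((u @ v) ! (i + j))) = (\<Prod>j<r - i. f (i + j) (v ! j))"
    using assms(1) by (intro prod.cong) auto
  ultimately show ?thesis by simp
qed

text \<open>Here \<open>i\<close> counts the variables above p. A point p = c leaves N - c places
  above and c below, and summing over c is a convolution.\<close>

lemma window_sum_centred_at_point: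
  "window_sum ws (\<lambda>x. \<Prod>i<length ws. 1 / x i ^ fst (ws ! i)) N =
   (\<Sum>i\<le>length ws. convol (nsum (take i ws)) (nsum (rev (map reflect (drop i ws)))) N)"
proof -
  let ?I = "{0..int N}" and ?r = "length ws"
  have "window_sum ws (\<lambda>x. \<Prod>i<?r. 1 / x i ^ fst (ws ! i)) N =
     (\<Sum>p\<in>?I. \<Sum>m\<in>decr_lists ?r (?I - {p}). \<Prod>i<?r. letter_fun (ws ! i) (m ! i - p))"
    unfolding window_sum_def prod.distrib[symmetric]
    by (intro sum.cong refl prod.cong) (simp add: letter_fun_def)
  also have "\<dots> = (\<Sum>p\<in>?I. \<Sum>i\<le>?r. chain_sum (take i ws) p {y\<in>?I. y > p} * chain_sum (drop i ws) p {y\<in>?I. y < p})"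
  proof (rule sum.cong[OF refl])
    fix p assume p: "p \<in> ?I"
    have "(\<Sum>m\<in>decr_lists ?r (?I - {p}). \<Prod>i<?r. letter_fun (ws ! i) (m ! i - p)) =
      (\<Sum>i\<le>?r. \<Sum>u\<in>decr_lists i {y\<in>?I. y > p}. \<Sum>v\<in>decr_lists (?r - i) {y\<in>?I. y < p}.
         \<Prod>j<?r. letter_fun (ws ! j) ((u @ v) ! j - p))"
      by (rule sum_decr_lists_gap) (use p in auto)
    also have "\<dots> = (\<Sum>i\<le>?r. \<Sum>u\<in>decr_lists i {y\<in>?I. y > p}. \<Sum>v\<in>decr_lists (?r - i) {y\<in>?I. y < p}.
         (\<Prod>j<i. letter_fun (take i ws ! j) (u ! j - p)) * (\<Prod>j<?r - i. letter_fun (drop i ws ! j) (v ! j - p)))"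
    proof (intro sum.cong refl)
      fix i u v assume *: "i \<in> {..?r}" "u \<in> decr_lists i {y\<in>?I. y > p}"
      then have "length u = i" by (simp add: decr_lists_def)
      then show "(\<Prod>j<?r. letter_fun (ws ! j) ((u @ v) ! j - p)) =
        (\<Prod>j<i. letter_fun (take i ws ! j) (u ! j - p)) * (\<Prod>j<?r - i. letter_fun (drop i ws ! j) (v ! j - p))"
        using prod_split_append[of u i ?r "\<lambda>j m. letter_fun (ws ! j) (m - p)" v] * by simp
    qed
    also have "\<dots> = (\<Sum>i\<le>?r. chain_sum (take i ws) p {y\<in>?I. y > p} * chain_sum (drop i ws) p {y\<in>?I. y < p})"
      by (intro sum.cong refl) (simp add: chain_sum_def sum_product min_absorb2)
    finally show "(\<Sum>m\<in>decr_lists ?r (?I - {p}). \<Prod>i<?r. letter_fun (ws ! i) (m ! i - p)) = \<dots>" .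
  qed
  also have "\<dots> = (\<Sum>c\<le>N. \<Sum>i\<le>?r. nsum (take i ws) (N - c) * nsum (rev (map reflect (drop i ws))) c)"
    unfolding sum_window
  proof (intro sum.cong refl)
    fix c i assume "c \<in> {..N}"
    then have "c \<le> N" by simp
    from chain_sum_window[OF this] show "chain_sum (take i ws) (int c) {y\<in>?I. y > int c} * chain_sum (drop i ws) (int c) {y\<in>?I. y < int c}
      = nsum (take i ws) (N - c) * nsum (rev (map reflect (drop i ws))) c" by (simp only:)
  qed
  also have "\<dots> = (\<Sum>i\<le>?r. convol (nsum (take i ws)) (nsum (rev (map reflect (drop i ws)))) N)"
    unfolding convol_def by (rule sum.swap)
  finally show ?thesis .
qed

definition merges :: "letter \<Rightarrow> letter list \<Rightarrow> letter list list" where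
  "merges a us = map (\<lambda>i. us[i := letter_mult a (us ! i)]) [0..<length us]"

text \<open>The new point has no prescribed order relative to the chain and must only avoid it. So
  the sum is a full product minus the coincidences p = u_i, and a coincidence multiplies the i-th
  letter by \<open>a\<close>.\<close>

lemma chain_sum_insert_point:
  assumes "finite A"
  shows "(\<Sum>u\<in>decr_lists (length us) A.
      (\<Prod>i<length us. letter_fun (us ! i) (u ! i - c)) * (\<Sum>p\<in>A - set u. letter_fun a (p - c)))
    = chain_sum [a] c A * chain_sum us c A - (\<Sum>ws\<leftarrow>merges a us. chain_sum ws c A)"
proof -
  let ?P = "\<lambda>u. \<Prod>i<length us. letter_fun (us ! i) (u ! i - c)"
  have "(\<Sum>u\<in>decr_lists (length us) A. ?P u * (\<Sum>p\<in>A - set u. letter_fun a (p - c))) =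
    (\<Sum>u\<in>decr_lists (length us) A. ?P u * (\<Sum>p\<in>A. letter_fun a (p - c)) - (\<Sum>i<length us. letter_fun a (u ! i - c) * ?P u))"
  proof (intro sum.cong refl)
    fix u assume u: "u \<in> decr_lists (length us) A"
    then have "set u \<subseteq> A" "length u = length us" and s: "sorted_wrt (>) u" by (auto simp: decr_lists_def)
    have d: "distinct u" using s by (induction u) auto
    have "(\<Sum>p\<in>A - set u. letter_fun a (p - c)) = (\<Sum>p\<in>A. letter_fun a (p - c)) - (\<Sum>p\<in>set u. letter_fun a (p - c))"
      using \<open>set u \<subseteq> A\<close> assms by (intro sum_diff) auto
    also have "(\<Sum>p\<in>set u. letter_fun a (p - c)) = (\<Sum>i<length us. letter_fun a (u ! i - c))"
      using d \<open>length u = length us\<close> sum.reindex_bij_betw[OF bij_betw_nth[OF d refl refl], of "\<lambda>p. letter_fun a (p - c)"]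
      by (simp add: lessThan_atLeast0)
    finally show "?P u * (\<Sum>p\<in>A - set u. letter_fun a (p - c)) =
      ?P u * (\<Sum>p\<in>A. letter_fun a (p - c)) - (\<Sum>i<length us. letter_fun a (u ! i - c) * ?P u)"
      by (simp only: right_diff_distrib sum_distrib_right mult.commute[of "?P u"])
  qed
  also have "\<dots> = chain_sum us c A * (\<Sum>p\<in>A. letter_fun a (p - c)) -
      (\<Sum>i<length us. \<Sum>u\<in>decr_lists (length us) A. letter_fun a (u ! i - c) * ?P u)"
  proof -
    have "(\<Sum>u\<in>decr_lists (length us) A. \<Sum>i<length us. letter_fun a (u ! i - c) * ?P u) =
      (\<Sum>i<length us. \<Sum>u\<in>decr_lists (length us) A. letter_fun a (u ! i - c) * ?P u)" by (rule sum.swap)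
    then show ?thesis by (simp only: sum_subtractf chain_sum_def sum_distrib_right)
  qed
  also have "(\<Sum>p\<in>A. letter_fun a (p - c)) = chain_sum [a] c A"
    using assms by (simp add: chain_sum_Cons)
  also have "(\<Sum>i<length us. \<Sum>u\<in>decr_lists (length us) A. letter_fun a (u ! i - c) * ?P u) =
     (\<Sum>i<length us. chain_sum (us[i := letter_mult a (us ! i)]) c A)"
  proof (intro sum.cong refl)
    fix i assume i: "i \<in> {..<length us}"
    have "letter_fun a (u ! i - c) * ?P u =
        (\<Prod>j<length us. letter_fun (us[i := letter_mult a (us ! i)] ! j) (u ! j - c))" for u
    proof -
      have "?P u = letter_fun (us ! i) (u ! i - c) * (\<Prod>j\<in>{..<length us} - {i}. letter_fun (us ! j) (u ! j - c))"
        using i by (intro prod.remove) auto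
      moreover have "(\<Prod>j<length us. letter_fun (us[i := letter_mult a (us ! i)] ! j) (u ! j - c)) =
        letter_fun (us[i := letter_mult a (us ! i)] ! i) (u ! i - c) *
        (\<Prod>j\<in>{..<length us} - {i}. letter_fun (us[i := letter_mult a (us ! i)] ! j) (u ! j - c))"
        using i by (intro prod.remove) auto
      moreover have "(\<Prod>j\<in>{..<length us} - {i}. letter_fun (us[i := letter_mult a (us ! i)] ! j) (u ! j - c)) =
        (\<Prod>j\<in>{..<length us} - {i}. letter_fun (us ! j) (u ! j - c))" by (intro prod.cong) auto
      ultimately show ?thesis using i by (simp add: letter_fun_mult)
    qed
    then show "(\<Sum>u\<in>decr_lists (length us) A. letter_fun a (u ! i - c) * ?P u) = chain_sum (us[i := letter_mult a (us ! i)]) c A"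
      by (simp add: chain_sum_def)
  qed
  also have "\<dots> = (\<Sum>ws\<leftarrow>merges a us. chain_sum ws c A)"
    by (simp add: merges_def interv_sum_list_conv_sum_set_nat o_def lessThan_atLeast0)
  finally show ?thesis by (simp add: mult.commute)
qed

lemma decr_lists_remove_iff: "m \<in> decr_lists r (A - {p}) \<longleftrightarrow> m \<in> decr_lists r A \<and> p \<notin> set m"
  by (auto simp: decr_lists_def)

text \<open>With a the residue of p - m_j, the character value at m_i - p equals that at (m_i - m_j)
  - a, a letter in m_i - m_j alone (\<open>shift_letter\<close>). The present letter carries the
  power of p - m_j and enforces the residue.\<close>

definition residue_letter :: "nat \<Rightarrow> int \<Rightarrow> letter" where
  "residue_letter l a = (l, \<lambda>m. if m mod 4 = a then 1 else 0)"

definition shift_letter :: "(int \<Rightarrow> real) \<Rightarrow> nat \<Rightarrow> int \<Rightarrow> letter" where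
  "shift_letter g e a = (e, \<lambda>m. g (m - a))"

text \<open>With centre c = m_j the point p lies on one of the two sides, whence two convolutions,
  and on its side it is a free point as in \<open>chain_sum_insert_point\<close>. The sign (-1)^l
  and the argument -a arise because x_j = m_j - p is the negative of p - c.\<close>

lemma window_sum_centred_at_entry:
  fixes es :: "nat \<Rightarrow> nat" and ws :: "letter list"
  assumes j: "j < length ws" and v: "list_all valid ws"
  defines "us \<equiv> \<lambda>a. map (\<lambda>i. shift_letter (snd (ws ! i)) (es i) a) [0..<j]"
    and "vs \<equiv> \<lambda>a. map (\<lambda>i. shift_letter (snd (ws ! i)) (es i) a) [Suc j..<length ws]"
  shows "window_sum ws (\<lambda>x. q * (1 / x j ^ l * (\<Prod>i\<in>{..<length ws} - {j}. 1 / (x i - x j) ^ es i))) N =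
    (\<Sum>a\<in>{0..<4}. q * (-1) ^ l * snd (ws ! j) (- a) *
      (convol (\<lambda>n. nsum [residue_letter l a] n * nsum (us a) n - (\<Sum>w\<leftarrow>merges (residue_letter l a) (us a). nsum w n))
         (nsum (rev (map reflect (vs a)))) N +
       convol (nsum (us a))
         (\<lambda>n. nsum [reflect (residue_letter l a)] n * nsum (rev (map reflect (vs a))) n -
              (\<Sum>w\<leftarrow>merges (residue_letter l a) (vs a). nsum (rev (map reflect w)) n)) N))"
proof -
  let ?I = "{0..int N}" and ?r = "length ws"
  let ?\<phi> = "residue_letter l"
  let ?f = "\<lambda>a. letter_fun (?\<phi> a)"
  let ?g = "\<lambda>a. q * (-1) ^ l * snd (ws ! j) (- a)"
  let ?B = "\<lambda>a c. (nsum [?\<phi> a] (N - c) * nsum (us a) (N - c) -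
        (\<Sum>w\<leftarrow>merges (?\<phi> a) (us a). nsum w (N - c))) * nsum (rev (map reflect (vs a))) c +
     nsum (us a) (N - c) * (nsum [reflect (?\<phi> a)] c * nsum (rev (map reflect (vs a))) c -
        (\<Sum>w\<leftarrow>merges (?\<phi> a) (vs a). nsum (rev (map reflect w)) c))"
  let ?C = "\<lambda>a c. (chain_sum [?\<phi> a] c {y\<in>?I. y > c} * chain_sum (us a) c {y\<in>?I. y > c} -
        (\<Sum>w\<leftarrow>merges (?\<phi> a) (us a). chain_sum w c {y\<in>?I. y > c})) * chain_sum (vs a) c {y\<in>?I. y < c} +
     chain_sum (us a) c {y\<in>?I. y > c} * (chain_sum [?\<phi> a] c {y\<in>?I. y < c} * chain_sum (vs a) c {y\<in>?I. y < c} -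
        (\<Sum>w\<leftarrow>merges (?\<phi> a) (vs a). chain_sum w c {y\<in>?I. y < c}))"
  define n' where "n' = ?r - Suc j"
  have r: "?r = j + Suc n'" using j by (simp add: n'_def)
  have lus: "length (us a) = j" and lvs: "length (vs a) = n'" for a by (simp_all add: us_def vs_def n'_def)
  define G where "G p m = (\<Prod>i<?r. snd (ws ! i) (m ! i - p)) *
     (q * (1 / real_of_int (m ! j - p) ^ l * (\<Prod>i\<in>{..<?r} - {j}. 1 / (real_of_int (m ! i - p) - real_of_int (m ! j - p)) ^ es i)))"
    for p and m :: "int list"
  have G: "G p (u @ c # v) = (\<Sum>a\<in>{0..<4}. ?g a * ((\<Prod>i<length (us a). letter_fun (us a ! i) (u ! i - c)) *
      (\<Prod>i<length (vs a). letter_fun (vs a ! i) (v ! i - c)) * ?f a (p - c)))"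
    if l: "length u = j" "length v = n'" for p c u v
  proof -
    let ?m = "u @ c # v"
    define b where "b = (p - c) mod 4"
    have b: "b \<in> {0..<4}" by (simp add: b_def)
    have bd: "4 dvd (p - c - b)" unfolding b_def by (rule dvd_minus_mod)
    have mj: "?m ! j = c" using l by (simp add: nth_append)
    have per: "snd (ws ! i) (x - p) = snd (ws ! i) (x - c - b)" if "i < ?r" for i x
    proof -
      have p4: "per4 (snd (ws ! i))" using v that by (simp add: list_all_length valid_def)
      obtain k where "p - c - b = 4 * k" using bd by (elim dvdE)
      then have "x - c - b = (x - p) + 4 * k" by simp
      then show ?thesis using per4_iter[OF p4] by metis
    qed
    have "G p ?m = snd (ws ! j) (- b) * (q / real_of_int (c - p) ^ l) *
        (\<Prod>i\<in>{..<?r} - {j}. letter_fun (shift_letter (snd (ws ! i)) (es i) b) (?m ! i - c))"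
    proof -
      have "(\<Prod>i<?r. snd (ws ! i) (?m ! i - p)) = snd (ws ! j) (c - p) * (\<Prod>i\<in>{..<?r} - {j}. snd (ws ! i) (?m ! i - p))"
        using j mj by (subst prod.remove[of _ j]) auto
      moreover have "snd (ws ! j) (c - p) = snd (ws ! j) (- b)" using per[OF j, of c] by simp
      moreover have "(\<Prod>i\<in>{..<?r} - {j}. snd (ws ! i) (?m ! i - p)) * (\<Prod>i\<in>{..<?r} - {j}. 1 / (real_of_int (?m ! i - p) - real_of_int (c - p)) ^ es i)
        = (\<Prod>i\<in>{..<?r} - {j}. letter_fun (shift_letter (snd (ws ! i)) (es i) b) (?m ! i - c))"
        unfolding prod.distrib[symmetric]
        by (intro prod.cong refl) (simp add: letter_fun_def shift_letter_def per)
      ultimately show ?thesis unfolding G_def mj by (simp add: algebra_simps)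
    qed
    also have "(\<Prod>i\<in>{..<?r} - {j}. letter_fun (shift_letter (snd (ws ! i)) (es i) b) (?m ! i - c)) =
       (\<Prod>i<length (us b). letter_fun (us b ! i) (u ! i - c)) * (\<Prod>i<length (vs b). letter_fun (vs b ! i) (v ! i - c))"
    proof -
      let ?h = "\<lambda>i. letter_fun (shift_letter (snd (ws ! i)) (es i) b) (?m ! i - c)"
      have sp: "{..<?r} - {j} = {..<j} \<union> {Suc j..<?r}" using j by auto
      have "(\<Prod>i\<in>{..<?r} - {j}. ?h i) = (\<Prod>i<j. ?h i) * (\<Prod>i\<in>{Suc j..<?r}. ?h i)"
        unfolding sp by (rule prod.union_disjoint) auto
      also have "(\<Prod>i<j. ?h i) = (\<Prod>i<length (us b). letter_fun (us b ! i) (u ! i - c))"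
        using l by (intro prod.cong) (auto simp: us_def nth_append)
      also have "(\<Prod>i\<in>{Suc j..<?r}. ?h i) = (\<Prod>i<n'. ?h (Suc j + i))"
        by (rule prod.reindex_bij_witness[of _ "\<lambda>i. Suc j + i" "\<lambda>i. i - Suc j"]) (auto simp: n'_def)
      also have "\<dots> = (\<Prod>i<length (vs b). letter_fun (vs b ! i) (v ! i - c))"
        using l by (intro prod.cong) (auto simp: vs_def nth_append n'_def)
      finally show ?thesis .
    qed
    also have "q / real_of_int (c - p) ^ l = q * (-1) ^ l * ?f b (p - c)"
    proof -
      have "real_of_int (c - p) = (-1) * real_of_int (p - c)" by simp
      then have "real_of_int (c - p) ^ l = (-1) ^ l * real_of_int (p - c) ^ l" by (metis power_mult_distrib)
      moreover have "?f b (p - c) = 1 / real_of_int (p - c) ^ l" by (simp add: letter_fun_def residue_letter_def b_def)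
      ultimately show ?thesis by (cases "even l") simp_all
    qed
    finally have Gb: "G p ?m = ?g b * ((\<Prod>i<length (us b). letter_fun (us b ! i) (u ! i - c)) *
      (\<Prod>i<length (vs b). letter_fun (vs b ! i) (v ! i - c)) * ?f b (p - c))" by (simp add: mult_ac)
    \<comment> \<open>Only the actual residue of p - c contributes. Writing the single term as a sum
      over all residues makes the range of a independent of p, so the sums can be exchanged.\<close>
    have z: "?f a (p - c) = 0" if "a \<noteq> b" for a using that by (simp add: letter_fun_def residue_letter_def b_def)
    show ?thesis unfolding Gb using b z by (subst sum.remove[of _ b]) auto
  qed
  have "window_sum ws (\<lambda>x. q * (1 / x j ^ l * (\<Prod>i\<in>{..<length ws} - {j}. 1 / (x i - x j) ^ es i))) N =
    (\<Sum>p\<in>?I. \<Sum>m\<in>{m\<in>decr_lists ?r ?I. p \<notin> set m}. G p m)"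
    unfolding window_sum_def G_def by (intro sum.cong refl) (auto simp: decr_lists_remove_iff)
  \<comment> \<open>The change of roles: the chain is fixed first, and p becomes the inner
    variable.\<close>
  also have "\<dots> = (\<Sum>m\<in>decr_lists ?r ?I. \<Sum>p\<in>{p\<in>?I. p \<notin> set m}. G p m)"
    by (rule sum.swap_restrict) auto
  also have "\<dots> = (\<Sum>c\<in>?I. \<Sum>u\<in>decr_lists j {y\<in>?I. y > c}. \<Sum>v\<in>decr_lists n' {y\<in>?I. y < c}.
      \<Sum>p\<in>{p\<in>?I. p \<notin> set (u @ c # v)}. G p (u @ c # v))"
    unfolding r by (rule sum_decr_lists_split) auto
  also have "\<dots> = (\<Sum>c\<in>?I. \<Sum>a\<in>{0..<4}. ?g a * (?C a c))"
  proof (rule sum.cong[OF refl])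
    fix c assume c: "c \<in> ?I"
    let ?hi = "{y\<in>?I. y > c}" and ?lo = "{y\<in>?I. y < c}"
    let ?U = "\<lambda>a u. \<Prod>i<length (us a). letter_fun (us a ! i) (u ! i - c)"
    let ?V = "\<lambda>a v. \<Prod>i<length (vs a). letter_fun (vs a ! i) (v ! i - c)"
    let ?X = "\<lambda>a u v. ?g a * ((?U a u * (\<Sum>p\<in>?hi - set u. ?f a (p - c))) * ?V a v + ?U a u * (?V a v * (\<Sum>p\<in>?lo - set v. ?f a (p - c))))"
    let ?Y = "\<lambda>a. (\<Sum>u\<in>decr_lists j ?hi. ?U a u * (\<Sum>p\<in>?hi - set u. ?f a (p - c))) * (\<Sum>v\<in>decr_lists n' ?lo. ?V a v) +
       (\<Sum>u\<in>decr_lists j ?hi. ?U a u) * (\<Sum>v\<in>decr_lists n' ?lo. ?V a v * (\<Sum>p\<in>?lo - set v. ?f a (p - c)))"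
    let ?P = "\<lambda>u v. {p\<in>?I. p \<notin> set (u @ c # v)}"
    have fin: "finite ?hi" "finite ?lo" by (rule finite_subset[OF Collect_restrict], simp)+
    have "(\<Sum>u\<in>decr_lists j ?hi. \<Sum>v\<in>decr_lists n' ?lo. \<Sum>p\<in>?P u v. G p (u @ c # v)) =
      (\<Sum>u\<in>decr_lists j ?hi. \<Sum>v\<in>decr_lists n' ?lo. \<Sum>a\<in>{0..<4}.
         ?X a u v)"
    proof (rule sum.cong[OF refl], rule sum.cong[OF refl])
      fix u v assume uv: "u \<in> decr_lists j ?hi" "v \<in> decr_lists n' ?lo"
      then have l: "length u = j" "length v = n'" and s: "set u \<subseteq> ?hi" "set v \<subseteq> ?lo" by (auto simp: decr_lists_def)
      have "?P u v = (?hi - set u) \<union> (?lo - set v)" using s by auto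
      moreover have "(?hi - set u) \<inter> (?lo - set v) = {}" by auto
      ultimately have sp: "(\<Sum>p\<in>?P u v. h p) = (\<Sum>p\<in>?hi - set u. h p) + (\<Sum>p\<in>?lo - set v. h p)" for h :: "int \<Rightarrow> real"
        using fin by (simp add: sum.union_disjoint)
      have "(\<Sum>p\<in>?P u v. G p (u @ c # v)) =
        (\<Sum>a\<in>{0..<4}. \<Sum>p\<in>?P u v. ?g a * (?U a u * ?V a v * ?f a (p - c)))"
        unfolding G[OF l] by (rule sum.swap)
      also have "\<dots> = (\<Sum>a\<in>{0..<4}. ?X a u v)"
        unfolding sum_distrib_left[symmetric] sp by (intro sum.cong refl) (simp only: algebra_simps)
      finally show "(\<Sum>p\<in>?P u v. G p (u @ c # v)) = \<dots>" .
    qed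
    also have "\<dots> = (\<Sum>a\<in>{0..<4}. \<Sum>u\<in>decr_lists j ?hi. \<Sum>v\<in>decr_lists n' ?lo.
         ?X a u v)"
      by (subst sum.swap[of _ "{0..<4}" "decr_lists n' ?lo"], subst sum.swap[of _ "{0..<4}" "decr_lists j ?hi"]) (rule refl)
    also have "\<dots> = (\<Sum>a\<in>{0..<4}. ?g a * (?Y a))"
      by (simp only: sum_distrib_left[symmetric] sum.distrib sum_product)
    also have "\<dots> = (\<Sum>a\<in>{0..<4}. ?g a * (?C a c))"
    proof (intro sum.cong refl)
      fix a
      have "(\<Sum>u\<in>decr_lists j ?hi. ?U a u * (\<Sum>p\<in>?hi - set u. ?f a (p - c))) =
          chain_sum [?\<phi> a] c ?hi * chain_sum (us a) c ?hi - (\<Sum>w\<leftarrow>merges (?\<phi> a) (us a). chain_sum w c ?hi)"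
        using chain_sum_insert_point[OF fin(1), of "us a" c "residue_letter l a"] unfolding lus by simp
      moreover have "(\<Sum>v\<in>decr_lists n' ?lo. ?V a v * (\<Sum>p\<in>?lo - set v. ?f a (p - c))) =
          chain_sum [?\<phi> a] c ?lo * chain_sum (vs a) c ?lo - (\<Sum>w\<leftarrow>merges (?\<phi> a) (vs a). chain_sum w c ?lo)"
        using chain_sum_insert_point[OF fin(2), of "vs a" c "residue_letter l a"] unfolding lvs by simp
      moreover have "(\<Sum>v\<in>decr_lists n' ?lo. ?V a v) = chain_sum (vs a) c ?lo" "(\<Sum>u\<in>decr_lists j ?hi. ?U a u) = chain_sum (us a) c ?hi"
        by (simp_all only: chain_sum_def lus lvs)
      ultimately show "?g a * (?Y a) =
       ?g a * (?C a c)" by (simp only:)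
    qed
    finally show "(\<Sum>u\<in>decr_lists j ?hi. \<Sum>v\<in>decr_lists n' ?lo. \<Sum>p\<in>?P u v. G p (u @ c # v)) = \<dots>" .
  qed
  also have "\<dots> = (\<Sum>c\<le>N. \<Sum>a\<in>{0..<4}. ?g a * (?B a c))"
    unfolding sum_window
  proof (rule sum.cong[OF refl])
    fix c assume "c \<in> {..N}"
    then have c: "c \<le> N" by simp
    have 1: "nsum (rev (map reflect [?\<phi> a])) c = nsum [reflect (?\<phi> a)] c" for a by simp
    show "(\<Sum>a\<in>{0..<4}. ?g a * (?C a (int c))) =
     (\<Sum>a\<in>{0..<4}. ?g a * (?B a c))"
      by (simp only: chain_sum_window[OF c] 1)
  qed
  also have "\<dots> = (\<Sum>a\<in>{0..<4}. \<Sum>c\<le>N. ?g a * (?B a c))"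
    by (rule sum.swap)
  finally show ?thesis by (simp only: convol_def sum_distrib_left[symmetric] sum.distrib)
qed

section \<open>The parity relation\<close>

text \<open>There are p + 1 places for the extra letter; the remaining terms merge it with another
  letter and so have depth p. Quantifying over \<open>g\<close> states an equality of multisets of
  words without fixing their order.\<close>

lemma qshuffle_s_replicate:
  "\<exists>L. (\<forall>g::letter list \<Rightarrow> real. (\<Sum>ws\<leftarrow>qshuffle [s_letter] (replicate p s_letter). g ws) =
      (real p + 1) * g (replicate (Suc p) s_letter) + (\<Sum>ws\<leftarrow>L. g ws)) \<and>
     (\<forall>ws\<in>set L. list_all valid ws \<and> weight ws = Suc p \<and> length ws = p)"
proof (induction p)
  case 0 then show ?case by (intro exI[of _ "[]"]) simp
next
  case (Suc p)
  then obtain L where L: "\<And>g::letter list \<Rightarrow> real. (\<Sum>ws\<leftarrow>qshuffle [s_letter] (replicate p s_letter). g ws) =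
      (real p + 1) * g (replicate (Suc p) s_letter) + (\<Sum>ws\<leftarrow>L. g ws)"
     "\<forall>ws\<in>set L. list_all valid ws \<and> weight ws = Suc p \<and> length ws = p" by blast
  have rv: "list_all valid (replicate p s_letter)" "weight (replicate p s_letter) = p"
    by (simp_all add: list_all_iff weight_def sum_list_replicate) (simp add: s_letter_def)
  have "(\<Sum>ws\<leftarrow>qshuffle [s_letter] (replicate (Suc p) s_letter). g ws) =
      (real (Suc p) + 1) * g (replicate (Suc (Suc p)) s_letter) +
      (\<Sum>ws\<leftarrow>map ((#) s_letter) L @ [letter_mult s_letter s_letter # replicate p s_letter]. g ws)" for g :: "letter list \<Rightarrow> real"
    using L(1)[of "\<lambda>w. g (s_letter # w)"] by (simp add: o_def algebra_simps)
  moreover have "\<forall>ws\<in>set (map ((#) s_letter) L @ [letter_mult s_letter s_letter # replicate p s_letter]).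
      list_all valid ws \<and> weight ws = Suc (Suc p) \<and> length ws = Suc p"
    using L(2) rv by (auto simp: valid_mult) (simp_all add: s_letter_def)
  ultimately show ?case by blast
qed

lemma log_reg_E1_mult_esum: "\<exists>c. log_reg (Suc p) p (\<lambda>N. esum 1 N * esum p N - (real p + 1) * esum (Suc p) N) c"
proof -
  obtain L where L: "\<And>g::letter list \<Rightarrow> real. (\<Sum>ws\<leftarrow>qshuffle [s_letter] (replicate p s_letter). g ws) =
      (real p + 1) * g (replicate (Suc p) s_letter) + (\<Sum>ws\<leftarrow>L. g ws)"
     "\<forall>ws\<in>set L. list_all valid ws \<and> weight ws = Suc p \<and> length ws = p" using qshuffle_s_replicate by blast
  have "\<exists>c. log_reg (Suc p) p (\<lambda>N. \<Sum>ws\<leftarrow>L. nsum ws N) c"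
    using L(2) log_reg_valid by (intro log_reg_sum_list) metis
  moreover have "esum 1 N * esum p N - (real p + 1) * esum (Suc p) N = (\<Sum>ws\<leftarrow>L. nsum ws N)" for N
    using L(1)[of "\<lambda>ws. nsum ws N"] nsum_mult[of "[s_letter]" N "replicate p s_letter"] by (simp add: esum_def)
  ultimately show ?thesis by simp
qed

text \<open>The new constant has depth \<open>d\<close>, not \<open>d + 1\<close>. A constant times
  \<open>esum 1\<close> is a pure divergence with constant 0, and on \<open>esum p\<close> the
  leading part (p + 1) \<open>esum (Suc p)\<close> again has constant 0, so only merged words
  contribute.\<close>

lemma log_reg_E1_mult:
  assumes "log_reg w d a c" shows "\<exists>e\<in>val_span (Suc w) d. log_reg (Suc w) (Suc d) (\<lambda>N. esum 1 N * a N) e"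
  using assms
proof (induction rule: log_reg.induct)
  case (log_reg_decaying a)
  have "decaying (\<lambda>N. a N * esum 1 N)" by (rule decaying_mult_log_bdd[OF log_reg_decaying log_bdd_esum])
  then have "log_reg (Suc w) (Suc d) (\<lambda>N. esum 1 N * a N) 0" by (intro log_reg.log_reg_decaying) (simp add: mult.commute)
  then show ?case by (intro bexI[of _ 0]) simp_all
next
  case (log_reg_const x)
  have "log_reg (Suc w) (Suc d) (\<lambda>N. x * esum 1 N) 0" by (rule log_reg_esum) (use log_reg_const in auto)
  then show ?case by (intro bexI[of _ 0]) (simp_all add: mult.commute)
next
  case (log_reg_esum p x)
  obtain c where c: "log_reg (Suc p) p (\<lambda>N. esum 1 N * esum p N - (real p + 1) * esum (Suc p) N) c"
    using log_reg_E1_mult_esum by blast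
  have 1: "log_reg (Suc w) d (\<lambda>N. (esum 1 N * esum p N - (real p + 1) * esum (Suc p) N) * x) (c * x)"
    using log_reg_mult_const[OF c log_reg_esum(4)] log_reg_esum by simp
  have 2: "log_reg (Suc w) (Suc d) (\<lambda>N. ((real p + 1) * x) * esum (Suc p) N) 0"
    by (rule log_reg.log_reg_esum) (use log_reg_esum in \<open>auto intro!: val_span_scale\<close>)
  have "log_reg (Suc w) (Suc d) (\<lambda>N. esum 1 N * (x * esum p N)) (c * x + 0)"
    using log_reg_add[OF log_reg_mono[OF 1, of "Suc d"] 2] by (simp add: algebra_simps)
  then show ?case using log_reg_val_span[OF 1] by (intro bexI[of _ "c * x"]) simp_all
next
  case (log_reg_add a c b c')
  obtain e where e: "e \<in> val_span (Suc w) d" "log_reg (Suc w) (Suc d) (\<lambda>N. esum 1 N * a N) e" using log_reg_add.IH(1) by (elim bexE)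
  obtain e' where e': "e' \<in> val_span (Suc w) d" "log_reg (Suc w) (Suc d) (\<lambda>N. esum 1 N * b N) e'" using log_reg_add.IH(2) by (elim bexE)
  show ?case using log_reg.log_reg_add[OF e(2) e'(2)] val_span_add[OF e(1) e'(1)]
    by (intro bexI[of _ "e + e'"]) (simp_all add: distrib_left)
qed

text \<open>In weight and depth 1 the coefficient of the only possible divergence has weight 0,
  hence is rational.\<close>

lemma log_reg_1_1: "log_reg w d a c \<Longrightarrow> w = 1 \<Longrightarrow> d = 1 \<Longrightarrow> \<exists>\<alpha>\<in>\<rat>. decaying (\<lambda>N. a N - \<alpha> * esum 1 N - c)"
proof (induction rule: log_reg.induct)
  case (log_reg_decaying a) then show ?case by (intro bexI[of _ 0]) auto
next
  case (log_reg_const x) show ?case by (intro bexI[of _ 0]) auto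
next
  case (log_reg_esum p x)
  then have "p = 1" "x \<in> \<rat>" using val_span_00_Rats by auto
  then show ?case by (intro bexI[of _ x]) auto
next
  case (log_reg_add a c b c')
  then obtain \<alpha> \<beta> where *: "\<alpha> \<in> \<rat>" "\<beta> \<in> \<rat>" "decaying (\<lambda>N. a N - \<alpha> * esum 1 N - c)" "decaying (\<lambda>N. b N - \<beta> * esum 1 N - c')" by blast
  from decaying_add[OF *(3,4)] have "decaying (\<lambda>N. (a N + b N) - (\<alpha> + \<beta>) * esum 1 N - (c + c'))" by (simp add: algebra_simps)
  then show ?case using *(1,2) by (intro bexI[of _ "\<alpha> + \<beta>"]) simp_all
qed

lemma valid_residue_letter: "l \<ge> 1 \<Longrightarrow> valid (residue_letter l a)"
  by (simp add: valid_def residue_letter_def per4_def)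

text \<open>For exponent 1 this is the indicator of the class of a minus that of -a, an odd function
  modulo 4. It vanishes at 0 and 2 and takes opposite values at 1 and 3.\<close>

lemma anti_residue:
  assumes "a \<in> {0..<4}"
  shows "anti (\<lambda>m. 1 * snd (residue_letter 1 a) m + 1 * snd (reflect (residue_letter 1 a)) m)"
proof (rule antiI)
  show "per4 (\<lambda>m. 1 * snd (residue_letter 1 a) m + 1 * snd (reflect (residue_letter 1 a)) m)"
    using valid_residue_letter[of 1 a] valid_reflect[of "residue_letter 1 a"]
    by (intro per4_lin) (simp_all add: valid_def)
  have "a = 0 \<or> a = 1 \<or> a = 2 \<or> a = 3" using assms by (simp add: atLeastLessThan_iff) presburger
  then show "1 * snd (residue_letter 1 a) 2 + 1 * snd (reflect (residue_letter 1 a)) 2 =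
      - (1 * snd (residue_letter 1 a) 0 + 1 * snd (reflect (residue_letter 1 a)) 0)"
    "1 * snd (residue_letter 1 a) 3 + 1 * snd (reflect (residue_letter 1 a)) 3 =
      - (1 * snd (residue_letter 1 a) 1 + 1 * snd (reflect (residue_letter 1 a)) 1)"
    by (elim disjE; simp add: residue_letter_def reflect_def)+
qed

text \<open>
  For \<open>l = 1\<close> the point letter diverges on both sides of the centre, but its two halves add up to an
  odd function, hence to an admissible letter, and the divergent parts cancel up to lower depth.
\<close>

lemma conv_reg_term:
  assumes us: "adm_word us" and nv: "list_all valid nv" and l: "l \<ge> 1" and a: "a \<in> {0..<4}"
    and n: "length us + length nv \<ge> 1"
    and M1: "log_reg (l + weight us) (length us) m1 c1" and M2: "log_reg (l + weight nv) (length nv) m2 c2"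
  shows "\<exists>c\<in>low_span (l + weight us + weight nv) (Suc (length us + length nv)).
    conv_reg (\<lambda>N. convol (\<lambda>n. nsum [residue_letter l a] n * nsum us n - m1 n) (nsum nv) N +
              convol (nsum us) (\<lambda>n. nsum [reflect (residue_letter l a)] n * nsum nv n - m2 n) N) c"
proof -
  define \<phi> where "\<phi> = residue_letter l a"
  define w1 w2 d1 d2 where "w1 = weight us" "w2 = weight nv" "d1 = length us" "d2 = length nv"
  note defs = this
  let ?Z = "\<lambda>N. convol (\<lambda>n. nsum [\<phi>] n * nsum us n - m1 n) (nsum nv) N + convol (nsum us) (\<lambda>n. nsum [reflect \<phi>] n * nsum nv n - m2 n) N"
  let ?w = "l + w1 + w2" and ?r = "Suc (d1 + d2)"
  have v\<phi>: "valid \<phi>" "valid (reflect \<phi>)" "fst \<phi> = l"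
    using valid_residue_letter[OF l] valid_reflect by (auto simp: \<phi>_def residue_letter_def)
  have LU: "log_reg w1 d1 (nsum us) (wval us)" using log_reg_wval[OF us] by (simp add: defs)
  obtain c where LV: "log_reg w2 d2 (nsum nv) c" using log_reg_valid[OF nv] by (auto simp: defs)
  have UW: "wval us \<in> val_span w1 d1" and VW: "c \<in> val_span w2 d2" using log_reg_val_span[OF LU] log_reg_val_span[OF LV] .
  have m1: "log_reg (l + w1) d1 m1 c1" and m2: "log_reg (l + w2) d2 m2 c2" using M1 M2 by (simp_all add: defs)
  have m1W: "c1 \<in> val_span (l + w1) d1" and m2W: "c2 \<in> val_span (l + w2) d2" using log_reg_val_span[OF m1] log_reg_val_span[OF m2] .
  have pos: "w1 + w2 > 0" "d1 + d2 > 0"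
  proof -
    have ne: "us \<noteq> [] \<or> nv \<noteq> []"
    proof (rule ccontr)
      assume "\<not> (us \<noteq> [] \<or> nv \<noteq> [])"
      then have "us = []" "nv = []" by blast+
      with n show False by simp
    qed
    have "list_all valid us" using us by (simp add: adm_word_def)
    then show "w1 + w2 > 0" using ne valid_weight_pos[of us] valid_weight_pos[OF nv]
      unfolding defs by (metis add_gr_0)
    show "d1 + d2 > 0" using n unfolding defs by linarith
  qed
  have low1: "c1 * c \<in> low_span ?w ?r"
    using val_span_mult[OF m1W VW] pos by (intro low_span_val_span[of _ _ "d1 + d2"]) (auto simp: add_ac)
  have low2: "wval us * x \<in> low_span ?w ?r" if "x \<in> val_span (l + w2) d2" for x
    using val_span_mult[OF UW that] pos by (intro low_span_val_span[of _ _ "d1 + d2"]) (auto simp: add_ac)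
  have low3: "(wval us * c) * x \<in> low_span ?w ?r" if "x \<in> val_span l 1" for x
    by (rule low_span_mult[OF val_span_mult[OF UW VW] that]) (use l pos in auto)
  have adm_letter: "\<exists>y\<in>val_span l 1. decaying (\<lambda>N. nsum [b] N - y)" if "valid b" "adm b" "fst b = l" for b
    using that decaying_wval[of "[b]"] val_span_wval[of "[b]" l 1] by (auto simp: adm_word_def)
  show ?thesis unfolding \<phi>_def[symmetric] defs[symmetric]
  proof (cases "l \<ge> 2")
    case True
    then have "adm \<phi>" "adm (reflect \<phi>)" using v\<phi> by (simp_all add: adm_def)
    then obtain y y' where y: "y \<in> val_span l 1" "decaying (\<lambda>N. nsum [\<phi>] N - y)" "y' \<in> val_span l 1" "decaying (\<lambda>N. nsum [reflect \<phi>] N - y')"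
      using adm_letter[of \<phi>] adm_letter[of "reflect \<phi>"] v\<phi> by auto
    have 1: "log_reg (w1 + l) (d1 + 1) (\<lambda>n. nsum us n * nsum [\<phi>] n - m1 n) (wval us * y - c1)"
      by (rule log_reg_diff[OF log_reg_mult_conv[OF LU y(2,1)]]) (use log_reg_mono[OF m1, of "d1 + 1"] in \<open>simp add: add.commute\<close>)
    have 2: "log_reg (w2 + l) (d2 + 1) (\<lambda>n. nsum nv n * nsum [reflect \<phi>] n - m2 n) (c * y' - c2)"
      by (rule log_reg_diff[OF log_reg_mult_conv[OF LV y(4,3)]]) (use log_reg_mono[OF m2, of "d2 + 1"] in \<open>simp add: add.commute\<close>)
    have cr: "conv_reg ?Z
       ((wval us * y - c1) * c + wval us * (c * y' - c2))"
      using conv_reg_add[OF conv_reg_convol[OF 1 LV] conv_reg_convol[OF LU 2]] by (simp add: mult.commute)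
    have eq: "(wval us * y - c1) * c + wval us * (c * y' - c2) =
        (wval us * c) * y - c1 * c + (wval us * c) * y' - wval us * c2" by (simp add: algebra_simps)
    have mem: "(wval us * c) * y - c1 * c + (wval us * c) * y' - wval us * c2 \<in> low_span ?w ?r"
      using m2W y by (intro low_span_add low_span_diff low1 low2 low3)
    show "\<exists>c\<in>low_span ?w ?r. conv_reg ?Z c"
      by (rule bexI[OF _ mem[folded eq]]) (rule cr)
  next
    case False
    then have l1: "l = 1" using l by simp
    define \<omega> where "\<omega> = (1::nat, \<lambda>m. 1 * snd \<phi> m + 1 * snd (reflect \<phi>) m)"
    have "per4 (snd \<omega>)" using v\<phi> unfolding \<omega>_def snd_conv by (intro per4_lin) (auto simp: valid_def)
    moreover have "anti (snd \<omega>)" using anti_residue[OF a] by (simp add: \<omega>_def \<phi>_def l1)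
    ultimately obtain z where z: "z \<in> val_span l 1" "decaying (\<lambda>N. nsum [\<omega>] N - z)"
      using adm_letter[of \<omega>] by (auto simp: valid_def adm_def \<omega>_def l1)
    have reflect_eq: "nsum [reflect \<phi>] N = nsum [\<omega>] N - nsum [\<phi>] N" for N
    proof -
      have "(1, snd \<phi>) = \<phi>" "(1, snd (reflect \<phi>)) = reflect \<phi>" using v\<phi>(3) l1 by (auto simp: prod_eq_iff)
      then show ?thesis using nsum_linear[of "[]" 1 1 "snd \<phi>" 1 "snd (reflect \<phi>)" "[]" N] by (simp add: \<omega>_def)
    qed
    obtain \<beta> where \<beta>: "log_reg 1 1 (nsum [\<phi>]) \<beta>" using log_reg_valid[of "[\<phi>]"] v\<phi> l1 by auto
    obtain \<alpha> where \<alpha>: "\<alpha> \<in> \<rat>" "decaying (\<lambda>N. nsum [\<phi>] N - \<alpha> * esum 1 N - \<beta>)" using log_reg_1_1[OF \<beta>] by auto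
    \<comment> \<open>This constant has depth \<open>d2\<close> only, so
      \<open>wval us * (\<alpha> * e)\<close> has depth at most \<open>d1 + d2\<close>, one less
      than the total.\<close>
    obtain e where e: "e \<in> val_span (Suc w2) d2" "log_reg (Suc w2) (Suc d2) (\<lambda>N. esum 1 N * nsum nv N) e" using log_reg_E1_mult[OF LV] by blast
    have 1: "log_reg (1 + w1) (1 + d1) (\<lambda>n. nsum [\<phi>] n * nsum us n - m1 n) (\<beta> * wval us - c1)"
      by (rule log_reg_diff[OF log_reg_mult_conv[OF \<beta> decaying_wval[OF us] UW]]) (use log_reg_mono[OF m1, of "1 + d1"] l1 in simp)
    have "log_reg (w2 + 1) (d2 + 1) (\<lambda>n. nsum nv n * nsum [\<omega>] n - (\<alpha> * (esum 1 n * nsum nv n) + nsum nv n * (nsum [\<phi>] n - \<alpha> * esum 1 n)) - m2 n)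
        (c * z - (\<alpha> * e + c * \<beta>) - c2)"
      using e(2) log_reg_mono[OF m2, of "d2 + 1"] l1 log_reg_val_span[OF \<beta>]
      by (intro log_reg_diff log_reg_add log_reg_scale log_reg_mult_conv[OF LV] z(2)[unfolded l1] z(1)[unfolded l1] \<alpha>) auto
    then have 2: "log_reg (w2 + 1) (d2 + 1) (\<lambda>n. nsum [reflect \<phi>] n * nsum nv n - m2 n) (c * z - (\<alpha> * e + c * \<beta>) - c2)"
      by (simp add: reflect_eq algebra_simps)
    have cr: "conv_reg ?Z
       ((\<beta> * wval us - c1) * c + wval us * (c * z - (\<alpha> * e + c * \<beta>) - c2))"
      by (rule conv_reg_add[OF conv_reg_convol[OF 1 LV] conv_reg_convol[OF LU 2]])
    \<comment> \<open>The contributions of \<beta> from the two sides cancel.\<close>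
    have eq: "(\<beta> * wval us - c1) * c + wval us * (c * z - (\<alpha> * e + c * \<beta>) - c2) =
        (wval us * c) * z - c1 * c - wval us * (\<alpha> * e) - wval us * c2" by (simp add: algebra_simps)
    have mem: "(wval us * c) * z - c1 * c - wval us * (\<alpha> * e) - wval us * c2 \<in> low_span ?w ?r"
      using m2W e(1) \<alpha>(1) l1 by (intro low_span_diff low1 low2 low3 z(1) val_span_scale) auto
    show "\<exists>c\<in>low_span ?w ?r. conv_reg ?Z c"
      by (rule bexI[OF _ mem[folded eq]]) (rule cr)
  qed
qed

lemma merges_props:
  assumes "w \<in> set (merges a us)" "valid a" "list_all valid us"
  shows "list_all valid w \<and> weight w = fst a + weight us \<and> length w = length us"
proof -
  obtain i where i: "i < length us" "w = us[i := letter_mult a (us ! i)]" using assms(1) by (auto simp: merges_def)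
  have "us = take i us @ us ! i # drop (Suc i) us" using i by (simp add: id_take_nth_drop)
  then have "weight us = weight (take i us) + (fst (us ! i) + weight (drop (Suc i) us))"
    by (metis weight_simps(2,3))
  then have "weight w = fst a + weight us" using i by (simp add: upd_conv_take_nth_drop)
  moreover have "list_all valid w"
    using i assms(2,3) by (auto simp: list_all_length nth_list_update valid_mult)
  ultimately show ?thesis using i by simp
qed

lemma weight_map_reflect [simp]: "weight (map reflect ws) = weight ws"
  by (simp add: weight_def o_def)

text \<open>A centred term consists of independent factors: the letter of p, the word above and the
  word below the centre. As the length is at least 2, one of the words is non-empty, so constants
  without a merge are products of positive depths.\<close>

lemma star_conv_reg:
  assumes "star (length ws) (\<lambda>i. fst (ws ! i)) w F" "adm_word ws" "length ws \<ge> 2"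
  shows "\<exists>c\<in>low_span w (length ws). conv_reg (window_sum ws F) c"
  using assms(1)
proof (induction rule: star.induct)
  case star_0
  have "window_sum ws (\<lambda>_. 0) = (\<lambda>_. 0)" by (simp add: window_sum_def fun_eq_iff)
  then show ?case using conv_reg_0 by (intro bexI[of _ 0]) simp_all
next
  case (star_add F G)
  then obtain c c' where c: "c \<in> low_span w (length ws)" "c' \<in> low_span w (length ws)"
     "conv_reg (window_sum ws F) c" "conv_reg (window_sum ws G) c'" by blast
  have "window_sum ws (\<lambda>x. F x + G x) = (\<lambda>N. window_sum ws F N + window_sum ws G N)"
    by (simp add: window_sum_def fun_eq_iff distrib_left sum.distrib)
  then show ?case using conv_reg_add[OF c(3,4)] low_span_add[OF c(1,2)] by metis
next
  case (star_term j l es q)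
  define us where "us = (\<lambda>a. map (\<lambda>i. shift_letter (snd (ws ! i)) (es i) a) [0..<j])"
  define vs where "vs = (\<lambda>a. map (\<lambda>i. shift_letter (snd (ws ! i)) (es i) a) [Suc j..<length ws])"
  let ?r = "length ws"
  have v: "list_all valid ws" using assms(2) by (simp add: adm_word_def)
  have vws: "valid (ws ! i)" if "i < ?r" for i using v that by (simp add: list_all_length)
  have per: "per4 (\<lambda>m. g (m - a))" if "per4 g" for g a
    using per4_shift[OF that, of "- a"] by simp
  have vsh: "valid (shift_letter (snd (ws ! i)) (es i) a)" if "i < ?r" "i \<noteq> j" for i a
    using vws[OF that(1)] star_term(3)[OF that] per by (auto simp: valid_def shift_letter_def)
  have vu: "list_all valid (us a)" and vv: "list_all valid (vs a)" for a
    using vsh star_term(1) by (auto simp: us_def vs_def list_all_iff)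
  \<comment> \<open>Exponents away from the centre never fall below the original ones and
    translation preserves antiperiodicity, so the word above the centre inherits an admissible
    head.\<close>
  have au: "adm_word (us a)" for a
  proof (cases "j = 0")
    case True then show ?thesis by (simp add: us_def adm_word_def)
  next
    case False
    then have hd: "hd (us a) = shift_letter (snd (ws ! 0)) (es 0) a" by (simp add: us_def hd_map upt_conv_Cons)
    have "ws \<noteq> []" using assms(3) by auto
    then have "adm (ws ! 0)" using assms(2) by (simp add: adm_word_def hd_conv_nth)
    moreover have "fst (ws ! 0) \<le> es 0" using star_term(3)[of 0] False \<open>ws \<noteq> []\<close> by simp
    ultimately have "adm (hd (us a))" unfolding hd
      by (auto simp: adm_def shift_letter_def anti_def algebra_simps) (metis add.commute add_diff_eq diff_add_eq)
    then show ?thesis using vu by (simp add: adm_word_def)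
  qed
  have len: "length (us a) = j" "length (vs a) = ?r - Suc j" for a by (simp_all add: us_def vs_def)
  have wt: "l + weight (us a) + weight (vs a) = w" for a
  proof -
    have "weight (us a) = (\<Sum>i\<in>{..<j}. es i)"
      by (simp add: weight_def us_def o_def shift_letter_def interv_sum_list_conv_sum_set_nat lessThan_atLeast0)
    moreover have "weight (vs a) = (\<Sum>i\<in>{Suc j..<?r}. es i)"
      by (simp add: weight_def vs_def o_def shift_letter_def interv_sum_list_conv_sum_set_nat)
    moreover have "{..<?r} - {j} = {..<j} \<union> {Suc j..<?r}" using star_term(1) by auto
    moreover have "sum es ({..<j} \<union> {Suc j..<?r}) = sum es {..<j} + sum es {Suc j..<?r}"
      by (rule sum.union_disjoint) auto
    ultimately show ?thesis using star_term(4) by simp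
  qed
  let ?\<phi> = "residue_letter l"
  have v\<phi>: "valid (?\<phi> a)" "fst (?\<phi> a) = l" for a using valid_residue_letter[OF star_term(2)] by (auto simp: residue_letter_def)
  let ?Z = "\<lambda>a N. convol (\<lambda>n. nsum [?\<phi> a] n * nsum (us a) n - (\<Sum>w\<leftarrow>merges (?\<phi> a) (us a). nsum w n)) (nsum (rev (map reflect (vs a)))) N +
       convol (nsum (us a)) (\<lambda>n. nsum [reflect (?\<phi> a)] n * nsum (rev (map reflect (vs a))) n - (\<Sum>w\<leftarrow>merges (?\<phi> a) (vs a). nsum (rev (map reflect w)) n)) N"
  have Z: "\<exists>c\<in>low_span w ?r. conv_reg (?Z a) c" if a: "a \<in> {0..<4}" for a
  proof -
    have "\<exists>c. log_reg (l + weight (us a)) (length (us a)) (\<lambda>n. \<Sum>w\<leftarrow>merges (?\<phi> a) (us a). nsum w n) c"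
    proof (rule log_reg_sum_list)
      fix u assume "u \<in> set (merges (?\<phi> a) (us a))"
      from merges_props[OF this v\<phi>(1) vu] show "\<exists>c. log_reg (l + weight (us a)) (length (us a)) (nsum u) c"
        using log_reg_valid[of u] v\<phi> by auto
    qed
    then obtain c1 where c1: "log_reg (l + weight (us a)) (length (us a)) (\<lambda>n. \<Sum>w\<leftarrow>merges (?\<phi> a) (us a). nsum w n) c1" ..
    let ?nv = "rev (map reflect (vs a))"
    have nv: "list_all valid ?nv" "weight ?nv = weight (vs a)" "length ?nv = length (vs a)"
      using vv[of a] by (auto simp: list_all_iff valid_reflect)
    have "\<exists>c. log_reg (l + weight ?nv) (length ?nv) (\<lambda>n. \<Sum>w\<leftarrow>merges (?\<phi> a) (vs a). nsum (rev (map reflect w)) n) c"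
    proof (rule log_reg_sum_list)
      fix u assume "u \<in> set (merges (?\<phi> a) (vs a))"
      from merges_props[OF this v\<phi>(1) vv]
      have u: "list_all valid u" "weight u = l + weight (vs a)" "length u = length (vs a)" using v\<phi> by auto
      have "list_all valid (rev (map reflect u))" using u(1) by (auto simp: list_all_iff valid_reflect)
      from log_reg_valid[OF this] show "\<exists>c. log_reg (l + weight ?nv) (length ?nv) (nsum (rev (map reflect u))) c"
        using u by simp
    qed
    then obtain c2 where c2: "log_reg (l + weight ?nv) (length ?nv) (\<lambda>n. \<Sum>w\<leftarrow>merges (?\<phi> a) (vs a). nsum (rev (map reflect w)) n) c2" ..
    have n1: "length (us a) + length ?nv \<ge> 1" using len assms(3) star_term(1) by simp
    have "l + weight (us a) + weight ?nv = w" "Suc (length (us a) + length ?nv) = ?r"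
      using wt[of a] len[of a] star_term(1) by simp_all
    then show ?thesis using conv_reg_term[OF au nv(1) star_term(2) a n1 c1 c2] by simp
  qed
  then have "\<forall>a\<in>{0..<4}. \<exists>c. c \<in> low_span w ?r \<and> conv_reg (?Z a) c" by blast
  then obtain cz where "\<forall>a\<in>{0..<4}. cz a \<in> low_span w ?r \<and> conv_reg (?Z a) (cz a)" using bchoice by meson
  then have cz: "\<And>a. a \<in> {0..<4} \<Longrightarrow> cz a \<in> low_span w ?r" "\<And>a. a \<in> {0..<4} \<Longrightarrow> conv_reg (?Z a) (cz a)" by blast+
  let ?q = "\<lambda>a. q * (-1) ^ l * snd (ws ! j) (- a)"
  have "conv_reg (\<lambda>N. \<Sum>a\<in>{0..<4}. ?q a * ?Z a N) (\<Sum>a\<in>{0..<4}. ?q a * cz a)"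
    by (intro conv_reg_sum conv_reg_scale cz(2)) auto
  moreover have "window_sum ws (\<lambda>x. q * (1 / x j ^ l * (\<Prod>i\<in>{..<?r} - {j}. 1 / (x i - x j) ^ es i))) =
     (\<lambda>N. \<Sum>a\<in>{0..<4}. ?q a * ?Z a N)"
    unfolding us_def vs_def by (rule ext) (rule window_sum_centred_at_entry[OF star_term(1) v])
  moreover have "(\<Sum>a\<in>{0..<4}. ?q a * cz a) \<in> low_span w ?r"
    using cz(1) star_term(5) vws[OF star_term(1)] by (intro low_span_sum low_span_scale) (auto simp: valid_def per4_def)
  ultimately show ?case by auto
qed

text \<open>Both evaluations of the window sum are compared through \<open>conv_reg_unique\<close>.
  The one centred at entries has its constant in \<open>low_span\<close>; the one centred at p has
  the extreme terms \<open>wval ws\<close> and \<open>c0\<close>, while all others are products. Any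
  regularization \<open>c0\<close> is accepted, so that the one from the antipode can be
  inserted.\<close>

lemma parity_reversal:
  assumes ws: "adm_word ws" "length ws \<ge> 2"
    and c0: "log_reg (weight ws) (length ws) (nsum (rev (map reflect ws))) c0"
  shows "wval ws + c0 \<in> low_span (weight ws) (length ws)"
proof -
  let ?r = "length ws" and ?w = "weight ws"
  have v: "list_all valid ws" using ws(1) by (simp add: adm_word_def)
  obtain F where F: "star ?r (\<lambda>i. fst (ws ! i)) (\<Sum>i<?r. fst (ws ! i)) F"
    "\<And>x. generic ?r x \<Longrightarrow> (\<Prod>i<?r. 1 / x i ^ fst (ws ! i)) = F x"
    using partial_fraction[of ?r "\<lambda>i. fst (ws ! i)"] ws(2) v by (auto simp: list_all_length valid_def)
  have w: "(\<Sum>i<?r. fst (ws ! i)) = ?w"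
    by (simp add: weight_def sum_list_sum_nth lessThan_atLeast0)
  obtain c where c: "c \<in> low_span ?w ?r" "conv_reg (window_sum ws F) c"
    using star_conv_reg[OF F(1) ws] unfolding w by blast
  have "window_sum ws F N = window_sum ws (\<lambda>x. \<Prod>i<?r. 1 / x i ^ fst (ws ! i)) N" for N
    unfolding window_sum_def
  proof (intro sum.cong refl)
    fix p m assume m: "m \<in> decr_lists ?r ({0..int N} - {p})"
    then have s: "length m = ?r" "sorted_wrt (>) m" "p \<notin> set m" by (auto simp: decr_lists_def)
    have d: "distinct m" using s(2) by (induction m) auto
    have "generic ?r (\<lambda>i. real_of_int (m ! i - p))"
      using s d by (auto simp: generic_def inj_on_def nth_eq_iff_index_eq)
    then show "(\<Prod>i<?r. snd (ws ! i) (m ! i - p)) * F (\<lambda>i. real_of_int (m ! i - p)) =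
      (\<Prod>i<?r. snd (ws ! i) (m ! i - p)) * (\<Prod>i<?r. 1 / real_of_int (m ! i - p) ^ fst (ws ! i))"
      using F(2) by simp
  qed
  then have eq: "window_sum ws F = (\<lambda>N. \<Sum>i\<le>?r. convol (nsum (take i ws)) (nsum (rev (map reflect (drop i ws)))) N)"
    by (simp add: window_sum_centred_at_point fun_eq_iff)
  note adm_take = adm_word_take[OF ws(1)]
  have "\<exists>c. log_reg (weight (drop i ws)) (?r - i) (nsum (rev (map reflect (drop i ws)))) c" for i
  proof -
    have "list_all valid (rev (map reflect (drop i ws)))"
      using v by (auto simp: list_all_iff valid_reflect dest: in_set_dropD)
    from log_reg_valid[OF this] show ?thesis by simp
  qed
  then obtain cd' where cd': "\<And>i. log_reg (weight (drop i ws)) (?r - i) (nsum (rev (map reflect (drop i ws)))) (cd' i)" by metis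
  \<comment> \<open>The constants chosen so far are arbitrary witnesses. At the ends they are
    replaced by the prescribed \<open>c0\<close> and by 1, the constant of the empty word.\<close>
  define cd where "cd = cd'(0 := c0, ?r := 1)"
  have cd: "log_reg (weight (drop i ws)) (?r - i) (nsum (rev (map reflect (drop i ws)))) (cd i)" for i
  proof -
    have "log_reg 0 0 (nsum []) 1" using log_reg_wval[of "[]"] by (simp add: adm_word_def)
    then show ?thesis using cd'[of i] c0 ws(2) by (auto simp: cd_def)
  qed
  have cd0: "cd 0 = c0" "cd ?r = 1" using ws(2) by (auto simp: cd_def)
  have "conv_reg (window_sum ws F) (\<Sum>i\<le>?r. wval (take i ws) * cd i)"
    unfolding eq by (intro conv_reg_sum conv_reg_convol[OF log_reg_wval[OF adm_take] cd]) auto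
  with c(2) have "c = (\<Sum>i\<le>?r. wval (take i ws) * cd i)" by (rule conv_reg_unique)
  also have "{..?r} = insert 0 (insert ?r {1..<?r})" using ws(2) by auto
  also have "(\<Sum>i\<in>insert 0 (insert ?r {1..<?r}). wval (take i ws) * cd i) =
     c0 + (wval ws + (\<Sum>i\<in>{1..<?r}. wval (take i ws) * cd i))"
  proof -
    have "ws \<noteq> []" using ws(2) by auto
    then show ?thesis by (simp add: cd0)
  qed
  finally have "wval ws + c0 = c - (\<Sum>i\<in>{1..<?r}. wval (take i ws) * cd i)" by simp
  moreover have "(\<Sum>i\<in>{1..<?r}. wval (take i ws) * cd i) \<in> low_span ?w ?r"
  proof (rule low_span_sum)
    fix i assume i: "i \<in> {1..<?r}"
    have wsum: "weight (take i ws) + weight (drop i ws) = ?w" by (metis append_take_drop_id weight_simps(3))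
    have pos: "weight (take i ws) > 0" "weight (drop i ws) > 0"
    proof -
      have "list_all valid (take i ws)" "list_all valid (drop i ws)"
        using v by (metis append_take_drop_id list_all_append)+
      then show "weight (take i ws) > 0" "weight (drop i ws) > 0"
        using i by (auto intro!: valid_weight_pos)
    qed
    show "wval (take i ws) * cd i \<in> low_span ?w ?r"
      by (rule low_span_mult[OF val_span_wval[OF adm_take refl order.refl] log_reg_val_span[OF cd] wsum _ pos]) (use i in auto)
  qed
  ultimately show ?thesis using low_span_diff[OF c(1)] by simp
qed

section \<open>Alternating multiple mixed values\<close>

text \<open>The character of \<open>ammv_factor\<close>, extended to all integers because reflection
  evaluates it at -m.\<close>

definition sgn_char :: "int \<Rightarrow> int \<Rightarrow> int \<Rightarrow> real" where
  "sgn_char \<sigma> \<epsilon> m = (1 + of_int \<epsilon> * (if even m then 1 else -1)) * of_int \<sigma> powi ((2 * m + 1 - \<epsilon>) div 4)"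

lemma minus_one_powi: "(-1 :: real) powi n = (if even n then 1 else -1)"
  by (simp add: power_int_def minus_one_power_iff even_nat_iff)

text \<open>Both m / 2 for even m and (m + 1) / 2 for odd m are even exactly when m is 0 or 3 modulo
  4.\<close>

lemma sgn_char_eq:
  assumes "\<sigma> \<in> {1, -1}" "\<epsilon> \<in> {1, -1}"
  shows "sgn_char \<sigma> \<epsilon> m = (if even m \<longleftrightarrow> \<epsilon> = 1 then 2 * (if \<sigma> = 1 \<or> m mod 4 = 0 \<or> m mod 4 = 3 then 1 else -1) else 0)"
proof -
  have e: "even m \<Longrightarrow> (2 * m + 1 - 1) div 4 = m div 2" by presburger
  have o: "odd m \<Longrightarrow> (2 * m + 1 - (-1)) div 4 = (m + 1) div 2" by presburger
  have e': "even m \<Longrightarrow> even (m div 2) \<longleftrightarrow> m mod 4 = 0 \<or> m mod 4 = 3" by presburger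
  have o': "odd m \<Longrightarrow> even ((m + 1) div 2) \<longleftrightarrow> m mod 4 = 0 \<or> m mod 4 = 3" by presburger
  show ?thesis
  proof (cases "even m")
    case True then show ?thesis using assms e e' by (auto simp: sgn_char_def minus_one_powi)
  next
    case False then show ?thesis using assms o o' by (auto simp: sgn_char_def minus_one_powi)
  qed
qed

lemma per4_sgn_char: assumes "\<sigma> \<in> {1, -1}" "\<epsilon> \<in> {1, -1}" shows "per4 (sgn_char \<sigma> \<epsilon>)"
  unfolding per4_def sgn_char_eq[OF assms] by simp

text \<open>So \<open>iota\<close> is the parity of the character. Negation fixes the residues 0 and
  2 and exchanges 1 and 3, which matters only for \<sigma> = \<epsilon> = -1, twice the negative of
  the odd character modulo 4.\<close>

lemma sgn_char_uminus:
  assumes "\<sigma> \<in> {1, -1}" "\<epsilon> \<in> {1, -1}"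
  shows "sgn_char \<sigma> \<epsilon> (- m) = of_int (iota \<sigma> \<epsilon>) * sgn_char \<sigma> \<epsilon> m"
proof -
  have "m mod 4 \<in> {0,1,2,3}" by auto
  moreover have "(- m) mod 4 = (- (m mod 4)) mod 4" by (simp add: mod_minus_eq)
  moreover have "even m \<longleftrightarrow> m mod 4 = 0 \<or> m mod 4 = 2" by presburger
  ultimately show ?thesis unfolding sgn_char_eq[OF assms] iota_def using assms by auto
qed

lemma anti_sgn_char: assumes "\<epsilon> \<in> {1, -1}" shows "anti (sgn_char (-1) \<epsilon>)"
  by (rule antiI) (use assms in \<open>auto intro!: per4_sgn_char simp: sgn_char_eq\<close>)

definition sgn_word :: "nat list \<Rightarrow> int list \<Rightarrow> int list \<Rightarrow> letter list" where
  "sgn_word k \<sigma> \<epsilon> = map (\<lambda>j. (k ! j, sgn_char (\<sigma> ! j) (\<epsilon> ! j))) [0..<length k]"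

lemma length_sgn_word [simp]: "length (sgn_word k \<sigma> \<epsilon>) = length k"
  by (simp add: sgn_word_def)

lemma weight_sgn_word: "weight (sgn_word k \<sigma> \<epsilon>) = sum_list k"
  by (simp add: weight_def sgn_word_def o_def map_nth)

lemma ammv_factor_eq: "ammv_factor k \<sigma> \<epsilon> m = letter_fun (k, sgn_char \<sigma> \<epsilon>) (int m)"
proof -
  have "(-1 :: real) ^ m = (if even m then 1 else -1)" by simp
  then show ?thesis by (simp add: ammv_factor_def letter_fun_def sgn_char_def)
qed

lemma sum_decr_lists_nsum:
  "(\<Sum>m\<in>decr_lists (length ws) {1..N}. \<Prod>j<length ws. letter_fun (ws ! j) (int (m ! j))) = nsum ws N"
proof (induction ws arbitrary: N)
  case (Cons a ws)
  have "(\<Sum>m\<in>decr_lists (length (a # ws)) {1..N}. \<Prod>j<length (a # ws). letter_fun ((a # ws) ! j) (int (m ! j))) =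
     (\<Sum>x\<in>{1..N}. \<Sum>m\<in>decr_lists (length ws) {y\<in>{1..N}. y < x}. letter_fun a (int x) * (\<Prod>j<length ws. letter_fun (ws ! j) (int (m ! j))))"
    by (simp add: sum_decr_lists_Suc prod.lessThan_Suc_shift del: prod.lessThan_Suc)
  also have "\<dots> = (\<Sum>x\<in>{1..N}. letter_fun a (int x) * nsum ws (x - 1))"
  proof (rule sum.cong[OF refl])
    fix x assume "x \<in> {1..N}"
    then have "{y\<in>{1..N}. y < x} = {1..x - 1}" by auto
    then show "(\<Sum>m\<in>decr_lists (length ws) {y\<in>{1..N}. y < x}. letter_fun a (int x) * (\<Prod>j<length ws. letter_fun (ws ! j) (int (m ! j)))) =
      letter_fun a (int x) * nsum ws (x - 1)" by (simp only: sum_distrib_left[symmetric] Cons)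
  qed
  finally show ?case by (simp add: nsum.simps)
qed simp

lemma ammv_partial_eq: "ammv_partial k \<sigma> \<epsilon> = nsum (sgn_word k \<sigma> \<epsilon>)"
proof
  fix N
  have "ammv_partial k \<sigma> \<epsilon> N = (\<Sum>m\<in>decr_lists (length (sgn_word k \<sigma> \<epsilon>)) {1..N}.
      \<Prod>j<length (sgn_word k \<sigma> \<epsilon>). letter_fun (sgn_word k \<sigma> \<epsilon> ! j) (int (m ! j)))"
    unfolding ammv_partial_def decr_lists_def length_sgn_word
    by (intro sum.cong prod.cong refl) (simp add: ammv_factor_eq sgn_word_def)
  then show "ammv_partial k \<sigma> \<epsilon> N = nsum (sgn_word k \<sigma> \<epsilon>) N" by (simp only: sum_decr_lists_nsum)
qed

lemma ammv_eq: "ammv k \<sigma> \<epsilon> = wval (sgn_word k \<sigma> \<epsilon>)"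
  by (simp add: ammv_def wval_def ammv_partial_eq)

lemma valid_sgn_word:
  assumes "length \<sigma> = length k" "length \<epsilon> = length k" "\<forall>x\<in>set k. x > 0" "set \<sigma> \<subseteq> {1, -1}" "set \<epsilon> \<subseteq> {1, -1}"
  shows "list_all valid (sgn_word k \<sigma> \<epsilon>)"
proof -
  have "per4 (sgn_char (\<sigma> ! j) (\<epsilon> ! j))" "k ! j \<ge> 1" if "j < length k" for j
    using assms that by (auto intro!: per4_sgn_char simp: Suc_le_eq) (metis insertE nth_mem singletonD subsetD)+
  then show ?thesis by (auto simp: list_all_iff sgn_word_def valid_def)
qed

lemma adm_word_sgn_word:
  assumes "admissible k \<sigma> \<epsilon>" shows "adm_word (sgn_word k \<sigma> \<epsilon>)"
proof -
  have v: "list_all valid (sgn_word k \<sigma> \<epsilon>)" using assms by (intro valid_sgn_word) (auto simp: admissible_def)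
  have k: "k \<noteq> []" "length \<sigma> = length k" "length \<epsilon> = length k" using assms by (auto simp: admissible_def)
  then have "hd (sgn_word k \<sigma> \<epsilon>) = (k ! 0, sgn_char (\<sigma> ! 0) (\<epsilon> ! 0))" by (simp add: sgn_word_def hd_map upt_conv_Cons)
  moreover have "adm (k ! 0, sgn_char (\<sigma> ! 0) (\<epsilon> ! 0))"
  proof (cases "k ! 0 \<ge> 2")
    case False
    have "k ! 0 \<in> set k" "\<sigma> ! 0 \<in> set \<sigma>" "\<epsilon> ! 0 \<in> set \<epsilon>" using k by auto
    then have *: "k ! 0 > 0" "\<sigma> ! 0 \<in> {1, -1}" "\<epsilon> ! 0 \<in> {1, -1}" using assms unfolding admissible_def by blast+
    then have "k ! 0 = 1" using False by simp
    then have "\<sigma> ! 0 = -1" using assms * by (auto simp: admissible_def)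
    then show ?thesis using anti_sgn_char[OF *(3)] by (simp add: adm_def)
  qed (simp add: adm_def)
  ultimately show ?thesis using v by (simp add: adm_word_def)
qed

section \<open>Admissible words as rational combinations of mixed values\<close>

lemma AMMV_add: "x \<in> AMMV w d \<Longrightarrow> y \<in> AMMV w d \<Longrightarrow> x + y \<in> AMMV w d"
  by (simp add: AMMV_def real_rat.span_add)

lemma AMMV_scale: "q \<in> \<rat> \<Longrightarrow> x \<in> AMMV w d \<Longrightarrow> q * x \<in> AMMV w d"
  by (auto simp: AMMV_def Rats_def intro: real_rat.span_scale)

lemma wval_linear:
  assumes "adm_word (us @ (k, g) # vs)" "adm_word (us @ (k, h) # vs)"
  shows "wval (us @ (k, \<lambda>m. \<alpha> * g m + \<beta> * h m) # vs) = \<alpha> * wval (us @ (k, g) # vs) + \<beta> * wval (us @ (k, h) # vs)"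
proof -
  have "(\<lambda>N. \<alpha> * nsum (us @ (k, g) # vs) N + \<beta> * nsum (us @ (k, h) # vs) N) \<longlonglongrightarrow> \<alpha> * wval (us @ (k, g) # vs) + \<beta> * wval (us @ (k, h) # vs)"
    by (intro tendsto_add tendsto_mult_left nsum_tendsto_wval assms)
  moreover have "nsum (us @ (k, \<lambda>m. \<alpha> * g m + \<beta> * h m) # vs) = (\<lambda>N. \<alpha> * nsum (us @ (k, g) # vs) N + \<beta> * nsum (us @ (k, h) # vs) N)"
    by (rule ext) (rule nsum_linear)
  ultimately have "nsum (us @ (k, \<lambda>m. \<alpha> * g m + \<beta> * h m) # vs) \<longlonglongrightarrow> \<alpha> * wval (us @ (k, g) # vs) + \<beta> * wval (us @ (k, h) # vs)"
    by simp
  then show ?thesis unfolding wval_def by (rule limI)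
qed

text \<open>One half comes from splitting each parity class into symmetric and antiperiodic parts,
  the other from the value 2 of \<open>sgn_char\<close>. In the odd class g 3 comes before g 1
  because for \<sigma> = -1 the character is 2 at 3 and -2 at 1.\<close>

lemma per4_sgn_char_expand:
  assumes "per4 g"
  shows "g = (\<lambda>m. ((g 0 - g 2) / 4) * sgn_char (-1) 1 m + 1 * (\<lambda>m. ((g 3 - g 1) / 4) * sgn_char (-1) (-1) m +
    1 * (\<lambda>m. ((g 0 + g 2) / 4) * sgn_char 1 1 m + ((g 3 + g 1) / 4) * sgn_char 1 (-1) m) m) m)"
proof (rule per4_eqI[OF assms])
  have r: "g m \<in> \<rat>" for m using assms by (simp add: per4_def)
  show "per4 (\<lambda>m. ((g 0 - g 2) / 4) * sgn_char (-1) 1 m + 1 * (\<lambda>m. ((g 3 - g 1) / 4) * sgn_char (-1) (-1) m +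
    1 * (\<lambda>m. ((g 0 + g 2) / 4) * sgn_char 1 1 m + ((g 3 + g 1) / 4) * sgn_char 1 (-1) m) m) m)"
    by (intro per4_lin per4_sgn_char Rats_divide Rats_diff Rats_add r) simp_all
qed (auto simp: sgn_char_eq field_simps)

lemma per4_anti_sgn_char_expand:
  assumes "per4 g" "anti g"
  shows "g = (\<lambda>m. ((g 0 - g 2) / 4) * sgn_char (-1) 1 m + ((g 3 - g 1) / 4) * sgn_char (-1) (-1) m)"
proof (rule per4_eqI[OF assms(1)])
  have r: "g m \<in> \<rat>" for m using assms by (simp add: per4_def)
  show "per4 (\<lambda>m. ((g 0 - g 2) / 4) * sgn_char (-1) 1 m + ((g 3 - g 1) / 4) * sgn_char (-1) (-1) m)"
    by (intro per4_lin per4_sgn_char Rats_divide Rats_diff Rats_add r) simp_all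
  have "g (0 + 2) = - g 0" "g (1 + 2) = - g 1" using assms(2) unfolding anti_def by blast+
  then have "g 2 = - g 0" "g 3 = - g 1" by simp_all
  then show "g 0 = (g 0 - g 2) / 4 * sgn_char (- 1) 1 0 + (g 3 - g 1) / 4 * sgn_char (- 1) (- 1) 0"
    "g 1 = (g 0 - g 2) / 4 * sgn_char (- 1) 1 1 + (g 3 - g 1) / 4 * sgn_char (- 1) (- 1) 1"
    "g 2 = (g 0 - g 2) / 4 * sgn_char (- 1) 1 2 + (g 3 - g 1) / 4 * sgn_char (- 1) (- 1) 2"
    "g 3 = (g 0 - g 2) / 4 * sgn_char (- 1) 1 3 + (g 3 - g 1) / 4 * sgn_char (- 1) (- 1) 3"
    by (auto simp: sgn_char_eq field_simps)
qed

lemma sgn_word_snoc: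
  assumes "length \<sigma> = length k" "length \<epsilon> = length k"
  shows "sgn_word (k @ [k']) (\<sigma> @ [\<sigma>']) (\<epsilon> @ [\<epsilon>']) = sgn_word k \<sigma> \<epsilon> @ [(k', sgn_char \<sigma>' \<epsilon>')]"
  using assms by (auto simp: sgn_word_def nth_append)

text \<open>The prefix holds the letters already expanded in the four basis characters. A head
  letter of exponent 1 is antiperiodic, so only \<sigma> = -1 occurs in its expansion and all
  resulting indices stay admissible.\<close>

lemma wval_in_AMMV:
  assumes "length \<sigma> = length k" "length \<epsilon> = length k" "\<forall>x\<in>set k. x > 0" "set \<sigma> \<subseteq> {1, -1}" "set \<epsilon> \<subseteq> {1, -1}"
    and "k \<noteq> [] \<longrightarrow> (k ! 0, \<sigma> ! 0) \<noteq> (1, 1)" "k \<noteq> [] \<or> ws \<noteq> []"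
    and "adm_word (sgn_word k \<sigma> \<epsilon> @ ws)"
  shows "wval (sgn_word k \<sigma> \<epsilon> @ ws) \<in> AMMV (sum_list k + weight ws) (length k + length ws)"
  using assms
proof (induction ws arbitrary: k \<sigma> \<epsilon>)
  case Nil
  then have "admissible k \<sigma> \<epsilon>" by (simp add: admissible_def)
  then show ?case unfolding AMMV_def by (intro real_rat.span_base) (auto simp: ammv_eq)
next
  case (Cons a ws)
  let ?A = "AMMV (sum_list k + weight (a # ws)) (length k + length (a # ws))"
  let ?u = "sgn_word k \<sigma> \<epsilon>"
  have av: "fst a \<ge> 1" "per4 (snd a)" and wv: "list_all valid ws" and uv: "list_all valid ?u"
    using Cons.prems(8) by (auto simp: adm_word_def valid_def list_all_append)
  have r: "snd a m \<in> \<rat>" for m using av by (simp add: per4_def)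
  have adm_cond: "adm_word (?u @ (fst a, g) # ws)" if "per4 g" "k \<noteq> [] \<or> adm (fst a, g)" for g
  proof (cases "k = []")
    case True then show ?thesis using that av wv by (simp add: sgn_word_def adm_word_def valid_def)
  next
    case False
    then have "?u \<noteq> []" by (metis length_0_conv length_sgn_word)
    then have "adm (hd ?u)" using Cons.prems(8) by (simp add: adm_word_def)
    then show ?thesis using \<open>?u \<noteq> []\<close> that av wv uv by (simp add: adm_word_def valid_def list_all_append)
  qed
  have basis: "wval (?u @ (fst a, sgn_char s e) # ws) \<in> ?A"
    if "s \<in> {1, -1}" "e \<in> {1, -1}" "k \<noteq> [] \<or> fst a \<ge> 2 \<or> s = -1" for s e
  proof -
    have "adm (fst a, sgn_char s e)" if "k = []" using that \<open>k \<noteq> [] \<or> fst a \<ge> 2 \<or> s = -1\<close> anti_sgn_char \<open>e \<in> _\<close>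
      by (auto simp: adm_def)
    then have adw: "adm_word (?u @ (fst a, sgn_char s e) # ws)" using that by (intro adm_cond per4_sgn_char) auto
    have "wval (sgn_word (k @ [fst a]) (\<sigma> @ [s]) (\<epsilon> @ [e]) @ ws) \<in> AMMV (sum_list (k @ [fst a]) + weight ws) (length (k @ [fst a]) + length ws)"
    proof (rule Cons.IH)
      show "k @ [fst a] \<noteq> [] \<longrightarrow> ((k @ [fst a]) ! 0, (\<sigma> @ [s]) ! 0) \<noteq> (1, 1)"
        using Cons.prems(1,6) that by (cases "k = []") (auto simp: nth_append)
      show "adm_word (sgn_word (k @ [fst a]) (\<sigma> @ [s]) (\<epsilon> @ [e]) @ ws)"
        using adw Cons.prems(1,2) by (simp add: sgn_word_snoc)
    qed (use Cons.prems that av in auto)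
    then show ?thesis using Cons.prems(1,2) by (simp add: sgn_word_snoc add_ac)
  qed
  show ?case
  proof (cases "k \<noteq> [] \<or> fst a \<ge> 2")
    case True
    let ?q1 = "(snd a 0 - snd a 2) / 4" and ?q2 = "(snd a 3 - snd a 1) / 4"
      and ?q3 = "(snd a 0 + snd a 2) / 4" and ?q4 = "(snd a 3 + snd a 1) / 4"
    have q: "?q1 \<in> \<rat>" "?q2 \<in> \<rat>" "?q3 \<in> \<rat>" "?q4 \<in> \<rat>"
      by (intro Rats_divide Rats_diff Rats_add r; simp)+
    define g3 where "g3 = (\<lambda>m. ?q3 * sgn_char 1 1 m + ?q4 * sgn_char 1 (-1) m)"
    define g2 where "g2 = (\<lambda>m. ?q2 * sgn_char (-1) (-1) m + 1 * g3 m)"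
    have p3: "per4 g3" unfolding g3_def by (intro per4_lin per4_sgn_char q) simp_all
    have p2: "per4 g2" unfolding g2_def by (intro per4_lin per4_sgn_char q p3) simp_all
    have a: "a = (fst a, \<lambda>m. ?q1 * sgn_char (-1) 1 m + 1 * g2 m)"
      using per4_sgn_char_expand[OF av(2)] unfolding g2_def g3_def by (metis prod.collapse)
    have ad: "adm_word (?u @ (fst a, g) # ws)" if "per4 g" for g
      using True that by (intro adm_cond) (auto simp: adm_def)
    have 1: "wval (?u @ (fst a, \<lambda>m. ?q1 * sgn_char (-1) 1 m + 1 * g2 m) # ws) =
        ?q1 * wval (?u @ (fst a, sgn_char (-1) 1) # ws) + 1 * wval (?u @ (fst a, g2) # ws)"
      by (intro wval_linear ad per4_sgn_char p2) simp_all
    have 2: "wval (?u @ (fst a, g2) # ws) =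
        ?q2 * wval (?u @ (fst a, sgn_char (-1) (-1)) # ws) + 1 * wval (?u @ (fst a, g3) # ws)"
      unfolding g2_def by (intro wval_linear ad per4_sgn_char p3) simp_all
    have 3: "wval (?u @ (fst a, g3) # ws) =
        ?q3 * wval (?u @ (fst a, sgn_char 1 1) # ws) + ?q4 * wval (?u @ (fst a, sgn_char 1 (-1)) # ws)"
      unfolding g3_def by (intro wval_linear ad per4_sgn_char) simp_all
    have "wval (?u @ a # ws) = ?q1 * wval (?u @ (fst a, sgn_char (-1) 1) # ws) + 1 * (?q2 * wval (?u @ (fst a, sgn_char (-1) (-1)) # ws)
      + 1 * (?q3 * wval (?u @ (fst a, sgn_char 1 1) # ws) + ?q4 * wval (?u @ (fst a, sgn_char 1 (-1)) # ws)))"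
      by (subst a) (simp only: 1 2 3)
    also have "\<dots> \<in> ?A" using True
      by (intro AMMV_add AMMV_scale basis q) simp_all
    finally show ?thesis .
  next
    case False
    then have k: "k = []" "fst a = 1" using av by auto
    have an: "anti (snd a)" using Cons.prems(8) k by (simp add: adm_word_def sgn_word_def adm_def)
    let ?q1 = "(snd a 0 - snd a 2) / 4" and ?q2 = "(snd a 3 - snd a 1) / 4"
    have a: "a = (fst a, \<lambda>m. ?q1 * sgn_char (-1) 1 m + ?q2 * sgn_char (-1) (-1) m)"
      using per4_anti_sgn_char_expand[OF av(2) an] by (metis prod.collapse)
    have "wval (?u @ a # ws) = ?q1 * wval (?u @ (fst a, sgn_char (-1) 1) # ws) + ?q2 * wval (?u @ (fst a, sgn_char (-1) (-1)) # ws)"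
      by (subst a, subst wval_linear) (auto intro!: adm_cond per4_sgn_char simp: adm_def anti_sgn_char)
    also have "\<dots> \<in> ?A"
      by (intro AMMV_add AMMV_scale basis Rats_divide Rats_diff r) simp_all
    finally show ?thesis .
  qed
qed

lemma val_span_generator_in_AMMV:
  assumes "adm_word ws" "ws \<noteq> []" shows "wval ws \<in> AMMV (weight ws) (length ws)"
  using wval_in_AMMV[of "[]" "[]" "[]" ws] assms by (simp add: sgn_word_def)

section \<open>Comparison with \<open>AMMV_lower\<close>\<close>

lemma subspace_set_plus:
  assumes "real_rat.subspace A" "real_rat.subspace B"
  shows "real_rat.subspace (A + B)" "A \<subseteq> A + B" "B \<subseteq> A + B"
proof -
  show "real_rat.subspace (A + B)"
    using real_rat.subspace_sums[OF assms] by (simp add: set_plus_def setcompr_eq_image) (auto simp: set_plus_def elim!: back_subst[of real_rat.subspace])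
  show "A \<subseteq> A + B" using set_plus_intro[of _ A 0 B] real_rat.subspace_0[OF assms(2)] by fastforce
  show "B \<subseteq> A + B" using set_plus_intro[of 0 A _ B] real_rat.subspace_0[OF assms(1)] by fastforce
qed

lemma subspace_set_sum:
  assumes "finite I" "\<And>i. i \<in> I \<Longrightarrow> real_rat.subspace (A i)"
  shows "real_rat.subspace (\<Sum>i\<in>I. A i) \<and> (\<forall>i\<in>I. A i \<subseteq> (\<Sum>i\<in>I. A i))"
  using assms
proof (induction I rule: finite_induct)
  case empty
  then show ?case by (simp add: set_zero real_rat.subspace_single_0)
next
  case (insert x I)
  then have IH: "real_rat.subspace (sum A I)" "\<forall>i\<in>I. A i \<subseteq> sum A I" "real_rat.subspace (A x)" by auto
  show ?case using subspace_set_plus[OF IH(3,1)] IH(2) insert.hyps by auto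
qed

lemma AMMV_lower_subspace:
  shows "real_rat.subspace (AMMV_lower w r)"
    and "0 < l \<Longrightarrow> l < r \<Longrightarrow> AMMV w l \<subseteq> AMMV_lower w r"
    and "w1 + w2 = w \<Longrightarrow> w1 > 0 \<Longrightarrow> w2 > 0 \<Longrightarrow> d1 + d2 = r \<Longrightarrow> d1 > 0 \<Longrightarrow> d2 > 0 \<Longrightarrow>
      span_rat (AMMV w1 d1 * AMMV w2 d2) \<subseteq> AMMV_lower w r"
proof -
  let ?J = "{(w1, w2, d1, d2). w1 + w2 = w \<and> w1 > 0 \<and> w2 > 0 \<and> d1 + d2 = r \<and> d1 > 0 \<and> d2 > 0}"
  let ?P = "\<Sum>(w1, w2, d1, d2)\<in>?J. span_rat (AMMV w1 d1 * AMMV w2 d2)"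
  have A: "real_rat.subspace (\<Sum>l\<in>{0<..<r}. AMMV w l) \<and> (\<forall>l\<in>{0<..<r}. AMMV w l \<subseteq> (\<Sum>l\<in>{0<..<r}. AMMV w l))"
    by (rule subspace_set_sum) (auto simp: AMMV_def)
  have B: "real_rat.subspace ?P \<and> (\<forall>i\<in>?J. (case i of (w1, w2, d1, d2) \<Rightarrow> span_rat (AMMV w1 d1 * AMMV w2 d2)) \<subseteq> ?P)"
    by (rule subspace_set_sum[OF finite_AMMV_lower_index]) auto
  note S = subspace_set_plus[OF conjunct1[OF A] conjunct1[OF B], folded AMMV_lower_def]
  show "real_rat.subspace (AMMV_lower w r)" by (rule S(1))
  show "AMMV w l \<subseteq> AMMV_lower w r" if "0 < l" "l < r"
    using conjunct2[OF A] S(2) that by (meson greaterThanLessThan_iff order.trans)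
  show "span_rat (AMMV w1 d1 * AMMV w2 d2) \<subseteq> AMMV_lower w r"
    if "w1 + w2 = w" "w1 > 0" "w2 > 0" "d1 + d2 = r" "d1 > 0" "d2 > 0"
  proof -
    have "(w1, w2, d1, d2) \<in> ?J" using that by simp
    from bspec[OF conjunct2[OF B] this] show ?thesis using S(3) by simp
  qed
qed

text \<open>Positive weight excludes the empty word, which is not a mixed value of positive
  depth.\<close>

lemma val_span_subset_AMMV_lower: assumes "w > 0" "d < r" shows "val_span w d \<subseteq> AMMV_lower w r"
  unfolding val_span_def
proof (rule real_rat.span_minimal[OF _ AMMV_lower_subspace(1)])
  show "{wval ws |ws. adm_word ws \<and> weight ws = w \<and> length ws \<le> d} \<subseteq> AMMV_lower w r"
  proof clarify
    fix ws assume ws: "adm_word ws" "w = weight ws" "length ws \<le> d"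
    then have ne: "ws \<noteq> []" using assms(1) by auto
    then show "wval ws \<in> AMMV_lower (weight ws) r"
      using val_span_generator_in_AMMV[OF ws(1) ne] AMMV_lower_subspace(2)[of "length ws" r "weight ws"] ws assms by auto
  qed
qed

text \<open>Products in \<open>AMMV_lower\<close> require exact depths. If a factor is shorter than
  its bound, the quasi-shuffle product turns x y into words of depth below \<open>r\<close>
  instead.\<close>

lemma low_span_subset_AMMV_lower: assumes "w > 0" "r > 0" shows "low_span w r \<subseteq> AMMV_lower w r"
  unfolding low_span_def
proof (rule real_rat.span_minimal[OF _ AMMV_lower_subspace(1)])
  have "x * y \<in> AMMV_lower w r"
    if xy: "x \<in> val_span w1 d1" "y \<in> val_span w2 d2" and wd: "w1 + w2 = w" "d1 + d2 = r" "w1 > 0" "w2 > 0" "d1 > 0" "d2 > 0" for x y w1 w2 d1 d2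
  proof -
    have span: "span_rat (AMMV_lower w r) = AMMV_lower w r"
      using AMMV_lower_subspace(1) by (simp add: real_rat.span_eq_iff)
    have "x * y \<in> span_rat (AMMV_lower w r)"
    proof (rule span_rat_mult_closed[OF _ xy[unfolded val_span_def]])
      fix x y
      assume "x \<in> {wval ws |ws. adm_word ws \<and> weight ws = w1 \<and> length ws \<le> d1}" "y \<in> {wval ws |ws. adm_word ws \<and> weight ws = w2 \<and> length ws \<le> d2}"
      then obtain us vs where *: "x = wval us" "adm_word us" "weight us = w1" "length us \<le> d1"
        "y = wval vs" "adm_word vs" "weight vs = w2" "length vs \<le> d2" by blast
      have ne: "us \<noteq> []" "vs \<noteq> []" using * wd by auto
      have "x * y \<in> AMMV_lower w r"
      proof (cases "length us = d1 \<and> length vs = d2")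
        case True
        then have "x \<in> AMMV w1 d1" "y \<in> AMMV w2 d2" using val_span_generator_in_AMMV * ne by auto
        then have "x * y \<in> span_rat (AMMV w1 d1 * AMMV w2 d2)" by (intro real_rat.span_base set_times_intro)
        then show ?thesis using AMMV_lower_subspace(3)[OF wd(1,3,4,2,5,6)] by blast
      next
        case False
        then have "length us + length vs < r" using * wd by linarith
        moreover have "x * y \<in> val_span w (length us + length vs)"
          using val_span_mult[OF val_span_wval[OF *(2,3) order.refl] val_span_wval[OF *(6,7) order.refl]] * wd by simp
        ultimately show ?thesis using val_span_subset_AMMV_lower[OF assms(1)] by blast
      qed
      then show "x * y \<in> span_rat (AMMV_lower w r)" by (rule real_rat.span_base)
    qed
    then show ?thesis by (simp only: span)
  qed
  moreover have "val_span w (r - 1) \<subseteq> AMMV_lower w r" using assms by (intro val_span_subset_AMMV_lower) auto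
  ultimately show "val_span w (r - 1) \<union> {x * y |x y w1 w2 d1 d2. x \<in> val_span w1 d1 \<and> y \<in> val_span w2 d2 \<and>
     w1 + w2 = w \<and> d1 + d2 = r \<and> w1 > 0 \<and> w2 > 0 \<and> d1 > 0 \<and> d2 > 0} \<subseteq> AMMV_lower w r" by blast
qed

lemma nsum_scale_letters:
  assumes "length vs = length ws" "\<And>i m. i < length ws \<Longrightarrow> letter_fun (vs ! i) m = s i * letter_fun (ws ! i) m"
  shows "nsum vs N = (\<Prod>i<length ws. s i) * nsum ws N"
  using assms
proof (induction ws arbitrary: vs s N)
  case (Cons a ws)
  then obtain b us where vs: "vs = b # us" by (cases vs) auto
  have "nsum us M = (\<Prod>i<length ws. s (Suc i)) * nsum ws M" for M
    using Cons.prems(1) Cons.prems(2)[of "Suc _"] by (intro Cons.IH) (auto simp: vs)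
  moreover have "letter_fun b m = s 0 * letter_fun a m" for m using Cons.prems(2)[of 0] by (simp add: vs)
  ultimately show ?case
    by (simp add: vs nsum.simps sum_distrib_left prod.lessThan_Suc_shift mult_ac del: prod.lessThan_Suc)
qed simp

theorem theorem3p10:
  fixes r w :: nat and k :: "nat list" and \<sigma> \<epsilon> :: "int list"
  assumes "r \<ge> 2"
    and "length k = r" and "length \<sigma> = r" and "length \<epsilon> = r"
    and "\<forall>x\<in>set k. x > 0" and "sum_list k = w"
    and "set \<sigma> \<subseteq> {1, -1}" and "set \<epsilon> \<subseteq> {1, -1}"
    and "(k ! 0, \<sigma> ! 0) \<noteq> (1, 1)"
  shows "(1 - (-1) ^ (r + w) * (\<Prod>j<r. of_int (iota (\<sigma> ! j) (\<epsilon> ! j)))) * ammv k \<sigma> \<epsilon>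
           \<in> AMMV_lower w r"
proof -
  define ws where "ws = sgn_word k \<sigma> \<epsilon>"
  \<comment> \<open>The total sign under reflection: the letter at position j contributes (-1)^(k_j)
    from its denominator and \<open>iota\<close> from its character.\<close>
  define s where "s = (-1) ^ w * (\<Prod>j<r. real_of_int (iota (\<sigma> ! j) (\<epsilon> ! j)))"
  have adw: "adm_word ws" using assms unfolding ws_def by (intro adm_word_sgn_word) (auto simp: admissible_def)
  have len: "length ws = r" and wt: "weight ws = w" using assms by (simp_all add: ws_def weight_sgn_word)
  have ne: "ws \<noteq> []" using len assms(1) by auto
  obtain c where c: "log_reg w r (nsum (rev ws)) c" "c - (-1) ^ (r - 1) * wval ws \<in> low_span w r"
    using log_reg_rev[OF adw ne] unfolding len wt by blast
  have "s = real_of_int ((-1) ^ w * (\<Prod>j<r. iota (\<sigma> ! j) (\<epsilon> ! j)))" by (simp add: s_def)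
  then have sR: "s \<in> \<rat>" by (simp only: Rats_of_int)
  have "nsum (rev (map reflect ws)) N = s * nsum (rev ws) N" for N
  proof -
    let ?t = "\<lambda>j. (-1) ^ (k ! j) * real_of_int (iota (\<sigma> ! j) (\<epsilon> ! j))"
    have "nsum (rev (map reflect ws)) N = (\<Prod>i<length (rev ws). ?t (r - Suc i)) * nsum (rev ws) N"
    proof (rule nsum_scale_letters)
      fix i m assume "i < length (rev ws)"
      then have i: "i < r" by (simp add: len)
      let ?j = "r - Suc i"
      have j: "?j < r" using i by simp
      have "\<sigma> ! ?j \<in> set \<sigma>" "\<epsilon> ! ?j \<in> set \<epsilon>" using j assms(3,4) by simp_all
      then have se: "\<sigma> ! ?j \<in> {1, -1}" "\<epsilon> ! ?j \<in> {1, -1}" using assms(7,8) by (simp_all only: subset_eq)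
      have "rev ws ! i = (k ! ?j, sgn_char (\<sigma> ! ?j) (\<epsilon> ! ?j))" "rev (map reflect ws) ! i = reflect (rev ws ! i)"
        using i j len assms(2) by (simp_all add: rev_nth ws_def sgn_word_def)
      then show "letter_fun (rev (map reflect ws) ! i) m = ?t ?j * letter_fun (rev ws ! i) m"
        using sgn_char_uminus[OF se] by (simp add: letter_fun_def reflect_def)
    qed simp
    also have "(\<Prod>i<length (rev ws). ?t (r - Suc i)) = (\<Prod>j<r. ?t j)"
      unfolding length_rev len by (rule prod.nat_diff_reindex)
    also have "\<dots> = s"
      using assms(2,6) unfolding s_def prod.distrib
      by (simp add: power_sum[symmetric] sum_list_sum_nth lessThan_atLeast0)
    finally show ?thesis .
  qed
  then have "log_reg w r (nsum (rev (map reflect ws))) (s * c)"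
    using log_reg_scale[OF c(1) sR] by presburger
  then have "wval ws + s * c \<in> low_span w r" using parity_reversal[OF adw] assms(1) by (simp add: len wt)
  \<comment> \<open>Eliminates the constant \<open>c\<close> of the reversed word, which the
    antipode identifies with (-1)^(r - 1) \<open>wval ws\<close> modulo lower terms.\<close>
  then have "(wval ws + s * c) - s * (c - (-1) ^ (r - 1) * wval ws) \<in> low_span w r"
    by (intro low_span_diff low_span_scale sR c(2))
  also have "(wval ws + s * c) - s * (c - (-1) ^ (r - 1) * wval ws) = (1 - (-1) ^ r * s) * wval ws"
    using assms(1) by (cases r) (simp_all add: algebra_simps)
  finally have "(1 - (-1) ^ (r + w) * (\<Prod>j<r. of_int (iota (\<sigma> ! j) (\<epsilon> ! j)))) * ammv k \<sigma> \<epsilon> \<in> low_span w r"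
    by (simp add: s_def ammv_eq ws_def power_add mult.assoc)
  moreover have "w > 0" using valid_weight_pos[OF _ ne] adw wt by (simp add: adm_word_def)
  ultimately show ?thesis using low_span_subset_AMMV_lower[of w r] assms(1) by auto
qed

end
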